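(* Let $H\colon\mathbf{R}_{>0}^n\times\mathbf{R}^n\times\mathbf{R}_{\ge0}^k\to\mathbf{R}_{\ge0}$ be a pseudo length-type function, let $I\subset\{1,\dots,n\}$, and let $\widetilde H\colon F_I\times\mathbf{R}^n\times\mathbf{R}_{\ge0}^k\to\mathbf{R}_{\ge0}$, $\widetilde H(\mathbf{s}_n,\mathbf{t}_n,\mathbf{y}_k)=H(\Phi_I^{-1}(\mathbf{s}_n),\mathbf{t}_n,\mathbf{y}_k)$. There exist a partition of $F_I\times\mathbf{R}^n\times\mathbf{R}_{\ge0}^k$ into sets $U_1,\dots,U_N$, each the intersection of $F_I\times\mathbf{R}^n\times\mathbf{R}_{\ge0}^k$ with a cone defined by finitely many (strict or non-strict) linear inequalities, and linear isomorphisms $\Psi_1,\dots,\Psi_N\in\mathrm{GL}_{2n+k}(\mathbf{R})$ such that each $\Psi_i$ maps $U_i$ onto a product $\mathbf{R}_{>0}^{\#I}\times C_i$, where $C_i$ is an admissible polytope, and $\widetilde H\circ\Psi_i^{-1}\colon\mathbf{R}_{>0}^{\#I}\times C_i\to\mathbf{R}_{\ge0}$ is a simplified length-type function.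
   Context: Notation: $\mathbf{x}_n=(x_1,\dots,x_n)$, $\mathbf{0}_m$ is the zero vector of $\mathbf{R}^m$. Length-type: $h\colon\mathbf{R}_{>0}^n\times\mathbf{R}^n\times\mathbf{R}_{\ge0}^k\to\mathbf{R}_{\ge0}$ is length-type if it is proper and $$\cosh\Big(\frac{h(\mathbf{x}_n,\mathbf{t}_n,\mathbf{y}_k)}{2}\Big)=\frac1{\prod_{j=1}^n\sinh(\frac{x_j}{2})^{d_j}}\sum_{i=1}^p\sqrt{\sum_{T\in G_i}a_T^i e^{T(\mathbf{x}_n,\mathbf{t}_n,\mathbf{y}_k)}},$$ with $d_j\in\mathbf{N}_{\ge1}$, $G_i$ finite sets of linear forms on $\mathbf{R}^{2n+k}$, and all $a_T^i>0$. With $u(\ell)=2\log(2\cosh(\frac{\ell}{2}))$, $H$ is pseudo length-type if $u^{-1}\circ H$ is length-type. For $I\subset\{1,\dots,n\}$: $E_I=\{\mathbf{x}_n\in\mathbf{R}_{>0}^n : x_i\in(0,1)\ \forall i\in I,\ x_i\ge1\ \forall i\notin I\}$; $\Phi_I(\mathbf{x}_n)=\mathbf{s}_n$ with $s_i=-\log x_i$ for $i\in I$ and $s_i=x_i$ for $i\notin I$; $F_I=\Phi_I(E_I)=\{\mathbf{s}_n\in\mathbf{R}_{>0}^n : s_i\ge1\ \forall i\notin I\}$. Admissible polytope: $C\subset\mathbf{R}^q$ is an admissible polytope if $C\subset\{0\le x_1\le\cdots\le x_q\}$ and there exist a set $U$ defined by finitely many (strict or non-strict) linear inequalities, $m'\in\{0,\dots,q\}$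 and $\Psi\in\mathrm{GL}_q(\mathbf{R})$ with $C=\Psi(U\cap([1,+\infty)^{m'}\times\mathbf{R}^{q-m'}))$. Simplified length-type: let $C\subset\mathbf{R}^q$ be an admissible polytope with closure $\bar C$. A function $h\colon\mathbf{R}_{>0}^m\times C\to\mathbf{R}_{\ge0}$ is a simplified length-type function if it is real-analytic on an open neighbourhood of the closure of its domain and there exist a linear form $\Lambda$ on $\mathbf{R}^{m+q}$ and $\psi\in L^\infty(\mathbf{R}_{>0}^m\times C)$ such that: (i) $h=\Lambda+\psi$; (ii) $\Lambda$ is positive (away from the origin) and proper on $\mathbf{R}_{\ge0}^m\times\bar C$, and $\mathbf{s}_m\mapsto\Lambda(\mathbf{s}_m,0)$ has positive integer coefficients; (iii) there exist $c>0$ and linear forms $Y_1,\dots,Y_l$ on $\mathbf{R}^q$ such that for every $p\in\{1,\dots,q\}$ and $(\mathbf{s}_m,\mathbf{x}_q)\in\mathbf{R}_{>0}^m\times C$, $\big|\frac{\partial\psi}{\partial x_p}(\mathbf{s}_m,\mathbf{x}_q)\big|\le ce^{-\min\{x_p,Y_1(\mathbf{x}_q),\dots,Y_l(\mathbf{x}_q)\}}$, and, if $p_0=\max\{p : \frac{\partial\Lambda}{\partial x_p}\ne0\}$, there is $M>0$ such that $\Lambda(\mathbf{0}_m,\mathbf{x}_q)\le M\min\{x_{p_0},Y_1(\mathbf{x}_q),\dots,Y_l(\mathbf{x}_q)\}$ for all $\mathbf{x}_q\in C$. In the claim, the first $\#I$ coordinates of $\mathbf{R}_{>0}^{\#I}\times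 C_i$ play the role of $\mathbf{s}_m$ with $m=\#I$, and $C_i\subset\mathbf{R}^{2n+k-\#I}$. *)

theory Defs
  imports "HOL-Analysis.Analysis"
begin

text \<open>
  The dimensions n, k, the cardinality of I, and 2n + k minus that cardinality all occur in one
  statement, so R^d is not a type here: it is the library space \<^const>\<open>Euclidean_space\<close> d, whose
  points are the functions on the naturals that vanish at all indices \<open>\<ge> d\<close>. Coordinates are
  numbered from 0; the coordinate written x_i in the mathematics is \<open>x (i - 1)\<close>, and subsets of
  {1,...,n} become subsets of \<open>{..<n}\<close>.
\<close>

abbreviation Rn :: "nat \<Rightarrow> (nat \<Rightarrow> real) set" where
  "Rn d \<equiv> topspace (Euclidean_space d)"

definition Rpos :: "nat \<Rightarrow> (nat \<Rightarrow> real) set" where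
  "Rpos d = {x \<in> Rn d. \<forall>i<d. 0 < x i}"

definition Rnonneg :: "nat \<Rightarrow> (nat \<Rightarrow> real) set" where
  "Rnonneg d = {x \<in> Rn d. \<forall>i<d. 0 \<le> x i}"

text \<open>
  R^m x R^q is identified with R^(m+q) by concatenation; \<open>vprod m A B\<close> is the product
  A x B under this identification.
\<close>

definition vcat :: "nat \<Rightarrow> (nat \<Rightarrow> real) \<Rightarrow> (nat \<Rightarrow> real) \<Rightarrow> (nat \<Rightarrow> real)" where
  "vcat m x y = (\<lambda>i. if i < m then x i else y (i - m))"

definition vtake :: "nat \<Rightarrow> (nat \<Rightarrow> real) \<Rightarrow> (nat \<Rightarrow> real)" where
  "vtake m v = (\<lambda>i. if i < m then v i else 0)"

definition vdrop :: "nat \<Rightarrow> (nat \<Rightarrow> real) \<Rightarrow> (nat \<Rightarrow> real)" where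
  "vdrop m v = (\<lambda>i. v (m + i))"

definition vprod :: "nat \<Rightarrow> (nat \<Rightarrow> real) set \<Rightarrow> (nat \<Rightarrow> real) set \<Rightarrow> (nat \<Rightarrow> real) set" where
  "vprod m A B = {vcat m x y | x y. x \<in> A \<and> y \<in> B}"

text \<open>
  A linear form on R^d is given by its coefficient vector \<open>T \<in> Rn d\<close>; in particular the
  partial derivative of the form in direction i is the number \<open>T i\<close>.
\<close>

definition lform :: "nat \<Rightarrow> (nat \<Rightarrow> real) \<Rightarrow> (nat \<Rightarrow> real) \<Rightarrow> real" where
  "lform d T x = (\<Sum>i<d. T i * x i)"

definition GL :: "nat \<Rightarrow> ((nat \<Rightarrow> real) \<Rightarrow> (nat \<Rightarrow> real)) set" where
  "GL d = {\<Psi>. bij_betw \<Psi> (Rn d) (Rn d)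
      \<and> (\<forall>x\<in>Rn d. \<forall>y\<in>Rn d. \<Psi> (\<lambda>i. x i + y i) = (\<lambda>i. \<Psi> x i + \<Psi> y i))
      \<and> (\<forall>r. \<forall>x\<in>Rn d. \<Psi> (\<lambda>i. r * x i) = (\<lambda>i. r * \<Psi> x i))}"

text \<open>Linear inequalities are homogeneous, so the sets they define are cones.\<close>

definition linear_cone :: "nat \<Rightarrow> (nat \<Rightarrow> real) set \<Rightarrow> bool" where
  "linear_cone d K \<longleftrightarrow>
     (\<exists>A B. finite A \<and> finite B \<and> A \<subseteq> Rn d \<and> B \<subseteq> Rn d
        \<and> K = {x \<in> Rn d. (\<forall>T\<in>A. 0 \<le> lform d T x) \<and> (\<forall>T\<in>B. 0 < lform d T x)})"

definition length_dom :: "nat \<Rightarrow> nat \<Rightarrow> (nat \<Rightarrow> real) set" where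
  "length_dom n k = vprod n (Rpos n) (vprod n (Rn n) (Rnonneg k))"

definition length_type :: "nat \<Rightarrow> nat \<Rightarrow> ((nat \<Rightarrow> real) \<Rightarrow> real) \<Rightarrow> bool" where
  "length_type n k h \<longleftrightarrow>
     (\<forall>v\<in>length_dom n k. 0 \<le> h v)
     \<and> proper_map (subtopology (Euclidean_space (2*n + k)) (length_dom n k))
                  (top_of_set {0..}) h
     \<and> (\<exists>(d :: nat \<Rightarrow> nat) (p :: nat) (G :: nat \<Rightarrow> (nat \<Rightarrow> real) set) (a :: nat \<Rightarrow> (nat \<Rightarrow> real) \<Rightarrow> real).
          (\<forall>j<n. 1 \<le> d j)
          \<and> (\<forall>i<p. finite (G i) \<and> G i \<subseteq> Rn (2*n + k) \<and> (\<forall>T\<in>G i. 0 < a i T))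
          \<and> (\<forall>v\<in>length_dom n k.
               cosh (h v / 2) =
                 1 / (\<Prod>j<n. sinh (v j / 2) ^ d j)
                 * (\<Sum>i<p. sqrt (\<Sum>T\<in>G i. a i T * exp (lform (2*n + k) T v)))))"

definition u_fun :: "real \<Rightarrow> real" where
  "u_fun l = 2 * ln (2 * cosh (l / 2))"

text \<open>
  On nonnegative reals \<^const>\<open>u_fun\<close> is injective with range [2 log 2, +oo), so that the
  composite of its inverse with H only makes sense if H takes its values in that range.
\<close>

definition pseudo_length_type :: "nat \<Rightarrow> nat \<Rightarrow> ((nat \<Rightarrow> real) \<Rightarrow> real) \<Rightarrow> bool" where
  "pseudo_length_type n k H \<longleftrightarrow>
     (\<forall>v\<in>length_dom n k. H v \<in> u_fun ` {0..})
     \<and> length_type n k (inv_into {0..} u_fun \<circ> H)"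

definition E_set :: "nat \<Rightarrow> nat set \<Rightarrow> (nat \<Rightarrow> real) set" where
  "E_set n I = {x \<in> Rpos n. \<forall>i<n. if i \<in> I then 0 < x i \<and> x i < 1 else 1 \<le> x i}"

definition Phi :: "nat set \<Rightarrow> (nat \<Rightarrow> real) \<Rightarrow> (nat \<Rightarrow> real)" where
  "Phi I x = (\<lambda>i. if i \<in> I then - ln (x i) else x i)"

definition F_set :: "nat \<Rightarrow> nat set \<Rightarrow> (nat \<Rightarrow> real) set" where
  "F_set n I = Phi I ` E_set n I"

definition tilde_dom :: "nat \<Rightarrow> nat \<Rightarrow> nat set \<Rightarrow> (nat \<Rightarrow> real) set" where
  "tilde_dom n k I = vprod n (F_set n I) (vprod n (Rn n) (Rnonneg k))"

definition H_tilde ::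
    "nat \<Rightarrow> nat set \<Rightarrow> ((nat \<Rightarrow> real) \<Rightarrow> real) \<Rightarrow> (nat \<Rightarrow> real) \<Rightarrow> real" where
  "H_tilde n I H v = H (vcat n (inv_into (E_set n I) (Phi I) (vtake n v)) (vdrop n v))"

definition admissible_polytope :: "nat \<Rightarrow> (nat \<Rightarrow> real) set \<Rightarrow> bool" where
  "admissible_polytope q C \<longleftrightarrow>
     C \<subseteq> {x \<in> Rn q. (\<forall>i<q. 0 \<le> x i) \<and> (\<forall>j<q. \<forall>i\<le>j. x i \<le> x j)}
     \<and> (\<exists>U m' \<Psi>. linear_cone q U \<and> m' \<le> q \<and> \<Psi> \<in> GL q
          \<and> C = \<Psi> ` (U \<inter> {x \<in> Rn q. \<forall>i<m'. 1 \<le> x i}))"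

text \<open>
  Real-analyticity: near each point the function is the sum of an (unconditionally)
  convergent power series; the index set consists of the multi-indices in d variables.
\<close>

definition real_analytic_on ::
    "nat \<Rightarrow> ((nat \<Rightarrow> real) \<Rightarrow> real) \<Rightarrow> (nat \<Rightarrow> real) set \<Rightarrow> bool" where
  "real_analytic_on d f V \<longleftrightarrow>
     (\<forall>a\<in>V. \<exists>r>0. \<exists>c :: (nat \<Rightarrow> nat) \<Rightarrow> real.
        \<forall>x\<in>V. (\<forall>i<d. \<bar>x i - a i\<bar> < r) \<longrightarrow>
          ((\<lambda>\<alpha>. c \<alpha> * (\<Prod>i<d. (x i - a i) ^ \<alpha> i)) has_sum f x) {\<alpha>. \<forall>i\<ge>d. \<alpha> i = 0})"

definition partial_deriv ::
    "nat \<Rightarrow> ((nat \<Rightarrow> real) \<Rightarrow> real) \<Rightarrow> (nat \<Rightarrow> real) \<Rightarrow> real" where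
  "partial_deriv i f x = deriv (\<lambda>t. f (x(i := t))) (x i)"

text \<open>
  The function h lives on the product \<open>D = vprod m (Rpos m) C\<close>. It is analytic on an open
  neighbourhood V of the closure of D in the sense that some analytic g on V restricts to h; the
  splitting g = Lambda + psi is used on all of V, so that the partial derivatives of psi make sense
  at the points of D even when C has empty interior. Since psi is continuous, membership in
  L-infinity is expressed as boundedness on D (for C of measure zero the essential bound
  would say nothing). The clause involving \<open>Max\<close> is void if no coordinate of the second
  factor occurs in Lambda, as there is then no index p_0.
\<close>

definition simplified_length_type ::
    "nat \<Rightarrow> nat \<Rightarrow> (nat \<Rightarrow> real) set \<Rightarrow> ((nat \<Rightarrow> real) \<Rightarrow> real) \<Rightarrow> bool" where
  "simplified_length_type m q C h \<longleftrightarrow>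
     (let D = vprod m (Rpos m) C;
          D' = vprod m (Rnonneg m) (Euclidean_space q closure_of C)
      in (\<forall>v\<in>D. 0 \<le> h v)
       \<and> (\<exists>V g \<Lambda> \<psi>.
            openin (Euclidean_space (m + q)) V
          \<and> Euclidean_space (m + q) closure_of D \<subseteq> V
          \<and> real_analytic_on (m + q) g V
          \<and> (\<forall>v\<in>D. h v = g v)
          \<and> \<Lambda> \<in> Rn (m + q)
          \<and> (\<forall>v\<in>V. g v = lform (m + q) \<Lambda> v + \<psi> v)
          \<and> bounded (\<psi> ` D)
          \<and> (\<forall>v\<in>D'. v \<noteq> (\<lambda>_. 0) \<longrightarrow> 0 < lform (m + q) \<Lambda> v)
          \<and> proper_map (subtopology (Euclidean_space (m + q)) D') euclideanreal (lform (m + q) \<Lambda>)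
          \<and> (\<forall>i<m. \<Lambda> i \<in> \<int> \<and> 0 < \<Lambda> i)
          \<and> (\<exists>c>0. \<exists>Y. finite Y \<and> Y \<subseteq> Rn q
              \<and> (\<forall>p<q. \<forall>s\<in>Rpos m. \<forall>x\<in>C.
                    \<bar>partial_deriv (m + p) \<psi> (vcat m s x)\<bar>
                      \<le> c * exp (- Min (insert (x p) ((\<lambda>T. lform q T x) ` Y))))
              \<and> (let P = {p. p < q \<and> \<Lambda> (m + p) \<noteq> 0}
                 in P \<noteq> {} \<longrightarrow>
                    (\<exists>M>0. \<forall>x\<in>C. lform (m + q) \<Lambda> (vcat m (\<lambda>_. 0) x)
                        \<le> M * Min (insert (x (Max P)) ((\<lambda>T. lform q T x) ` Y)))))))"

end

theory Submission
  imports Defs "HOL-Library.Function_Algebras"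
begin

text \<open>
  After taking logarithms, H is a sum of one-variable terms - 2 d log sinh, which are linear up to a
  bounded correction, and of 2 log of a sum of square roots of exponential sums, which differs from
  its largest exponent by a bounded amount. Cut the domain by the order in which a finite set of
  linear forms is arranged: the coordinates not in I, their negatives, and half the differences of
  the exponents restricted to these coordinates. On such a cell one exponent dominates all others.
  Scanning the forms that are nonnegative on the cell in increasing order and keeping each one that
  is independent of its predecessors produces the new coordinates x_1 <= ... <= x_q. Every
  nonnegative form L is then a combination of coordinates x_p <= L. The correction terms are functions
  of exp (- L), and their derivative in direction x_p vanishes unless x_p occurs in L, so it is
  O(exp (- x_p)); hence the estimate (iii) holds without any auxiliary forms Y_j. Coercivity of Lambda
  comes from properness of h, applied along s = (1,...,1), because u(l) >= l.
\<close>

section \<open>Power series in several variables\<close>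

text \<open>The coordinates s_i with i in I stay outside the cell structure: there x_i = exp (- s_i)
  lies in (0,1), so they change each exponential only by a bounded factor, and condition (iii) asks
  for no derivative in their directions. Half differences are forced by the square roots. A set G_i
  without the dominant exponent gives a normalised radicand Q that may be arbitrarily small, so Q' /
  (2 sqrt Q) cannot be estimated through a lower bound of Q. Every term b of Q satisfies b / sqrt Q
  <= sqrt b, and this leaves the exponential of minus half the difference. Negatives of coordinates
  are included because twists have no sign, while at every point the nonnegative forms must span the
  dual space. Ties may give cells with empty interior, but the basis is one of the whole space and
  the functions live on an open set. The conditions s_i >= 1 keep cells from being cones; only
  scalings by r >= 1 preserve them. This suffices: if Lambda were <= 0 at a nonzero point of the
  closure, a whole ray would lie in a sublevel set that coercivity makes bounded.\<close>

definition multi_indices :: "nat \<Rightarrow> (nat \<Rightarrow> nat) set" where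
  "multi_indices d = {\<alpha>. \<forall>i\<ge>d. \<alpha> i = 0}"

definition monomial :: "nat \<Rightarrow> (nat \<Rightarrow> real) \<Rightarrow> (nat \<Rightarrow> nat) \<Rightarrow> real" where
  "monomial d x \<alpha> = (\<Prod>i<d. x i ^ \<alpha> i)"

text \<open>The point x ranges over all functions whose first d coordinates are close to those of a,
  with no domain V and no condition on later coordinates. Closure under arithmetic operations then
  needs no care about domains, and \<open>real_analytic_onI\<close> restricts to any V at the
  end.\<close>

definition analytic_near :: "nat \<Rightarrow> ((nat \<Rightarrow> real) \<Rightarrow> real) \<Rightarrow> (nat \<Rightarrow> real) \<Rightarrow> bool" where
  "analytic_near d f a \<longleftrightarrow>
     (\<exists>r>0. \<exists>c. \<forall>x. (\<forall>i<d. \<bar>x i - a i\<bar> < r) \<longrightarrow>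
        ((\<lambda>\<alpha>. c \<alpha> * monomial d (\<lambda>i. x i - a i) \<alpha>) has_sum f x) (multi_indices d))"

lemma analytic_nearE:
  assumes "analytic_near d f a"
  obtains r c where "r > 0"
    "\<forall>x. (\<forall>i<d. \<bar>x i - a i\<bar> < r) \<longrightarrow>
       ((\<lambda>\<alpha>. c \<alpha> * monomial d (\<lambda>i. x i - a i) \<alpha>) has_sum f x) (multi_indices d)"
  using assms unfolding analytic_near_def by blast

lemma real_analytic_onI:
  assumes "\<And>a. a \<in> V \<Longrightarrow> analytic_near d f a"
  shows "real_analytic_on d f V"
  unfolding real_analytic_on_def
proof
  fix a assume "a \<in> V"
  from assms[OF this] obtain r c where "r > 0"
    "\<forall>x. (\<forall>i<d. \<bar>x i - a i\<bar> < r) \<longrightarrow>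
       ((\<lambda>\<alpha>. c \<alpha> * monomial d (\<lambda>i. x i - a i) \<alpha>) has_sum f x) (multi_indices d)"
    by (rule analytic_nearE)
  then show "\<exists>r>0. \<exists>c. \<forall>x\<in>V. (\<forall>i<d. \<bar>x i - a i\<bar> < r) \<longrightarrow>
      ((\<lambda>\<alpha>. c \<alpha> * (\<Prod>i<d. (x i - a i) ^ \<alpha> i)) has_sum f x) {\<alpha>. \<forall>i\<ge>d. \<alpha> i = 0}"
    unfolding monomial_def multi_indices_def by blast
qed

lemma monomial_zero_index [simp]: "monomial d x (\<lambda>_. 0) = 1"
  by (simp add: monomial_def)

lemma monomial_add: "monomial d x (\<lambda>i. \<alpha> i + \<beta> i) = monomial d x \<alpha> * monomial d x \<beta>"
  by (simp add: monomial_def power_add prod.distrib)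

lemma zero_in_multi_indices [simp]: "(\<lambda>_. 0) \<in> multi_indices d"
  by (simp add: multi_indices_def)

lemma monomial_zero_point:
  assumes "\<alpha> \<in> multi_indices d" "\<alpha> \<noteq> (\<lambda>_. 0)"
  shows "monomial d (\<lambda>_. 0) \<alpha> = 0"
proof -
  obtain i where i: "\<alpha> i \<noteq> 0" using assms(2) by auto
  then have "i < d" using assms(1) linorder_not_less unfolding multi_indices_def by blast
  with i show ?thesis unfolding monomial_def by (intro prod_zero bexI[of _ i]) auto
qed

lemma analytic_near_const: "analytic_near d (\<lambda>_. c) a"
  unfolding analytic_near_def
proof (intro exI[of _ "1::real"] conjI exI[of _ "\<lambda>\<alpha>. if \<alpha> = (\<lambda>_. 0) then c else 0"] allI impI)
  fix x show "((\<lambda>\<alpha>. (if \<alpha> = (\<lambda>_. 0) then c else 0) * monomial d (\<lambda>i. x i - a i) \<alpha>) has_sum c)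
      (multi_indices d)"
    by (rule has_sum_finite_neutralI[of "{\<lambda>_. 0}"]) auto
qed auto

lemma analytic_near_add:
  assumes "analytic_near d f a" "analytic_near d g a"
  shows "analytic_near d (\<lambda>x. f x + g x) a"
proof -
  obtain r c where r: "r > 0" and f: "\<forall>x. (\<forall>i<d. \<bar>x i - a i\<bar> < r) \<longrightarrow>
       ((\<lambda>\<alpha>. c \<alpha> * monomial d (\<lambda>i. x i - a i) \<alpha>) has_sum f x) (multi_indices d)"
    by (rule analytic_nearE[OF assms(1)])
  obtain r' c' where r': "r' > 0" and g: "\<forall>x. (\<forall>i<d. \<bar>x i - a i\<bar> < r') \<longrightarrow>
       ((\<lambda>\<alpha>. c' \<alpha> * monomial d (\<lambda>i. x i - a i) \<alpha>) has_sum g x) (multi_indices d)"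
    by (rule analytic_nearE[OF assms(2)])
  show ?thesis
    unfolding analytic_near_def
  proof (intro exI[of _ "min r r'"] conjI exI[of _ "\<lambda>\<alpha>. c \<alpha> + c' \<alpha>"] allI impI)
    fix x assume "\<forall>i<d. \<bar>x i - a i\<bar> < min r r'"
    then show "((\<lambda>\<alpha>. (c \<alpha> + c' \<alpha>) * monomial d (\<lambda>i. x i - a i) \<alpha>) has_sum f x + g x) (multi_indices d)"
      using has_sum_add[OF f[rule_format, of x] g[rule_format, of x]] by (simp add: distrib_right)
  qed (use r r' in auto)
qed

lemma analytic_near_cmult:
  assumes "analytic_near d f a"
  shows "analytic_near d (\<lambda>x. k * f x) a"
proof -
  obtain r c where r: "r > 0" and f: "\<forall>x. (\<forall>i<d. \<bar>x i - a i\<bar> < r) \<longrightarrow>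
       ((\<lambda>\<alpha>. c \<alpha> * monomial d (\<lambda>i. x i - a i) \<alpha>) has_sum f x) (multi_indices d)"
    by (rule analytic_nearE[OF assms])
  show ?thesis
    unfolding analytic_near_def
  proof (intro exI[of _ r] conjI exI[of _ "\<lambda>\<alpha>. k * c \<alpha>"] allI impI)
    fix x assume "\<forall>i<d. \<bar>x i - a i\<bar> < r"
    then show "((\<lambda>\<alpha>. k * c \<alpha> * monomial d (\<lambda>i. x i - a i) \<alpha>) has_sum k * f x) (multi_indices d)"
      using has_sum_cmult_right[OF f[rule_format, of x], of k] by (simp add: mult.assoc)
  qed (use r in auto)
qed

lemma analytic_near_sum:
  assumes "\<And>i. i \<in> A \<Longrightarrow> analytic_near d (f i) a"
  shows "analytic_near d (\<lambda>x. \<Sum>i\<in>A. f i x) a"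
  using assms by (induction A rule: infinite_finite_induct) (auto intro: analytic_near_const analytic_near_add)

lemma analytic_near_coord:
  assumes "j < d"
  shows "analytic_near d (\<lambda>x. x j) a"
proof -
  define e :: "nat \<Rightarrow> nat" where "e = (\<lambda>i. if i = j then 1 else 0)"
  have e0: "e \<noteq> (\<lambda>_. 0)" unfolding e_def by (auto simp: fun_eq_iff)
  have e: "e \<in> multi_indices d" using assms by (auto simp: e_def multi_indices_def)
  have "monomial d x e = x j" for x
    using assms prod.remove[of "{..<d}" j "\<lambda>i. x i ^ e i"] by (simp add: monomial_def e_def)
  then have "((\<lambda>\<alpha>. (if \<alpha> = (\<lambda>_. 0) then a j else if \<alpha> = e then 1 else 0) * monomial d (\<lambda>i. x i - a i) \<alpha>)
     has_sum x j) (multi_indices d)" for x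
    using e0 e0[symmetric] e by (intro has_sum_finite_neutralI[of "{\<lambda>_. 0, e}"]) auto
  then show ?thesis unfolding analytic_near_def by (intro exI[of _ "1::real"] conjI exI) auto
qed

lemma analytic_near_lform: "analytic_near d (lform d T) a"
  unfolding lform_def by (intro analytic_near_sum analytic_near_cmult analytic_near_coord) auto

section \<open>Unconditional sums over products and over finite lists\<close>

text \<open>For real series unconditional and absolute convergence coincide, so the products of
  absolute values are summable over pairs and the iterated sum is the double sum.\<close>

lemma has_sum_times:
  fixes f :: "'a \<Rightarrow> real" and g :: "'b \<Rightarrow> real"
  assumes f: "(f has_sum s) A" and g: "(g has_sum t) B"
  shows "((\<lambda>(x, y). f x * g y) has_sum s * t) (A \<times> B)"
proof (rule has_sum_SigmaI)
  show "((\<lambda>y. case (x, y) of (x, y) \<Rightarrow> f x * g y) has_sum f x * t) B" for x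
    using has_sum_cmult_right[OF g, of "f x"] by simp
  show "((\<lambda>x. f x * t) has_sum s * t) A" using has_sum_cmult_left[OF f] .
  have fa: "(\<lambda>x. \<bar>f x\<bar>) summable_on A" and ga: "(\<lambda>x. \<bar>g x\<bar>) summable_on B"
    using summable_on_iff_abs_summable_on_real[THEN iffD1, OF has_sum_imp_summable[OF f]]
      summable_on_iff_abs_summable_on_real[THEN iffD1, OF has_sum_imp_summable[OF g]] by simp_all
  have "(\<lambda>(x, y). \<bar>f x\<bar> * \<bar>g y\<bar>) summable_on A \<times> B"
  proof (rule summable_on_SigmaI)
    show "((\<lambda>y. case (x, y) of (x, y) \<Rightarrow> \<bar>f x\<bar> * \<bar>g y\<bar>) has_sum \<bar>f x\<bar> * infsum (\<lambda>x. \<bar>g x\<bar>) B) B" for x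
      using has_sum_cmult_right[OF has_sum_infsum[OF ga], of "\<bar>f x\<bar>"] by simp
    show "(\<lambda>x. \<bar>f x\<bar> * infsum (\<lambda>x. \<bar>g x\<bar>) B) summable_on A"
      using summable_on_cmult_left[OF fa] .
  qed auto
  then show "(\<lambda>(x, y). f x * g y) summable_on A \<times> B"
    by - (rule abs_summable_summable, simp add: case_prod_unfold abs_mult)
qed

text \<open>Expansion of s ^ n into words of length n, with equal products left uncollected. The
  induction step peels off the first letter.\<close>

lemma has_sum_prod_list:
  fixes f :: "'a \<Rightarrow> real"
  assumes "(f has_sum s) A"
  shows "((\<lambda>xs. prod_list (map f xs)) has_sum s ^ n) {xs. set xs \<subseteq> A \<and> length xs = n}"
proof (induction n)
  case 0
  have "{xs. set xs \<subseteq> A \<and> length xs = 0} = {[]}" by auto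
  then show ?case by (simp add: has_sum_finiteI)
next
  case (Suc n)
  have eq: "{xs. set xs \<subseteq> A \<and> length xs = Suc n} =
     (\<lambda>(x, xs). x # xs) ` (A \<times> {xs. set xs \<subseteq> A \<and> length xs = n})"
    by (auto simp: length_Suc_conv image_iff)
  have inj: "inj_on (\<lambda>(x, xs). x # xs) (A \<times> {xs. set xs \<subseteq> A \<and> length xs = n})"
    by (auto simp: inj_on_def)
  show ?case
    unfolding eq has_sum_reindex[OF inj]
    using has_sum_times[OF assms Suc.IH] by (simp add: o_def case_prod_unfold)
qed

text \<open>Summing over the words of each length n first gives b n * s ^ n. Combining the lengths
  needs absolute summability of the double family, hence convergence at s', the sum of the absolute
  values, and not only at s.\<close>

lemma has_sum_lists:
  fixes f :: "'a \<Rightarrow> real"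
  assumes f: "(f has_sum s) A" and fa: "((\<lambda>x. \<bar>f x\<bar>) has_sum s') A"
    and b: "(\<lambda>n. b n * s ^ n) sums t" and ba: "summable (\<lambda>n. \<bar>b n\<bar> * s' ^ n)"
  shows "((\<lambda>xs. b (length xs) * prod_list (map f xs)) has_sum t) {xs. set xs \<subseteq> A}"
proof -
  define L where "L n = {xs. set xs \<subseteq> A \<and> length xs = n}" for n
  have s': "0 \<le> s'" using has_sum_nonneg[OF fa] by auto
  have ss: "\<bar>s\<bar> \<le> s'"
    using norm_infsum_bound[of f A] has_sum_imp_summable[OF fa] infsumI[OF f] infsumI[OF fa] by simp
  have abs_prod: "\<bar>prod_list (map f xs)\<bar> = prod_list (map (\<lambda>x. \<bar>f x\<bar>) xs)" for xs
    by (induction xs) (auto simp: abs_mult)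
  have "((\<lambda>(n, xs). b n * prod_list (map f xs)) has_sum t) (Sigma UNIV L)"
  proof (rule has_sum_SigmaI)
    show "((\<lambda>xs. case (n, xs) of (n, xs) \<Rightarrow> b n * prod_list (map f xs)) has_sum b n * s ^ n) (L n)" for n
      using has_sum_cmult_right[OF has_sum_prod_list[OF f, of n], of "b n"] by (simp add: L_def)
    have "summable (\<lambda>n. norm (b n * s ^ n))"
      by (rule summable_comparison_test'[OF ba, of 0])
        (auto simp: abs_mult power_abs intro!: mult_left_mono power_mono ss)
    then show "((\<lambda>n. b n * s ^ n) has_sum t) UNIV"
      by (rule norm_summable_imp_has_sum[OF _ b])
    have "(\<lambda>(n, xs). \<bar>b n\<bar> * prod_list (map (\<lambda>x. \<bar>f x\<bar>) xs)) summable_on Sigma UNIV L"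
    proof (rule summable_on_SigmaI)
      show "((\<lambda>xs. case (n, xs) of (n, xs) \<Rightarrow> \<bar>b n\<bar> * prod_list (map (\<lambda>x. \<bar>f x\<bar>) xs)) has_sum \<bar>b n\<bar> * s' ^ n) (L n)" for n
        using has_sum_cmult_right[OF has_sum_prod_list[OF fa, of n], of "\<bar>b n\<bar>"] by (simp add: L_def)
      show "(\<lambda>n. \<bar>b n\<bar> * s' ^ n) summable_on UNIV"
        using ba s' by (intro norm_summable_imp_summable_on) (simp add: abs_mult)
      show "0 \<le> (case (n, xs) of (n, xs) \<Rightarrow> \<bar>b n\<bar> * prod_list (map (\<lambda>x. \<bar>f x\<bar>) xs))" for n xs
        by (simp flip: abs_prod)
    qed
    then show "(\<lambda>(n, xs). b n * prod_list (map f xs)) summable_on Sigma UNIV L"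
      by - (rule abs_summable_summable, simp add: case_prod_unfold abs_mult abs_prod)
  qed
  moreover have "Sigma UNIV L = (\<lambda>xs. (length xs, xs)) ` {xs. set xs \<subseteq> A}"
    by (auto simp: L_def)
  moreover have "inj_on (\<lambda>xs. (length xs, xs)) {xs. set xs \<subseteq> A}" by (auto simp: inj_on_def)
  ultimately show ?thesis by (simp add: has_sum_reindex o_def)
qed

lemma monomial_scale: "monomial d (\<lambda>i. t * x i) \<alpha> = t ^ (\<Sum>i<d. \<alpha> i) * monomial d x \<alpha>"
  by (simp add: monomial_def power_mult_distrib prod.distrib power_sum)

text \<open>A nonconstant monomial has degree at least 1, so shrinking the polydisc by t <= 1 gains
  a factor t. This makes the nonconstant part of a power series absolutely small.\<close>

lemma monomial_bound:
  assumes "\<alpha> \<in> multi_indices d" "\<alpha> \<noteq> (\<lambda>_. 0)" "0 \<le> t" "t \<le> 1" "0 \<le> r" "\<And>i. i < d \<Longrightarrow> \<bar>x i\<bar> \<le> t * r"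
  shows "\<bar>monomial d x \<alpha>\<bar> \<le> t * monomial d (\<lambda>_. r) \<alpha>"
proof -
  obtain i where i: "\<alpha> i \<noteq> 0" using assms(2) by auto
  then have "i < d" using assms(1) linorder_not_less unfolding multi_indices_def by blast
  then have "\<alpha> i \<le> (\<Sum>i<d. \<alpha> i)" by (intro member_le_sum) auto
  then have *: "t ^ (\<Sum>i<d. \<alpha> i) \<le> t"
    using i assms(3,4) power_decreasing[of 1 "\<Sum>i<d. \<alpha> i" t] by auto
  have "\<bar>monomial d x \<alpha>\<bar> \<le> monomial d (\<lambda>i. t * r) \<alpha>"
    unfolding monomial_def abs_prod power_abs by (intro prod_mono) (auto intro!: power_mono assms)
  also have "\<dots> = t ^ (\<Sum>i<d. \<alpha> i) * monomial d (\<lambda>_. r) \<alpha>" by (rule monomial_scale)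
  also have "\<dots> \<le> t * monomial d (\<lambda>_. r) \<alpha>"
    using * assms(5) by (intro mult_right_mono) (auto simp: monomial_def intro!: prod_nonneg)
  finally show ?thesis .
qed

text \<open>
  Substituting the series of f - f a into that of F gives a sum over finite lists of nonzero
  multi-indices; grouping the lists by their sum yields a power series again.
\<close>

lemma analytic_near_compose:
  assumes f: "analytic_near d f a" and \<rho>: "\<rho> > 0"
    and F: "\<And>y. \<bar>y - f a\<bar> < \<rho> \<Longrightarrow> (\<lambda>n. b n * (y - f a) ^ n) sums F y"
  shows "analytic_near d (\<lambda>x. F (f x)) a"
proof -
  obtain r c where r: "r > 0" and c: "\<forall>x. (\<forall>i<d. \<bar>x i - a i\<bar> < r) \<longrightarrow>
       ((\<lambda>\<alpha>. c \<alpha> * monomial d (\<lambda>i. x i - a i) \<alpha>) has_sum f x) (multi_indices d)"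
    by (rule analytic_nearE[OF f])
  define h where "h x \<alpha> = c \<alpha> * monomial d (\<lambda>i. x i - a i) \<alpha>" for x \<alpha>
  define A where "A = multi_indices d - {\<lambda>_. 0}"
  have "(h a has_sum c (\<lambda>_. 0)) (multi_indices d)"
    by (rule has_sum_finite_neutralI[of "{\<lambda>_. 0}"]) (auto simp: h_def monomial_zero_point)
  moreover have "(h a has_sum f a) (multi_indices d)" using c[rule_format, of a] r unfolding h_def by simp
  ultimately have fa: "f a = c (\<lambda>_. 0)" using has_sum_unique by blast
  have hA: "(h x has_sum f x - f a) A" if "\<forall>i<d. \<bar>x i - a i\<bar> < r" for x
  proof -
    have "(h x has_sum f x) (multi_indices d)" using c[rule_format, of x] that unfolding h_def by simp
    moreover have "(h x has_sum f a) {\<lambda>_. 0}" by (rule has_sum_finiteI) (auto simp: h_def fa)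
    ultimately show ?thesis unfolding A_def by (rule has_sum_Diff) auto
  qed
  \<comment> \<open>\<open>g\<close> collects the absolute values of the nonconstant terms at
    distance r/2 from a in every coordinate; its sum M controls the series on all smaller
    polydiscs.\<close>
  define g where "g \<alpha> = \<bar>c \<alpha>\<bar> * monomial d (\<lambda>_. r/2) \<alpha>" for \<alpha>
  have "\<forall>i<d. \<bar>(a i + r/2) - a i\<bar> < r" using r by auto
  from has_sum_imp_summable[OF hA[OF this]]
  have "(\<lambda>\<alpha>. norm (h (\<lambda>i. a i + r/2) \<alpha>)) summable_on A"
    by (rule summable_on_iff_abs_summable_on_real[THEN iffD1])
  moreover have "norm (h (\<lambda>i. a i + r/2) \<alpha>) = g \<alpha>" for \<alpha>
    using r by (simp add: h_def g_def abs_mult monomial_def abs_prod power_abs)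
  ultimately have g: "g summable_on A" by simp
  have g0: "0 \<le> g \<alpha>" for \<alpha> using r by (auto simp: g_def monomial_def intro!: mult_nonneg_nonneg prod_nonneg)
  define M where "M = infsum g A"
  have M: "0 \<le> M" unfolding M_def by (rule infsum_nonneg) (auto simp: g0)
  \<comment> \<open>By \<open>monomial_bound\<close> the nonconstant part is absolutely at most t *
    M on the polydisc of radius t * (r/2). The choice of t brings this below \<rho>; M + 1 avoids a
    division by 0.\<close>
  define t where "t = min 1 (\<rho> / (2 * (M + 1)))"
  have t: "0 < t" "t \<le> 1" using \<rho> M by (auto simp: t_def)
  have "t * M \<le> \<rho> / (2 * (M + 1)) * M" by (intro mult_right_mono M) (simp add: t_def)
  also have "\<dots> < \<rho>" using \<rho> M by (simp add: field_simps add_nonneg_pos)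
  finally have tM: "t * M < \<rho>" .
  define r' where "r' = t * (r/2)"
  have "r' \<le> 1 * (r/2)" unfolding r'_def using t r by (intro mult_right_mono) auto
  then have r': "0 < r'" "r' < r" using r t by (auto simp: r'_def)
  define \<Gamma> :: "(nat \<Rightarrow> nat) list \<Rightarrow> nat \<Rightarrow> nat" where "\<Gamma> xs = (\<lambda>i. \<Sum>\<alpha>\<leftarrow>xs. \<alpha> i)" for xs
  define w where "w xs = b (length xs) * prod_list (map c xs)" for xs
  define L where "L = {xs. set xs \<subseteq> A}"
  define fib where "fib \<gamma> = {xs \<in> L. \<Gamma> xs = \<gamma>}" for \<gamma>
  have prod_h: "prod_list (map (h x) xs) = prod_list (map c xs) * monomial d (\<lambda>i. x i - a i) (\<Gamma> xs)" for x xs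
    by (induction xs) (auto simp: h_def \<Gamma>_def monomial_add)
  have main: "((\<lambda>xs. w xs * monomial d (\<lambda>i. x i - a i) (\<Gamma> xs)) has_sum F (f x)) L"
    if x: "\<forall>i<d. \<bar>x i - a i\<bar> < r'" for x
  proof -
    have hx: "(h x has_sum f x - f a) A" using x r' by (intro hA) force
    define s' where "s' = infsum (\<lambda>\<alpha>. \<bar>h x \<alpha>\<bar>) A"
    have sm: "(\<lambda>\<alpha>. \<bar>h x \<alpha>\<bar>) summable_on A"
      using summable_on_iff_abs_summable_on_real[THEN iffD1, OF has_sum_imp_summable[OF hx]] by simp
    then have hs': "((\<lambda>\<alpha>. \<bar>h x \<alpha>\<bar>) has_sum s') A" unfolding s'_def by (rule has_sum_infsum)
    have "\<bar>h x \<alpha>\<bar> \<le> t * g \<alpha>" if "\<alpha> \<in> A" for \<alpha>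
    proof -
      have "\<bar>monomial d (\<lambda>i. x i - a i) \<alpha>\<bar> \<le> t * monomial d (\<lambda>_. r/2) \<alpha>"
        using that t r x by (intro monomial_bound) (auto simp: A_def r'_def less_imp_le)
      then have "\<bar>c \<alpha>\<bar> * \<bar>monomial d (\<lambda>i. x i - a i) \<alpha>\<bar> \<le> \<bar>c \<alpha>\<bar> * (t * monomial d (\<lambda>_. r/2) \<alpha>)"
        by (rule mult_left_mono) auto
      then show ?thesis by (simp add: h_def g_def abs_mult algebra_simps)
    qed
    then have "s' \<le> infsum (\<lambda>\<alpha>. t * g \<alpha>) A"
      unfolding s'_def by (intro infsum_mono sm summable_on_cmult_right g)
    also have "\<dots> = t * M" unfolding M_def by (rule infsum_cmult_right) (use g in auto)
    finally have s'\<rho>: "s' < \<rho>" using tM by simp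
    have s'0: "0 \<le> s'" unfolding s'_def by (rule infsum_nonneg) auto
    have "\<bar>f x - f a\<bar> \<le> s'"
      using norm_infsum_bound[of "h x" A] sm infsumI[OF hx] by (simp add: s'_def)
    then have "(\<lambda>n. b n * (f x - f a) ^ n) sums F (f x)" using F s'\<rho> by simp
    moreover have "summable (\<lambda>n. \<bar>b n\<bar> * s' ^ n)"
    proof -
      \<comment> \<open>A point strictly between s' and the radius \<rho>: convergence of the power
        series at K gives absolute convergence at s'.\<close>
      define K where "K = (s' + \<rho>) / 2"
      have K: "s' < K" "\<bar>K\<bar> < \<rho>" using s'0 s'\<rho> by (auto simp: K_def)
      have "summable (\<lambda>n. b n * K ^ n)" using F[of "f a + K"] K by (simp add: sums_iff)
      from powser_insidea[OF this, of s'] show ?thesis using K s'0 by (simp add: abs_mult)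
    qed
    ultimately have "((\<lambda>xs. b (length xs) * prod_list (map (h x) xs)) has_sum F (f x)) L"
      unfolding L_def by (rule has_sum_lists[OF hx hs'])
    then show ?thesis by (simp add: prod_h w_def mult.assoc)
  qed
  have \<Gamma>: "\<Gamma> xs \<in> multi_indices d" if "xs \<in> L" for xs
    unfolding multi_indices_def mem_Collect_eq
  proof (intro allI impI)
    fix i assume "d \<le> i"
    moreover have "\<forall>\<alpha>\<in>set xs. \<alpha> \<in> multi_indices d" using that by (auto simp: L_def A_def)
    ultimately have "\<forall>\<alpha>\<in>set xs. \<alpha> i = 0" unfolding multi_indices_def by blast
    then show "\<Gamma> xs i = 0" by (simp add: \<Gamma>_def)
  qed
  have w: "w summable_on fib \<gamma>" for \<gamma>
  proof -
    \<comment> \<open>On a fibre the monomial is constant. With all increments equal to r'/2 it is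
      the positive number z, by which the summable family can be divided.\<close>
    define z where "z = monomial d (\<lambda>_. r'/2) \<gamma>"
    have z: "z > 0" using r' by (auto simp: z_def monomial_def intro!: prod_pos)
    have "(\<lambda>xs. w xs * monomial d (\<lambda>_. r'/2) (\<Gamma> xs)) summable_on L"
      using has_sum_imp_summable[OF main[of "\<lambda>i. a i + r'/2"]] r' by simp
    then have "(\<lambda>xs. w xs * monomial d (\<lambda>_. r'/2) (\<Gamma> xs)) summable_on fib \<gamma>"
      by (rule summable_on_subset_banach) (auto simp: fib_def)
    then have "(\<lambda>xs. w xs * z) summable_on fib \<gamma>"
      by (rule summable_on_cong[THEN iffD1, rotated]) (auto simp: fib_def z_def)
    then show ?thesis using z by (simp add: summable_on_cmult_left')
  qed
  show ?thesis
    unfolding analytic_near_def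
  proof (intro exI[of _ r'] conjI exI[of _ "\<lambda>\<gamma>. infsum w (fib \<gamma>)"] allI impI)
    fix x assume x: "\<forall>i<d. \<bar>x i - a i\<bar> < r'"
    let ?m = "monomial d (\<lambda>i. x i - a i)"
    have "Sigma (multi_indices d) fib = (\<lambda>xs. (\<Gamma> xs, xs)) ` L"
      using \<Gamma> by (auto simp: fib_def)
    moreover have "inj_on (\<lambda>xs. (\<Gamma> xs, xs)) L" by (auto simp: inj_on_def)
    ultimately have "((\<lambda>(\<gamma>, xs). w xs * ?m \<gamma>) has_sum F (f x)) (Sigma (multi_indices d) fib)"
      using main[OF x] by (simp add: has_sum_reindex o_def)
    then show "((\<lambda>\<gamma>. infsum w (fib \<gamma>) * ?m \<gamma>) has_sum F (f x)) (multi_indices d)"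
    proof (rule has_sum_SigmaD)
      fix \<gamma>
      show "((\<lambda>xs. case (\<gamma>, xs) of (\<gamma>, xs) \<Rightarrow> w xs * ?m \<gamma>) has_sum infsum w (fib \<gamma>) * ?m \<gamma>) (fib \<gamma>)"
        using has_sum_cmult_left[OF has_sum_infsum[OF w[of \<gamma>]], of "?m \<gamma>"] by simp
    qed
  qed (use r' in auto)
qed

lemma analytic_near_exp:
  assumes "analytic_near d f a"
  shows "analytic_near d (\<lambda>x. exp (f x)) a"
proof (rule analytic_near_compose[OF assms zero_less_one, where b = "\<lambda>n. exp (f a) / fact n"])
  fix y
  have "(\<lambda>n. exp (f a) * ((y - f a) ^ n /\<^sub>R fact n)) sums (exp (f a) * exp (y - f a))"
    by (intro sums_mult exp_converges)
  then show "(\<lambda>n. exp (f a) / fact n * (y - f a) ^ n) sums exp y"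
    by (simp add: exp_diff divide_inverse mult_ac scaleR_conv_of_real)
qed

lemma analytic_near_ln:
  assumes "analytic_near d f a" "f a > 0"
  shows "analytic_near d (\<lambda>x. ln (f x)) a"
proof (rule analytic_near_compose[OF assms, where b = "\<lambda>n. if n = 0 then ln (f a) else - ((- 1 / f a) ^ n / of_nat n)"])
  fix y assume y: "\<bar>y - f a\<bar> < f a"
  define x where "x = (y - f a) / f a"
  have x: "\<bar>x\<bar> < 1" using y assms(2) by (simp add: x_def abs_divide)
  \<comment> \<open>The term n = 0 of the logarithm series is a quotient by 0, hence 0; the constant
    ln (f a) is put in its place.\<close>
  have "(\<lambda>n. - ((-x) ^ n) / of_nat n + (if n = 0 then ln (f a) else 0)) sums (ln (1 + x) + ln (f a))"
    by (intro sums_add ln_series'[OF x] sums_single[of 0 "\<lambda>_. ln (f a)", simplified])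
  moreover have "ln (1 + x) + ln (f a) = ln y"
  proof -
    have "y = (1 + x) * f a" using assms(2) by (simp add: x_def field_simps)
    moreover have "1 + x > 0" using x by auto
    ultimately show ?thesis using assms(2) by (simp add: ln_mult)
  qed
  moreover have "- ((-x) ^ n) / of_nat n + (if n = 0 then ln (f a) else 0) =
     (if n = 0 then ln (f a) else - ((- 1 / f a) ^ n / of_nat n)) * (y - f a) ^ n" for n
    by (simp add: x_def power_divide flip: power_mult_distrib)
  ultimately show "(\<lambda>n. (if n = 0 then ln (f a) else - ((- 1 / f a) ^ n / of_nat n)) * (y - f a) ^ n) sums ln y"
    by simp
qed

section \<open>Linear forms and greedy bases\<close>

text \<open>The ambient space consists of all functions on the naturals, so that spans and bases
  serve every dimension d simultaneously, with \<open>Rn d\<close> as a subspace.\<close>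

interpretation fun_vs: vector_space "\<lambda>(r::real) (f :: nat \<Rightarrow> real) i. r * f i"
  by unfold_locales (auto simp: fun_eq_iff algebra_simps)

lemma Rn_iff: "x \<in> Rn d \<longleftrightarrow> (\<forall>i\<ge>d. x i = 0)"
  by (simp add: topspace_Euclidean_space)

lemma RnD: "x \<in> Rn d \<Longrightarrow> d \<le> i \<Longrightarrow> x i = 0"
  by (simp add: Rn_iff)

lemma lform_add: "lform d T (\<lambda>i. x i + y i) = lform d T x + lform d T y"
  by (simp add: lform_def distrib_left sum.distrib)

lemma lform_scale: "lform d T (\<lambda>i. r * x i) = r * lform d T x"
  by (simp add: lform_def sum_distrib_left mult_ac)

lemma lform_diff_form: "lform d (\<lambda>i. S i - T i) x = lform d S x - lform d T x"
  by (simp add: lform_def left_diff_distrib sum_subtractf)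

lemma lform_scale_form: "lform d (\<lambda>i. r * T i) x = r * lform d T x"
  by (simp add: lform_def sum_distrib_left mult_ac)

lemma lform_sum_form: "lform d (\<lambda>i. \<Sum>j\<in>A. S j i) x = (\<Sum>j\<in>A. lform d (S j) x)"
  by (simp add: lform_def sum_distrib_right sum.swap[of _ A])

definition unit_vec :: "nat \<Rightarrow> nat \<Rightarrow> real" where
  "unit_vec j = (\<lambda>i. if i = j then 1 else 0)"

lemma unit_vec_in_Rn: "j < d \<Longrightarrow> unit_vec j \<in> Rn d"
  by (auto simp: unit_vec_def Rn_iff)

lemma lform_unit_vec: "j < d \<Longrightarrow> lform d (unit_vec j) x = x j"
  by (simp add: lform_def unit_vec_def if_distrib[of "\<lambda>a. a * _"] cong: if_cong)

lemma Rn_expand: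
  assumes "x \<in> Rn d"
  shows "x = (\<lambda>i. \<Sum>j<d. x j * unit_vec j i)"
proof
  fix i
  show "x i = (\<Sum>j<d. x j * unit_vec j i)"
    using RnD[OF assms, of i] by (cases "i < d") (simp_all add: unit_vec_def if_distrib[of "\<lambda>a. _ * a"] cong: if_cong)
qed

lemma fun_sum_apply: "(\<Sum>x\<in>A. F x) i = (\<Sum>x\<in>A. (F x :: nat \<Rightarrow> real) i)"
  by (induction A rule: infinite_finite_induct) auto

lemma Rn_subspace: "fun_vs.subspace (Rn d)"
  by (auto simp: fun_vs.subspace_def Rn_iff)

lemma Rn_span_unit: "Rn d = fun_vs.span (unit_vec ` {..<d})"
proof
  show "fun_vs.span (unit_vec ` {..<d}) \<subseteq> Rn d"
    by (rule fun_vs.span_minimal) (auto simp: unit_vec_in_Rn Rn_subspace)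
  show "Rn d \<subseteq> fun_vs.span (unit_vec ` {..<d})"
  proof
    fix x assume "x \<in> Rn d"
    then have "x = (\<Sum>j<d. (\<lambda>i. x j * unit_vec j i))"
      unfolding fun_eq_iff fun_sum_apply using Rn_expand by metis
    also have "\<dots> \<in> fun_vs.span (unit_vec ` {..<d})"
      by (intro fun_vs.span_sum fun_vs.span_scale fun_vs.span_base) auto
    finally show "x \<in> fun_vs.span (unit_vec ` {..<d})" .
  qed
qed

lemma inj_unit_vec: "inj unit_vec"
  by (auto simp: inj_on_def unit_vec_def fun_eq_iff split: if_splits)

lemma independent_unit_vec: "fun_vs.independent (unit_vec ` {..<d})"
proof (rule fun_vs.independent_if_scalars_zero)
  fix f x assume s: "(\<Sum>x\<in>unit_vec ` {..<d}. (\<lambda>i. f x * x i)) = 0" and "x \<in> unit_vec ` {..<d}"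
  then obtain j where j: "j < d" "x = unit_vec j" by auto
  have "0 = (\<Sum>x\<in>unit_vec ` {..<d}. (\<lambda>i. f x * x i)) j" using s by simp
  also have "\<dots> = (\<Sum>l<d. f (unit_vec l) * unit_vec l j)"
    by (simp add: fun_sum_apply sum.reindex inj_unit_vec[THEN inj_on_subset])
  also have "\<dots> = f x"
    using j by (simp add: unit_vec_def if_distrib[of "\<lambda>a. _ * a"] cong: if_cong)
  finally show "f x = 0" by simp
qed simp

lemma card_basis_Rn:
  assumes "fun_vs.independent B" "fun_vs.span B = Rn d"
  shows "finite B \<and> card B = d"
proof -
  obtain f where "bij_betw f B (unit_vec ` {..<d})"
    using fun_vs.bij_if_span_eq_span_bases[OF assms(1) independent_unit_vec[of d]] assms(2) Rn_span_unit
    by auto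
  then show ?thesis
    using bij_betw_finite bij_betw_same_card card_image[OF inj_on_subset[OF inj_unit_vec]]
    by (metis card_lessThan finite_imageI finite_lessThan subset_UNIV)
qed

text \<open>
  Scanning the forms in increasing order of size and keeping those that are independent of their
  predecessors gives a basis in which every form only involves basis elements below itself.
\<close>

lemma greedy_independent_list:
  fixes key :: "(nat \<Rightarrow> real) \<Rightarrow> real"
  assumes "sorted (map key fs)"
  shows "\<exists>bs. set bs \<subseteq> set fs \<and> distinct bs \<and> fun_vs.independent (set bs) \<and> sorted (map key bs)
     \<and> (\<forall>f\<in>set fs. f \<in> fun_vs.span {b \<in> set bs. key b \<le> key f})"
  using assms
proof (induction fs rule: rev_induct)
  case Nil
  then show ?case by (simp add: fun_vs.independent_empty)
next
  case (snoc f fs)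
  have sorted: "sorted (map key fs)" and below: "\<And>g. g \<in> set fs \<Longrightarrow> key g \<le> key f"
    using snoc.prems by (auto simp: sorted_append)
  obtain bs where bs: "set bs \<subseteq> set fs" "distinct bs" "fun_vs.independent (set bs)" "sorted (map key bs)"
    "\<And>g. g \<in> set fs \<Longrightarrow> g \<in> fun_vs.span {b \<in> set bs. key b \<le> key g}"
    using snoc.IH[OF sorted] by blast
  show ?case
  proof (cases "f \<in> fun_vs.span (set bs)")
    case True
    \<comment> \<open>f comes last in the order, so the bound \<open>key f\<close> excludes no
      element kept so far.\<close>
    have "{b \<in> set bs. key b \<le> key f} = set bs" using below bs(1) by auto
    with True bs show ?thesis by (intro exI[of _ bs]) auto
  next
    case False
    then have new: "f \<notin> set bs" using fun_vs.span_base by blast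
    have mono: "g \<in> fun_vs.span {b \<in> insert f (set bs). key b \<le> key g}" if "g \<in> set fs" for g
      using bs(5)[OF that] fun_vs.span_mono[of "{b \<in> set bs. key b \<le> key g}" "{b \<in> insert f (set bs). key b \<le> key g}"]
      by blast
    have "fun_vs.independent (insert f (set bs))"
      using fun_vs.independent_insertI[OF False bs(3)] .
    moreover have "f \<in> fun_vs.span {b \<in> insert f (set bs). key b \<le> key f}"
      by (rule fun_vs.span_base) auto
    moreover have "sorted (map key (bs @ [f]))" using bs(1,4) below by (auto simp: sorted_append)
    ultimately show ?thesis
      using bs new mono by (intro exI[of _ "bs @ [f]"]) auto
  qed
qed

text \<open>In the application A consists of the forms that are nonnegative at a chosen point. Of a
  unit vector and its negative one always is, which makes A span. The fourth conclusion later
  becomes the inequality between a new coordinate x_p and any form in which it occurs.\<close>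

lemma ordered_basis:
  fixes key :: "(nat \<Rightarrow> real) \<Rightarrow> real"
  assumes "finite A" "A \<subseteq> Rn d"
    and unit: "\<And>j. j < d \<Longrightarrow> unit_vec j \<in> A \<or> (\<lambda>i. - unit_vec j i) \<in> A"
  obtains b c where "\<And>p. p < d \<Longrightarrow> b p \<in> A"
    "\<And>p r. p \<le> r \<Longrightarrow> r < d \<Longrightarrow> key (b p) \<le> key (b r)"
    "\<And>f. f \<in> Rn d \<Longrightarrow> f = (\<lambda>i. \<Sum>p<d. c f p * b p i)"
    "\<And>f p. f \<in> A \<Longrightarrow> p < d \<Longrightarrow> c f p \<noteq> 0 \<Longrightarrow> key (b p) \<le> key f"
    "\<And>a. (\<lambda>i. \<Sum>p<d. a p * b p i) = (\<lambda>_. 0) \<Longrightarrow> \<forall>p<d. a p = 0"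
proof -
  obtain fs0 where "set fs0 = A" using finite_list assms(1) by auto
  then have fs: "set (sort_key key fs0) = A" "sorted (map key (sort_key key fs0))" by auto
  obtain bs where bs: "set bs \<subseteq> A" "distinct bs" "fun_vs.independent (set bs)" "sorted (map key bs)"
    "\<And>g. g \<in> A \<Longrightarrow> g \<in> fun_vs.span {b \<in> set bs. key b \<le> key g}"
    using greedy_independent_list[OF fs(2)] unfolding fs(1) by blast
  have A_span: "A \<subseteq> fun_vs.span (set bs)"
    using bs(5) fun_vs.span_mono[of "{b \<in> set bs. key b \<le> key _}" "set bs"] by blast
  have "unit_vec j \<in> fun_vs.span (set bs)" if "j < d" for j
  proof -
    consider "unit_vec j \<in> A" | "(\<lambda>i. - unit_vec j i) \<in> A" using unit \<open>j < d\<close> by blast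
    then show ?thesis
    proof cases
      case 2
      then have "(\<lambda>i. (-1) * (\<lambda>i. - unit_vec j i) i) \<in> fun_vs.span (set bs)"
        using A_span by (intro fun_vs.span_scale) auto
      then show ?thesis by simp
    qed (use A_span in auto)
  qed
  then have "Rn d \<subseteq> fun_vs.span (set bs)"
    unfolding Rn_span_unit by (intro fun_vs.span_minimal) auto
  moreover have "fun_vs.span (set bs) \<subseteq> Rn d"
    using bs(1) assms(2) by (intro fun_vs.span_minimal Rn_subspace) auto
  ultimately have span: "fun_vs.span (set bs) = Rn d" by blast
  have len: "length bs = d"
    using card_basis_Rn[OF bs(3) span] distinct_card[OF bs(2)] by simp
  have bij: "bij_betw ((!) bs) {..<d} (set bs)"
    using bij_betw_nth[OF bs(2), of "{..<d}" "set bs"] len by simp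
  define c where "c f p = fun_vs.representation (set bs) f (bs ! p)" for f p
  show ?thesis
  proof
    show "bs ! p \<in> A" if "p < d" for p using that len bs(1) by auto
    show "key (bs ! p) \<le> key (bs ! r)" if "p \<le> r" "r < d" for p r
      using that len bs(4) sorted_iff_nth_mono[of "map key bs"] by auto
    show "f = (\<lambda>i. \<Sum>p<d. c f p * (bs ! p) i)" if "f \<in> Rn d" for f
    proof
      fix i
      have "f = (\<Sum>b\<in>set bs. (\<lambda>i. fun_vs.representation (set bs) f b * b i))"
        using that span fun_vs.sum_representation_eq[OF bs(3), of f "set bs"] by auto
      then have "f i = (\<Sum>b\<in>set bs. fun_vs.representation (set bs) f b * b i)"
        by (metis (no_types, lifting) fun_sum_apply sum.cong)
      then show "f i = (\<Sum>p<d. c f p * (bs ! p) i)"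
        unfolding c_def sum.reindex_bij_betw[OF bij, of "\<lambda>b. fun_vs.representation (set bs) f b * b i"] .
    qed
    show "key (bs ! p) \<le> key f" if "f \<in> A" "p < d" "c f p \<noteq> 0" for f p
    proof -
      let ?B = "{b \<in> set bs. key b \<le> key f}"
      \<comment> \<open>By uniqueness, a representation over the basis elements below f is the
        representation over the whole basis, so no larger element occurs in f.\<close>
      have "fun_vs.representation (set bs) f = fun_vs.representation ?B f"
        using bs(5)[OF that(1)] by (intro fun_vs.representation_extend[OF bs(3)]) auto
      then show ?thesis
        using that(3) fun_vs.representation_ne_zero[of ?B f "bs ! p"] unfolding c_def by auto
    qed
    show "\<forall>p<d. a p = 0" if a: "(\<lambda>i. \<Sum>p<d. a p * (bs ! p) i) = (\<lambda>_. 0)" for a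
    proof (intro allI impI)
      fix p assume p: "p < d"
      define f where "f b = a (the_inv_into {..<d} ((!) bs) b)" for b
      have f: "f (bs ! r) = a r" if "r < d" for r
        using bij that by (simp add: f_def the_inv_into_f_f bij_betw_def)
      have "(\<Sum>b\<in>set bs. (\<lambda>i. f b * b i)) = 0"
      proof
        fix i
        have "(\<Sum>b\<in>set bs. (\<lambda>i. f b * b i)) i = (\<Sum>b\<in>set bs. f b * b i)" by (simp add: fun_sum_apply)
        also have "\<dots> = (\<Sum>p<d. f (bs ! p) * (bs ! p) i)"
          using sum.reindex_bij_betw[OF bij, of "\<lambda>b. f b * b i"] by simp
        also have "\<dots> = (\<lambda>i. \<Sum>p<d. a p * (bs ! p) i) i" by (simp add: f)
        finally show "(\<Sum>b\<in>set bs. (\<lambda>i. f b * b i)) i = 0 i" using fun_cong[OF a, of i] by simp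
      qed
      then have "f (bs ! p) = 0"
        using fun_vs.independentD[OF bs(3), of "set bs" f "bs ! p"] p len by auto
      then show "a p = 0" using f p by simp
    qed
  qed
qed

definition frame_map :: "nat \<Rightarrow> (nat \<Rightarrow> nat \<Rightarrow> real) \<Rightarrow> (nat \<Rightarrow> real) \<Rightarrow> nat \<Rightarrow> real" where
  "frame_map d b x = (\<lambda>p. if p < d then lform d (b p) x else 0)"

lemma sum_mult_assoc:
  fixes u :: "'a \<Rightarrow> 'c :: comm_semiring_0"
  shows "(\<Sum>r\<in>B. (\<Sum>j\<in>A. u j * v j r) * y r) = (\<Sum>j\<in>A. u j * (\<Sum>r\<in>B. v j r * y r))"
proof -
  have "(\<Sum>r\<in>B. (\<Sum>j\<in>A. u j * v j r) * y r) = (\<Sum>r\<in>B. \<Sum>j\<in>A. u j * v j r * y r)"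
    by (simp add: sum_distrib_right)
  also have "\<dots> = (\<Sum>j\<in>A. \<Sum>r\<in>B. u j * v j r * y r)" by (rule sum.swap)
  finally show ?thesis by (simp add: sum_distrib_left mult.assoc)
qed

lemma lform_frame_map:
  assumes "f = (\<lambda>i. \<Sum>p<d. c p * b p i)"
  shows "lform d f x = lform d c (frame_map d b x)"
proof -
  have "lform d f x = (\<Sum>i<d. (\<Sum>p<d. c p * b p i) * x i)" unfolding lform_def by (subst assms) simp
  also have "\<dots> = (\<Sum>p<d. c p * (\<Sum>i<d. b p i * x i))" by (rule sum_mult_assoc)
  finally show ?thesis by (simp add: frame_map_def lform_def)
qed

text \<open>The inverse \<open>w\<close> has the coefficients of the unit vectors as rows. It is a
  left inverse by the expansion of the unit vectors, and a right inverse by comparison of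
  coefficients, which independence allows.\<close>

lemma frame_map_GL:
  assumes span: "\<And>f. f \<in> Rn d \<Longrightarrow> f = (\<lambda>i. \<Sum>p<d. c f p * b p i)"
    and indep: "\<And>a. (\<lambda>i. \<Sum>p<d. a p * b p i) = (\<lambda>_. 0) \<Longrightarrow> \<forall>p<d. a p = 0"
    and b: "\<And>p. p < d \<Longrightarrow> b p \<in> Rn d"
  shows "frame_map d b \<in> GL d"
proof -
  define w where "w x = (\<lambda>j. if j < d then \<Sum>r<d. c (unit_vec j) r * x r else 0)" for x :: "nat \<Rightarrow> real"
  define e where "e p r = (\<Sum>j<d. b p j * c (unit_vec j) r)" for p r
  have e: "e p r = (if p = r then 1 else 0)" if p: "p < d" "r < d" for p r
  proof -
    have "(\<lambda>i. \<Sum>r<d. (e p r - unit_vec p r) * b r i) = (\<lambda>_. 0)"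
    proof
      fix i
      have "(\<Sum>r<d. e p r * b r i) = (\<Sum>j<d. b p j * (\<Sum>r<d. c (unit_vec j) r * b r i))"
        unfolding e_def by (rule sum_mult_assoc)
      also have "\<dots> = (\<Sum>j<d. b p j * unit_vec j i)"
        by (rule sum.cong) (use span[OF unit_vec_in_Rn, THEN fun_cong, symmetric, of _ i] in auto)
      also have "\<dots> = b p i" using Rn_expand[OF b[OF p(1)], THEN fun_cong, symmetric, of i] .
      also have "\<dots> = (\<Sum>r<d. unit_vec p r * b r i)"
        using lform_unit_vec[OF p(1), of "\<lambda>r. b r i"] by (simp add: lform_def)
      finally show "(\<Sum>r<d. (e p r - unit_vec p r) * b r i) = 0"
        by (simp add: left_diff_distrib sum_subtractf)
    qed
    from indep[OF this] show ?thesis using p(2) by (auto simp: unit_vec_def)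
  qed
  have fR: "frame_map d b x \<in> Rn d" for x by (simp add: frame_map_def Rn_iff)
  have wR: "w x \<in> Rn d" for x by (simp add: w_def Rn_iff)
  have wf: "w (frame_map d b x) = x" if "x \<in> Rn d" for x
  proof
    fix j
    show "w (frame_map d b x) j = x j"
      using RnD[OF that, of j] lform_frame_map[OF span[OF unit_vec_in_Rn], of j x] lform_unit_vec[of j d x]
      by (cases "j < d") (simp_all add: w_def lform_def)
  qed
  have fw: "frame_map d b (w x) = x" if "x \<in> Rn d" for x
  proof
    fix p
    show "frame_map d b (w x) p = x p"
    proof (cases "p < d")
      case True
      then have "frame_map d b (w x) p = (\<Sum>r<d. e p r * x r)"
        by (simp add: frame_map_def w_def lform_def e_def sum_mult_assoc)
      also have "\<dots> = x p" using True e by (simp add: if_distrib[of "\<lambda>a. a * _"] cong: if_cong)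
      finally show ?thesis .
    qed (use RnD[OF that, of p] in \<open>simp add: frame_map_def\<close>)
  qed
  have "bij_betw (frame_map d b) (Rn d) (Rn d)"
    by (rule bij_betw_byWitness[where f' = w]) (auto simp: wf fw fR wR)
  then show ?thesis
    by (auto simp: GL_def frame_map_def lform_add lform_scale fun_eq_iff)
qed

section \<open>Topology of the coordinate spaces and one-variable estimates\<close>

text \<open>\<open>Rn q\<close> is closed in the product topology on functions, so closures may be
  formed in the ambient type, where \<open>closed\<close> and \<open>continuous_on\<close>
  apply.\<close>

lemma closure_of_Euclidean_space:
  assumes "C \<subseteq> Rn q"
  shows "Euclidean_space q closure_of C = closure C"
proof
  have "closed (Rn q)" using closedin_Euclidean_space_iff[of q "Rn q"] by auto
  then have "closure C \<subseteq> Rn q" using assms closure_minimal by blast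
  then have "closedin (Euclidean_space q) (closure C)"
    by (simp add: closedin_Euclidean_space_iff)
  then show "Euclidean_space q closure_of C \<subseteq> closure C"
    by (intro closure_of_minimal closure_subset)
  show "closure C \<subseteq> Euclidean_space q closure_of C"
    using closedin_Euclidean_imp_closed[OF closedin_closure_of] assms
    by (intro closure_minimal closure_of_subset) auto
qed

lemma continuous_on_lform [continuous_intros]: "continuous_on S (lform d T)"
  unfolding lform_def
  by (intro continuous_intros continuous_on_subset[OF continuous_on_product_coordinates]) auto

lemma continuous_on_lform' [continuous_intros]:
  "continuous_on S f \<Longrightarrow> continuous_on S (\<lambda>x. lform d T (f x))"
  using continuous_on_compose2[OF continuous_on_lform[of UNIV]] by blast

lemma continuous_on_vdrop [continuous_intros]: "continuous_on S (vdrop m)"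
  unfolding vdrop_def
  by (intro continuous_on_coordinatewise_then_product continuous_on_subset[OF continuous_on_product_coordinates]) auto

lemma continuous_on_coordinate [continuous_intros]: "continuous_on S (\<lambda>x. x i :: real)"
  by (intro continuous_on_subset[OF continuous_on_product_coordinates]) auto

text \<open>Tychonoff: a product of compact intervals for the indices below d and of the singleton 0
  for all others.\<close>

lemma compact_coordinate_box:
  fixes d :: nat and R :: real
  shows "compact {x \<in> Rn d. \<forall>i<d. \<bar>x i\<bar> \<le> R}"
proof -
  have "compactin (product_topology (\<lambda>_. euclideanreal) UNIV)
          (PiE UNIV (\<lambda>i. if i < d then {-R..R} else {0}))"
    unfolding compactin_PiE by auto
  moreover have "PiE UNIV (\<lambda>i. if i < d then {-R..R} else {0}) = {x \<in> Rn d. \<forall>i<d. \<bar>x i\<bar> \<le> R}"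
    by (force simp: PiE_def Pi_def Rn_iff abs_le_iff split: if_splits)
  ultimately show ?thesis by (simp add: euclidean_product_topology)
qed

lemma vdrop_vcat [simp]: "vdrop m (vcat m s x) = x"
  by (simp add: vdrop_def vcat_def)

lemma vcat_at [simp]: "i < m \<Longrightarrow> vcat m s x i = s i" "vcat m s x (m + p) = x p"
  by (simp_all add: vcat_def)

lemma vcat_in_Rn: "x \<in> Rn q \<Longrightarrow> vcat m s x \<in> Rn (m + q)"
  by (auto simp: vcat_def Rn_iff)

lemma lform_vcat_form: "lform (m + q) (vcat m u f) z = (\<Sum>i<m. u i * z i) + lform q f (vdrop m z)"
proof -
  have "lform (m + q) (vcat m u f) z = (\<Sum>i<m. vcat m u f i * z i) + (\<Sum>i=m..<m + q. vcat m u f i * z i)"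
    unfolding lform_def using sum.atLeastLessThan_concat[of 0 m "m + q" "\<lambda>i. vcat m u f i * z i"]
    by (simp add: lessThan_atLeast0)
  also have "(\<Sum>i=m..<m + q. vcat m u f i * z i) = lform q f (vdrop m z)"
    using sum.shift_bounds_nat_ivl[of "\<lambda>i. vcat m u f i * z i" 0 m q]
    by (simp add: lform_def vdrop_def vcat_def lessThan_atLeast0 add.commute)
  finally show ?thesis by simp
qed

lemma vdrop_fun_upd: "vdrop m (z(m + p := t)) = (vdrop m z)(p := t)"
  by (auto simp: vdrop_def)

lemma lform_fun_upd:
  assumes "p < q"
  shows "lform q f (x(p := t)) = lform q f x + f p * (t - x p)"
proof -
  have "lform q f (x(p := t)) - lform q f x = (\<Sum>i<q. f i * (if i = p then t - x p else 0))"
    unfolding lform_def sum_subtractf[symmetric] by (rule sum.cong) (auto simp: algebra_simps)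
  also have "\<dots> = f p * (t - x p)" using assms by (simp add: if_distrib[of "\<lambda>a. _ * a"] cong: if_cong)
  finally show ?thesis by simp
qed

lemma analytic_near_uminus: "analytic_near d f a \<Longrightarrow> analytic_near d (\<lambda>x. - f x) a"
  using analytic_near_cmult[of d f a "-1"] by simp

lemma analytic_near_diff:
  "analytic_near d f a \<Longrightarrow> analytic_near d g a \<Longrightarrow> analytic_near d (\<lambda>x. f x - g x) a"
  using analytic_near_add[of d f a "\<lambda>x. - g x"] analytic_near_uminus by simp

lemma analytic_near_divide_const: "analytic_near d f a \<Longrightarrow> analytic_near d (\<lambda>x. f x / k) a"
  using analytic_near_cmult[of d f a "1 / k"] by simp

lemmas analytic_near_intros =
  analytic_near_const analytic_near_coord analytic_near_add analytic_near_diff analytic_near_uminus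
  analytic_near_cmult analytic_near_divide_const analytic_near_sum analytic_near_lform
  analytic_near_exp analytic_near_ln

lemma analytic_near_sinh:
  assumes "analytic_near d f a"
  shows "analytic_near d (\<lambda>x. sinh (f x)) a"
  unfolding sinh_def real_scaleR_def by (intro analytic_near_intros assms)

text \<open>Reduced to \<open>exp\<close> and \<open>ln\<close> by sqrt y = exp (ln y / 2);
  positivity at all points makes this an identity of functions.\<close>

lemma analytic_near_sqrt:
  assumes "analytic_near d f a" "\<And>x. f x > 0"
  shows "analytic_near d (\<lambda>x. sqrt (f x)) a"
proof -
  have "sqrt (f x) = exp (ln (f x) / 2)" for x
    using assms(2)[of x] by (simp add: powr_half_sqrt[symmetric] powr_def)
  moreover have "analytic_near d (\<lambda>x. exp (ln (f x) / 2)) a"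
    by (intro analytic_near_intros assms)
  ultimately show ?thesis by simp
qed

section \<open>Bounded corrections to log sinh\<close>

text \<open>For i in I the length is x = exp (- s), and - ln (sinh (x / 2)) = s +
  \<open>pinch_corr s\<close>.\<close>

definition pinch_corr :: "real \<Rightarrow> real" where
  "pinch_corr s = - ln (sinh (exp (- s) / 2)) - s"

text \<open>The counterpart for a length w >= 1, whose linear part is - w / 2; see
  \<open>end_corr_sinh\<close>. Its singularity at w = 0 limits the domain of analyticity
  later.\<close>

definition end_corr :: "real \<Rightarrow> real" where
  "end_corr w = ln 2 - ln (1 - exp (- w))"

text \<open>With y = exp (- s) / 2, which is at most 1/2, the sandwich y / 2 <= sinh y <= 2 y and ln
  y = - s - ln 2 place the correction in [0, 2 ln 2].\<close>

lemma pinch_corr_bound: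
  assumes "0 < s"
  shows "\<bar>pinch_corr s\<bar> \<le> 2 * ln 2"
proof -
  define y where "y = exp (- s) / 2"
  have y: "0 < y" "y \<le> 1/2" using assms by (auto simp: y_def)
  have sinh: "sinh y = exp y * (1 - exp (- (2 * y))) / 2"
    by (simp add: sinh_def algebra_simps flip: exp_add)
  have "1 - exp (- (2 * y)) \<le> 2 * y" using exp_ge_add_one_self[of "- (2 * y)"] by simp
  moreover have "exp y \<le> 2"
    using y exp_half_le2 by (smt (verit) exp_le_cancel_iff)
  ultimately have "exp y * (1 - exp (- (2 * y))) \<le> 2 * (2 * y)"
    using y by (intro mult_mono) auto
  then have up: "sinh y \<le> 2 * y" by (simp add: sinh)
  have "exp (- (2 * y)) * (1 + 2 * y) \<le> exp (- (2 * y)) * exp (2 * y)"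
    using exp_ge_add_one_self[of "2 * y"] by (intro mult_left_mono) auto
  then have "exp (- (2 * y)) * (1 + 2 * y) \<le> 1" by (simp flip: exp_add)
  then have "exp (- (2 * y)) \<le> 1 / (1 + 2 * y)" using y by (simp add: field_simps)
  also have "\<dots> \<le> 1 - y" using y by (simp add: field_simps) 
  finally have "y \<le> 1 - exp (- (2 * y))" by simp
  moreover have "1 \<le> exp y" using y by simp
  ultimately have "1 * y \<le> exp y * (1 - exp (- (2 * y)))"
    using y by (intro mult_mono) auto
  then have low: "y / 2 \<le> sinh y" by (simp add: sinh)
  have "ln (sinh y) \<le> ln (2 * y)" using up y by (subst ln_le_cancel_iff) auto
  moreover have "ln (y / 2) \<le> ln (sinh y)" using low y by (subst ln_le_cancel_iff) auto
  moreover have "ln y = - s - ln 2" by (simp add: y_def ln_div)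
  ultimately have "ln (sinh y) \<le> - s" "- s - 2 * ln 2 \<le> ln (sinh y)"
    using y by (simp_all add: ln_mult ln_div)
  then show ?thesis by (simp add: pinch_corr_def flip: y_def)
qed

lemma exp_neg_le_half:
  assumes "1 \<le> w"
  shows "exp (- w :: real) \<le> 1/2"
proof -
  have "2 \<le> exp w" using exp_ge_add_one_self[of w] assms by linarith
  then show ?thesis by (simp add: exp_minus inverse_eq_divide divide_le_eq)
qed

text \<open>The cut-off at 1 gives 1 - exp (- w) >= 1/2, which places the correction in
  [ln 2, 2 ln 2].\<close>

lemma end_corr_bound:
  assumes "1 \<le> w"
  shows "\<bar>end_corr w\<bar> \<le> 2 * ln 2"
proof -
  have half: "1/2 \<le> 1 - exp (- w)" using exp_neg_le_half[OF assms] by simp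
  have pos: "0 < 1 - exp (- w)" using assms by simp
  then have "ln (1/2) \<le> ln (1 - exp (- w))" using half by (subst ln_le_cancel_iff) auto
  moreover from pos have "ln (1 - exp (- w)) \<le> 0" by (subst ln_le_zero_iff) auto
  ultimately show ?thesis by (simp add: end_corr_def ln_div)
qed

lemma end_corr_sinh:
  assumes "0 < w"
  shows "- ln (sinh (w / 2)) = end_corr w - w / 2"
proof -
  have "sinh (w / 2) = exp (w / 2) * ((1 - exp (- w)) / 2)"
    by (simp add: sinh_def algebra_simps flip: exp_add)
  then have "ln (sinh (w / 2)) = w / 2 + (ln (1 - exp (- w)) - ln 2)"
    using assms by (simp only: ln_mult ln_div) (simp add: ln_mult ln_div)
  then show ?thesis by (simp add: end_corr_def)
qed

lemma end_corr_deriv: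
  assumes "(f has_real_derivative f') (at t)" "0 < f t"
  shows "((\<lambda>t. end_corr (f t)) has_real_derivative - (f' * (exp (- f t) / (1 - exp (- f t))))) (at t)"
  unfolding end_corr_def
  by (rule derivative_eq_intros assms refl | use assms(2) in \<open>simp add: field_simps\<close>)+

lemma analytic_near_pinch_corr:
  assumes "analytic_near d f a"
  shows "analytic_near d (\<lambda>x. pinch_corr (f x)) a"
  unfolding pinch_corr_def by (intro analytic_near_intros analytic_near_sinh assms) simp

lemma analytic_near_end_corr:
  assumes "analytic_near d f a" "0 < f a"
  shows "analytic_near d (\<lambda>x. end_corr (f x)) a"
  unfolding end_corr_def by (intro analytic_near_intros assms) (use assms(2) in simp)

section \<open>The normal form on a cell\<close>

lemma weighted_abs_le: "\<bar>y\<bar> \<le> b \<Longrightarrow> \<bar>2 * real k * y\<bar> \<le> 2 * real k * b"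
  by (simp add: abs_mult mult_left_mono)

text \<open>
  The normal form of a pseudo length-type function on a cell. The exponents \<open>\<beta> T\<close> are the
  restrictions of the original linear forms to the second factor, \<open>\<tau>\<close> is the one that
  dominates on the cell, and \<open>gap T\<close> carries the factor 1/2 coming from the square roots. The
  conditions \<open>end_form_above\<close> and \<open>gap_above\<close> say that a form only involves coordinates
  lying below it.
\<close>

locale cell_normal_form =
  fixes m q e :: nat and C :: "(nat \<Rightarrow> real) set"
    and d d' :: "nat \<Rightarrow> nat" and \<xi> :: "nat \<Rightarrow> nat \<Rightarrow> real"
    and A :: "nat set" and G :: "nat \<Rightarrow> 'b set" and a :: "nat \<Rightarrow> 'b \<Rightarrow> real"
    and \<alpha> \<beta> :: "'b \<Rightarrow> nat \<Rightarrow> real" and i\<^sub>0 :: nat and \<tau> :: 'b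
  assumes C_chamber: "C \<subseteq> {x \<in> Rn q. (\<forall>i<q. 0 \<le> x i) \<and> (\<forall>j<q. \<forall>i\<le>j. x i \<le> x j)}"
    and \<xi>_Rn: "\<And>j. j < e \<Longrightarrow> \<xi> j \<in> Rn q"
    and \<beta>_Rn: "\<And>i T. i \<in> A \<Longrightarrow> T \<in> G i \<Longrightarrow> \<beta> T \<in> Rn q"
    and end_form_ge1: "\<And>x j. x \<in> C \<Longrightarrow> j < e \<Longrightarrow> 1 \<le> lform q (\<xi> j) x"
    and end_form_above: "\<And>x j p. x \<in> C \<Longrightarrow> j < e \<Longrightarrow> p < q \<Longrightarrow> \<xi> j p \<noteq> 0 \<Longrightarrow> x p \<le> lform q (\<xi> j) x"
    and A_fin: "finite A" and G_fin: "\<And>i. i \<in> A \<Longrightarrow> finite (G i) \<and> G i \<noteq> {}"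
    and a_pos: "\<And>i T. i \<in> A \<Longrightarrow> T \<in> G i \<Longrightarrow> 0 < a i T"
    and top: "i\<^sub>0 \<in> A" "\<tau> \<in> G i\<^sub>0"
    and gap_nonneg: "\<And>x i T. x \<in> C \<Longrightarrow> i \<in> A \<Longrightarrow> T \<in> G i \<Longrightarrow> 0 \<le> lform q (\<lambda>p. (\<beta> \<tau> p - \<beta> T p) / 2) x"
    and gap_above: "\<And>x i T p. x \<in> C \<Longrightarrow> i \<in> A \<Longrightarrow> T \<in> G i \<Longrightarrow> p < q \<Longrightarrow> (\<beta> \<tau> p - \<beta> T p) / 2 \<noteq> 0 \<Longrightarrow>
        x p \<le> lform q (\<lambda>p. (\<beta> \<tau> p - \<beta> T p) / 2) x"
    and d_pos: "\<And>j. j < m \<Longrightarrow> 1 \<le> d j"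
begin

definition gap :: "'b \<Rightarrow> nat \<Rightarrow> real" where
  "gap T p = (\<beta> \<tau> p - \<beta> T p) / 2"

text \<open>Term T of the i-th radicand divided by the exponential of the dominant form, since - 2
  \<open>gap T\<close> is \<open>\<beta> T\<close> minus \<open>\<beta> \<tau>\<close>. The \<alpha>
  part acts on exp (- s_j), which lies in (0,1) for s_j > 0, and is then a bounded factor.\<close>

definition summand :: "nat \<Rightarrow> 'b \<Rightarrow> (nat \<Rightarrow> real) \<Rightarrow> real" where
  "summand i T z = a i T * exp (\<Sum>j<m. \<alpha> T j * exp (- z j)) * exp (- 2 * lform q (gap T) (vdrop m z))"

definition rad :: "(nat \<Rightarrow> real) \<Rightarrow> real" where
  "rad z = (\<Sum>i\<in>A. sqrt (\<Sum>T\<in>G i. summand i T z))"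

definition psi :: "(nat \<Rightarrow> real) \<Rightarrow> real" where
  "psi z = 2 * ln 2 + (\<Sum>j<m. 2 * real (d j) * pinch_corr (z j))
     + (\<Sum>j<e. 2 * real (d' j) * end_corr (lform q (\<xi> j) (vdrop m z))) + 2 * ln (rad z)"

text \<open>Twice the logarithm of the factor exp (\<open>\<beta> \<tau>\<close> / 2) pulled out of
  the square roots is \<open>\<beta> \<tau>\<close>; each - 2 d' ln sinh of half an end form
  contributes - d' times that form.\<close>

definition Lam0 :: "nat \<Rightarrow> real" where
  "Lam0 p = \<beta> \<tau> p - (\<Sum>j<e. real (d' j) * \<xi> j p)"

definition Lam :: "nat \<Rightarrow> real" where
  "Lam = vcat m (\<lambda>j. 2 * real (d j)) Lam0"

definition total :: "(nat \<Rightarrow> real) \<Rightarrow> real" where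
  "total z = lform (m + q) Lam z + psi z"

lemma summand_pos: "i \<in> A \<Longrightarrow> T \<in> G i \<Longrightarrow> 0 < summand i T z"
  by (simp add: summand_def a_pos)

lemma inner_pos: "i \<in> A \<Longrightarrow> 0 < (\<Sum>T\<in>G i. summand i T z)"
  using G_fin by (intro sum_pos summand_pos) auto

lemma rad_pos: "0 < rad z"
  unfolding rad_def using A_fin top(1) inner_pos by (intro sum_pos) auto

lemma Lam_Rn: "Lam \<in> Rn (m + q)"
proof -
  have "Lam0 \<in> Rn q" using \<beta>_Rn[OF top] \<xi>_Rn by (auto simp: Lam0_def Rn_iff)
  then show ?thesis unfolding Lam_def by (rule vcat_in_Rn)
qed

lemma lform_Lam: "lform (m + q) Lam z = (\<Sum>j<m. 2 * real (d j) * z j) + lform q Lam0 (vdrop m z)"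
  unfolding Lam_def by (rule lform_vcat_form)

lemma analytic_near_second_lform: "analytic_near (m + q) (\<lambda>z. lform q f (vdrop m z)) z0"
  unfolding lform_def vdrop_def by (intro analytic_near_intros) auto

text \<open>The only singularities come from \<open>end_corr\<close> at zeros of the end forms; the
  radicands and \<open>rad\<close> are positive everywhere.\<close>

lemma analytic_near_total:
  assumes "\<And>j. j < e \<Longrightarrow> 0 < lform q (\<xi> j) (vdrop m z0)"
  shows "analytic_near (m + q) total z0"
proof -
  have "analytic_near (m + q) (\<lambda>z. \<Sum>T\<in>G i. summand i T z) z0" for i
  proof (rule analytic_near_sum)
    fix T
    have "analytic_near (m + q)
       (\<lambda>z. a i T * exp ((\<Sum>j<m. \<alpha> T j * exp (- z j)) + - 2 * lform q (gap T) (vdrop m z))) z0"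
      by (intro analytic_near_intros analytic_near_second_lform) auto
    moreover have "summand i T =
       (\<lambda>z. a i T * exp ((\<Sum>j<m. \<alpha> T j * exp (- z j)) + - 2 * lform q (gap T) (vdrop m z)))"
      by (intro ext) (simp only: summand_def exp_add mult.assoc)
    ultimately show "analytic_near (m + q) (summand i T) z0" by simp
  qed
  then have "analytic_near (m + q) rad z0"
    unfolding rad_def by (intro analytic_near_sum[of A] analytic_near_sqrt) (auto intro: inner_pos)
  then have "analytic_near (m + q) psi z0"
    unfolding psi_def
    by (intro analytic_near_add analytic_near_const analytic_near_sum analytic_near_cmult
        analytic_near_ln analytic_near_pinch_corr analytic_near_end_corr analytic_near_second_lform
        analytic_near_coord assms rad_pos) auto
  then show ?thesis
    unfolding total_def by (intro analytic_near_add analytic_near_lform)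
qed

lemma exponent_bound:
  assumes "s \<in> Rpos m"
  shows "\<bar>\<Sum>j<m. \<alpha> T j * exp (- vcat m s x j)\<bar> \<le> (\<Sum>j<m. \<bar>\<alpha> T j\<bar>)"
proof -
  have "\<bar>\<Sum>j<m. \<alpha> T j * exp (- vcat m s x j)\<bar> \<le> (\<Sum>j<m. \<bar>\<alpha> T j * exp (- vcat m s x j)\<bar>)"
    by (rule sum_abs)
  also have "\<dots> \<le> (\<Sum>j<m. \<bar>\<alpha> T j\<bar> * 1)"
    using assms by (intro sum_mono) (auto simp: abs_mult Rpos_def less_imp_le intro!: mult_left_le)
  finally show ?thesis by simp
qed

text \<open>Uniform bound, over positive s, for the factors of \<open>summand\<close> other than the
  exponential of the gap.\<close>

definition cap :: "nat \<Rightarrow> 'b \<Rightarrow> real" where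
  "cap i T = a i T * exp (\<Sum>j<m. \<bar>\<alpha> T j\<bar>)"

lemma cap_nonneg: "i \<in> A \<Longrightarrow> T \<in> G i \<Longrightarrow> 0 \<le> cap i T"
  using a_pos[of i T] by (simp add: cap_def)

lemma summand_le:
  assumes "s \<in> Rpos m" "i \<in> A" "T \<in> G i"
  shows "summand i T (vcat m s x) \<le> cap i T * exp (- 2 * lform q (gap T) x)"
proof -
  have "(\<Sum>j<m. \<alpha> T j * exp (- vcat m s x j)) \<le> (\<Sum>j<m. \<bar>\<alpha> T j\<bar>)"
    using exponent_bound[OF assms(1)] by (rule order_trans[OF abs_ge_self])
  then show ?thesis
    unfolding summand_def cap_def vdrop_vcat using a_pos[OF assms(2,3)]
    by (intro mult_right_mono mult_left_mono) auto
qed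

text \<open>The dominant term has gap 0 and alone keeps \<open>rad\<close> away from 0;
  nonnegativity of all gaps on C bounds it from above.\<close>

lemma rad_bounds:
  obtains R0 R1 where "0 < R0" "0 < R1"
    "\<And>s x. s \<in> Rpos m \<Longrightarrow> x \<in> C \<Longrightarrow> R0 \<le> rad (vcat m s x) \<and> rad (vcat m s x) \<le> R1"
proof
  let ?R0 = "sqrt (a i\<^sub>0 \<tau> * exp (- (\<Sum>j<m. \<bar>\<alpha> \<tau> j\<bar>)))"
  let ?R1 = "(\<Sum>i\<in>A. sqrt (\<Sum>T\<in>G i. cap i T)) + 1"
  show "0 < ?R0" using a_pos[OF top] by simp
  show "0 < ?R1" by (intro add_nonneg_pos sum_nonneg) (auto intro!: sum_nonneg cap_nonneg)
  fix s x assume s: "s \<in> Rpos m" and x: "x \<in> C"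
  let ?z = "vcat m s x"
  have "a i\<^sub>0 \<tau> * exp (- (\<Sum>j<m. \<bar>\<alpha> \<tau> j\<bar>)) \<le> summand i\<^sub>0 \<tau> ?z"
  proof -
    have "lform q (gap \<tau>) (vdrop m ?z) = 0" by (simp add: lform_def gap_def)
    moreover have "- (\<Sum>j<m. \<bar>\<alpha> \<tau> j\<bar>) \<le> (\<Sum>j<m. \<alpha> \<tau> j * exp (- ?z j))"
      using exponent_bound[OF s, of \<tau> x] by linarith
    ultimately show ?thesis using a_pos[OF top] by (simp add: summand_def)
  qed
  also have "\<dots> \<le> (\<Sum>T\<in>G i\<^sub>0. summand i\<^sub>0 T ?z)"
    using top G_fin summand_pos by (intro member_le_sum) (auto intro: less_imp_le)
  finally have "?R0 \<le> sqrt (\<Sum>T\<in>G i\<^sub>0. summand i\<^sub>0 T ?z)" by simp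
  also have "\<dots> \<le> rad ?z"
    unfolding rad_def using top A_fin inner_pos
    by (intro member_le_sum[of i\<^sub>0 A "\<lambda>i. sqrt (\<Sum>T\<in>G i. summand i T ?z)"]) (auto intro: less_imp_le)
  finally have "?R0 \<le> rad ?z" .
  moreover have "rad ?z \<le> ?R1"
  proof -
    have "summand i T ?z \<le> cap i T" if "i \<in> A" "T \<in> G i" for i T
    proof -
      have "0 \<le> lform q (gap T) x" using gap_nonneg[OF x that] by (simp add: gap_def[abs_def])
      then have "cap i T * exp (- 2 * lform q (gap T) x) \<le> cap i T * 1"
        by (intro mult_left_mono cap_nonneg that) auto
      then show ?thesis using summand_le[OF s that, of x] by linarith
    qed
    then have "rad ?z \<le> (\<Sum>i\<in>A. sqrt (\<Sum>T\<in>G i. cap i T))"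
      unfolding rad_def by (intro sum_mono real_sqrt_le_mono) auto
    then show ?thesis by simp
  qed
  ultimately show "?R0 \<le> rad ?z \<and> rad ?z \<le> ?R1" by blast
qed

lemma psi_bounded: "\<exists>K. \<forall>s\<in>Rpos m. \<forall>x\<in>C. \<bar>psi (vcat m s x)\<bar> \<le> K"
proof -
  obtain R0 R1 where R: "0 < R0" "0 < R1"
    "\<And>s x. s \<in> Rpos m \<Longrightarrow> x \<in> C \<Longrightarrow> R0 \<le> rad (vcat m s x) \<and> rad (vcat m s x) \<le> R1"
    using rad_bounds by blast
  let ?K = "2 * ln 2 + (\<Sum>j<m. 2 * real (d j) * (2 * ln 2)) + (\<Sum>j<e. 2 * real (d' j) * (2 * ln 2))
     + 2 * (\<bar>ln R0\<bar> + \<bar>ln R1\<bar>)"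
  have "\<bar>psi (vcat m s x)\<bar> \<le> ?K" if s: "s \<in> Rpos m" and x: "x \<in> C" for s x
  proof -
    let ?z = "vcat m s x"
    have "\<bar>\<Sum>j<m. 2 * real (d j) * pinch_corr (?z j)\<bar> \<le> (\<Sum>j<m. \<bar>2 * real (d j) * pinch_corr (?z j)\<bar>)"
      by (rule sum_abs)
    also have "\<dots> \<le> (\<Sum>j<m. 2 * real (d j) * (2 * ln 2))"
      using s by (intro sum_mono weighted_abs_le pinch_corr_bound) (auto simp: Rpos_def)
    finally have 1: "\<bar>\<Sum>j<m. 2 * real (d j) * pinch_corr (?z j)\<bar> \<le> (\<Sum>j<m. 2 * real (d j) * (2 * ln 2))" .
    have "\<bar>\<Sum>j<e. 2 * real (d' j) * end_corr (lform q (\<xi> j) (vdrop m ?z))\<bar>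
       \<le> (\<Sum>j<e. \<bar>2 * real (d' j) * end_corr (lform q (\<xi> j) (vdrop m ?z))\<bar>)"
      by (rule sum_abs)
    also have "\<dots> \<le> (\<Sum>j<e. 2 * real (d' j) * (2 * ln 2))"
      using end_form_ge1[OF x] by (intro sum_mono weighted_abs_le end_corr_bound) auto
    finally have 2: "\<bar>\<Sum>j<e. 2 * real (d' j) * end_corr (lform q (\<xi> j) (vdrop m ?z))\<bar>
       \<le> (\<Sum>j<e. 2 * real (d' j) * (2 * ln 2))" .
    have "ln R0 \<le> ln (rad ?z)" "ln (rad ?z) \<le> ln R1" using R(3)[OF s x] R(1,2) rad_pos by simp_all
    then have 3: "\<bar>ln (rad ?z)\<bar> \<le> \<bar>ln R0\<bar> + \<bar>ln R1\<bar>" by linarith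
    have aux: "\<bar>k + b + c + 2 * l\<bar> \<le> k + b' + c' + 2 * l'"
      if "\<bar>b\<bar> \<le> b'" "\<bar>c\<bar> \<le> c'" "\<bar>l\<bar> \<le> l'" "0 \<le> k" for k b b' c c' l l' :: real
      using that by linarith
    show ?thesis unfolding psi_def by (rule aux[OF 1 2 3]) simp
  qed
  then show ?thesis by blast
qed

lemma lform_deriv:
  assumes "p < q"
  shows "((\<lambda>t. lform q f (vdrop m (z(m + p := t)))) has_real_derivative f p) (at t0)"
  unfolding vdrop_fun_upd lform_fun_upd[OF assms]
  by (auto intro!: derivative_eq_intros)

text \<open>The derivative in direction x_p as the chain rule delivers it. No
  \<open>pinch_corr\<close> term appears, because these corrections only see the first m
  coordinates.\<close>

definition psi_deriv :: "nat \<Rightarrow> (nat \<Rightarrow> real) \<Rightarrow> real" where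
  "psi_deriv p z = (\<Sum>j<e. 2 * real (d' j) * - (\<xi> j p * (exp (- lform q (\<xi> j) (vdrop m z)) / (1 - exp (- lform q (\<xi> j) (vdrop m z))))))
     + 2 * ((\<Sum>i\<in>A. (\<Sum>T\<in>G i. - 2 * gap T p * summand i T z) / (2 * sqrt (\<Sum>T\<in>G i. summand i T z))) / rad z)"

lemma summand_deriv:
  assumes "p < q"
  shows "((\<lambda>t. summand i T (z(m + p := t))) has_real_derivative
     - 2 * gap T p * summand i T (z(m + p := t0))) (at t0)"
proof -
  \<comment> \<open>The update happens at m + p, so the factor that depends on the first m
    coordinates is constant in t.\<close>
  define K where "K = a i T * exp (\<Sum>j<m. \<alpha> T j * exp (- z j))"
  have eq: "summand i T (z(m + p := t)) = K * exp (- 2 * lform q (gap T) (vdrop m (z(m + p := t))))" for t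
    by (simp add: summand_def K_def)
  show ?thesis
    unfolding eq
    by (rule derivative_eq_intros lform_deriv[OF assms] refl)+ (simp add: algebra_simps)
qed

lemma psi_has_deriv:
  assumes p: "p < q" and z: "\<And>j. j < e \<Longrightarrow> 0 < lform q (\<xi> j) (vdrop m z)"
  shows "((\<lambda>t. psi (z(m + p := t))) has_real_derivative psi_deriv p z) (at (z (m + p)))"
proof -
  have upd: "z(m + p := z (m + p)) = z" by simp
  have sq: "((\<lambda>t. sqrt (\<Sum>T\<in>G i. summand i T (z(m + p := t)))) has_real_derivative
      (\<Sum>T\<in>G i. - 2 * gap T p * summand i T z) / (2 * sqrt (\<Sum>T\<in>G i. summand i T z))) (at (z (m + p)))"
    if "i \<in> A" for i
  proof -
    define F where "F t = (\<Sum>T\<in>G i. summand i T (z(m + p := t)))" for t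
    have Fz: "F (z (m + p)) = (\<Sum>T\<in>G i. summand i T z)" by (simp add: F_def)
    have "(F has_real_derivative (\<Sum>T\<in>G i. - 2 * gap T p * summand i T z)) (at (z (m + p)))"
      unfolding F_def
    proof (rule DERIV_sum)
      fix T
      show "((\<lambda>t. summand i T (z(m + p := t))) has_real_derivative - 2 * gap T p * summand i T z) (at (z (m + p)))"
        using summand_deriv[OF p, of i T z "z (m + p)"] by (simp only: upd)
    qed
    moreover have "(sqrt has_real_derivative inverse (sqrt (F (z (m + p)))) / 2) (at (F (z (m + p))))"
      using inner_pos[OF that, of z] unfolding Fz by (rule DERIV_real_sqrt)
    ultimately have "((\<lambda>t. sqrt (F t)) has_real_derivative
        inverse (sqrt (F (z (m + p)))) / 2 * (\<Sum>T\<in>G i. - 2 * gap T p * summand i T z)) (at (z (m + p)))"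
      by (rule DERIV_chain')
    moreover have "inverse y / 2 * x = x / (2 * y)" for x y :: real by (simp add: field_simps)
    ultimately show ?thesis unfolding Fz by (simp only: F_def)
  qed
  have "((\<lambda>t. rad (z(m + p := t))) has_real_derivative
      (\<Sum>i\<in>A. (\<Sum>T\<in>G i. - 2 * gap T p * summand i T z) / (2 * sqrt (\<Sum>T\<in>G i. summand i T z)))) (at (z (m + p)))"
    (is "(_ has_real_derivative ?r) _")
    unfolding rad_def by (rule DERIV_sum) (rule sq)
  moreover have "(ln has_real_derivative 1 / rad z) (at (rad (z(m + p := z (m + p)))))"
    unfolding upd by (rule DERIV_ln_divide[OF rad_pos])
  ultimately have "((\<lambda>t. ln (rad (z(m + p := t)))) has_real_derivative 1 / rad z * ?r) (at (z (m + p)))"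
    by (rule DERIV_chain')
  then have lnrad: "((\<lambda>t. ln (rad (z(m + p := t)))) has_real_derivative ?r / rad z) (at (z (m + p)))"
    by (simp only: times_divide_eq_left mult_1_left)
  have endc: "((\<lambda>t. end_corr (lform q (\<xi> j) (vdrop m (z(m + p := t))))) has_real_derivative
      - (\<xi> j p * (exp (- lform q (\<xi> j) (vdrop m z)) / (1 - exp (- lform q (\<xi> j) (vdrop m z)))))) (at (z (m + p)))"
    if "j < e" for j
    using end_corr_deriv[OF lform_deriv[OF p, of "\<xi> j" z "z (m + p)"]] z[OF that] by (simp only: upd)
  have "((\<lambda>t. 2 * ln 2 + (\<Sum>j<m. 2 * real (d j) * pinch_corr (z j))
     + (\<Sum>j<e. 2 * real (d' j) * end_corr (lform q (\<xi> j) (vdrop m (z(m + p := t))))) + 2 * ln (rad (z(m + p := t))))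
     has_real_derivative 0 + 0 + (\<Sum>j<e. 2 * real (d' j) * - (\<xi> j p * (exp (- lform q (\<xi> j) (vdrop m z)) / (1 - exp (- lform q (\<xi> j) (vdrop m z)))))) + 2 * (?r / rad z)) (at (z (m + p)))"
    by (intro DERIV_add DERIV_const DERIV_sum DERIV_cmult endc lnrad) auto
  moreover have "psi (z(m + p := t)) = 2 * ln 2 + (\<Sum>j<m. 2 * real (d j) * pinch_corr (z j))
     + (\<Sum>j<e. 2 * real (d' j) * end_corr (lform q (\<xi> j) (vdrop m (z(m + p := t))))) + 2 * ln (rad (z(m + p := t)))" for t
    by (simp add: psi_def)
  ultimately show ?thesis unfolding psi_deriv_def by (simp only: add_0_left)
qed

end

section \<open>Exponential decay of the derivatives of psi\<close>

context cell_normal_form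
begin

text \<open>Every term of the derivative carries a coefficient \<open>\<xi> j p\<close> or
  \<open>gap T p\<close>. If it vanishes, so does the term; otherwise x_p lies below the form
  itself, whose decaying exponential is then at most exp (- x_p). Division by \<open>rad\<close> is
  harmless because of its lower bound.\<close>

lemma psi_deriv_bound: "\<exists>c>0. \<forall>p<q. \<forall>s\<in>Rpos m. \<forall>x\<in>C. \<bar>psi_deriv p (vcat m s x)\<bar> \<le> c * exp (- x p)"
proof -
  obtain R0 R1 where R0: "0 < R0" "0 < R1"
    and R: "\<And>s x. s \<in> Rpos m \<Longrightarrow> x \<in> C \<Longrightarrow> R0 \<le> rad (vcat m s x) \<and> rad (vcat m s x) \<le> R1"
    using rad_bounds by blast
  define c1 where "c1 p = (\<Sum>j<e. 2 * real (d' j) * (\<bar>\<xi> j p\<bar> * 2))" for p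
  define c2 where "c2 p = (\<Sum>i\<in>A. \<Sum>T\<in>G i. \<bar>gap T p\<bar> * sqrt (cap i T))" for p
  define c where "c p = c1 p + 2 * (c2 p / R0)" for p
  have c2_nonneg: "0 \<le> c2 p" for p
    unfolding c2_def by (intro sum_nonneg mult_nonneg_nonneg) (auto intro: cap_nonneg)
  have c_nonneg: "0 \<le> c p" for p
    unfolding c_def c1_def using c2_nonneg R0
    by (intro add_nonneg_nonneg sum_nonneg mult_nonneg_nonneg divide_nonneg_pos) auto
  have bound: "\<bar>psi_deriv p (vcat m s x)\<bar> \<le> c p * exp (- x p)" if p: "p < q" and s: "s \<in> Rpos m" and x: "x \<in> C" for p s x
  proof -
    let ?z = "vcat m s x"
    let ?w = "\<lambda>j. lform q (\<xi> j) x"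
    let ?E = "exp (- x p)"
    have "\<bar>\<Sum>j<e. 2 * real (d' j) * - (\<xi> j p * (exp (- ?w j) / (1 - exp (- ?w j))))\<bar>
       \<le> (\<Sum>j<e. \<bar>2 * real (d' j) * - (\<xi> j p * (exp (- ?w j) / (1 - exp (- ?w j))))\<bar>)"
      by (rule sum_abs)
    also have "\<dots> \<le> (\<Sum>j<e. 2 * real (d' j) * (\<bar>\<xi> j p\<bar> * 2 * ?E))"
    proof (intro sum_mono weighted_abs_le)
      fix j assume "j \<in> {..<e}"
      then have j: "j < e" by simp
      have half: "exp (- ?w j) \<le> 1/2" using end_form_ge1[OF x j] by (rule exp_neg_le_half)
      show "\<bar>- (\<xi> j p * (exp (- ?w j) / (1 - exp (- ?w j))))\<bar> \<le> \<bar>\<xi> j p\<bar> * 2 * ?E"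
      proof (cases "\<xi> j p = 0")
        case False
        have "exp (- ?w j) / (1 - exp (- ?w j)) \<le> exp (- ?w j) / (1/2)"
          using half end_form_ge1[OF x j] by (intro divide_left_mono) auto
        also have "\<dots> \<le> 2 * ?E" using end_form_above[OF x j p False] by simp
        finally have "\<bar>\<xi> j p\<bar> * (exp (- ?w j) / (1 - exp (- ?w j))) \<le> \<bar>\<xi> j p\<bar> * (2 * ?E)"
          by (intro mult_left_mono) auto
        moreover have "\<bar>1 - exp (- ?w j)\<bar> = 1 - exp (- ?w j)" using half by linarith
        ultimately show ?thesis by (simp add: abs_mult abs_divide mult.assoc)
      qed simp
    qed
    also have "\<dots> = c1 p * ?E" by (simp add: c1_def sum_distrib_right mult.assoc)
    finally have 1: "\<bar>\<Sum>j<e. 2 * real (d' j) * - (\<xi> j p * (exp (- ?w j) / (1 - exp (- ?w j))))\<bar> \<le> c1 p * ?E" .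
    let ?r = "\<Sum>i\<in>A. (\<Sum>T\<in>G i. - 2 * gap T p * summand i T ?z) / (2 * sqrt (\<Sum>T\<in>G i. summand i T ?z))"
    have "\<bar>(\<Sum>T\<in>G i. - 2 * gap T p * summand i T ?z) / (2 * sqrt (\<Sum>T\<in>G i. summand i T ?z))\<bar>
        \<le> (\<Sum>T\<in>G i. \<bar>gap T p\<bar> * sqrt (cap i T)) * ?E" if i: "i \<in> A" for i
    proof -
      let ?Q = "\<Sum>T\<in>G i. summand i T ?z"
      have Q: "0 < ?Q" using inner_pos[OF i] .
      have "\<bar>\<Sum>T\<in>G i. - 2 * gap T p * summand i T ?z\<bar> \<le> (\<Sum>T\<in>G i. \<bar>- 2 * gap T p * summand i T ?z\<bar>)"
        by (rule sum_abs)
      also have "\<dots> \<le> (\<Sum>T\<in>G i. \<bar>gap T p\<bar> * sqrt (cap i T) * ?E * (2 * sqrt ?Q))"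
      proof (rule sum_mono)
        fix T assume T: "T \<in> G i"
        let ?b = "summand i T ?z"
        have b: "0 < ?b" using summand_pos[OF i T] .
        \<comment> \<open>The radicand Q need not have a positive lower bound when the dominant
          exponent is missing from \<open>G i\<close>. Writing b = sqrt b * sqrt b with one factor
          at most sqrt Q cancels the denominator; the other factor decays like the exponential of
          minus the gap.\<close>
        have "?b \<le> ?Q"
          using T G_fin[OF i] summand_pos[OF i] by (intro member_le_sum) (auto intro: less_imp_le)
        then have bQ: "sqrt ?b \<le> sqrt ?Q" by simp
        show "\<bar>- 2 * gap T p * ?b\<bar> \<le> \<bar>gap T p\<bar> * sqrt (cap i T) * ?E * (2 * sqrt ?Q)"
        proof (cases "gap T p = 0")
          case False
          have "x p \<le> lform q (gap T) x"
            using gap_above[OF x i T p] False by (simp add: gap_def[abs_def])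
          then have e: "exp (- lform q (gap T) x) \<le> ?E" by simp
          have "sqrt ?b \<le> sqrt (cap i T * exp (- 2 * lform q (gap T) x))"
            using summand_le[OF s i T] by simp
          also have "exp (- 2 * lform q (gap T) x) = exp (- lform q (gap T) x) ^ 2"
            by (simp add: exp_double[symmetric])
          also have "sqrt (cap i T * exp (- lform q (gap T) x) ^ 2) = sqrt (cap i T) * exp (- lform q (gap T) x)"
            by (simp add: real_sqrt_mult)
          also have "\<dots> \<le> sqrt (cap i T) * ?E"
            using e cap_nonneg[OF i T] by (intro mult_left_mono) auto
          finally have "sqrt ?b \<le> sqrt (cap i T) * ?E" .
          then have "sqrt ?b * sqrt ?b \<le> (sqrt (cap i T) * ?E) * sqrt ?Q"
            using bQ b cap_nonneg[OF i T] by (intro mult_mono) auto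
          then have "2 * \<bar>gap T p\<bar> * ?b \<le> 2 * \<bar>gap T p\<bar> * ((sqrt (cap i T) * ?E) * sqrt ?Q)"
            using b by (intro mult_left_mono) auto
          moreover have "\<bar>- 2 * gap T p * ?b\<bar> = 2 * \<bar>gap T p\<bar> * ?b" using b by (simp add: abs_mult)
          ultimately show ?thesis by (simp add: mult_ac)
        qed (simp add: mult_nonneg_nonneg)
      qed
      also have "\<dots> = (\<Sum>T\<in>G i. \<bar>gap T p\<bar> * sqrt (cap i T)) * ?E * (2 * sqrt ?Q)"
        by (simp only: sum_distrib_right)
      finally show ?thesis using Q by (simp add: abs_divide pos_divide_le_eq)
    qed
    then have "\<bar>?r\<bar> \<le> (\<Sum>i\<in>A. (\<Sum>T\<in>G i. \<bar>gap T p\<bar> * sqrt (cap i T)) * ?E)"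
      by (intro order_trans[OF sum_abs] sum_mono)
    also have "\<dots> = c2 p * ?E" by (simp add: c2_def sum_distrib_right)
    finally have r: "\<bar>?r\<bar> \<le> c2 p * ?E" .
    have "\<bar>?r / rad ?z\<bar> = \<bar>?r\<bar> / rad ?z" using rad_pos[of ?z] by (simp add: abs_divide)
    also have "\<dots> \<le> (c2 p * ?E) / R0"
      using r R[OF s x] R0 c2_nonneg by (intro frac_le) auto
    finally have "\<bar>?r / rad ?z\<bar> \<le> c2 p / R0 * ?E" by simp
    then have "\<bar>psi_deriv p ?z\<bar> \<le> c1 p * ?E + 2 * (c2 p / R0 * ?E)"
      using 1 unfolding psi_deriv_def vdrop_vcat by linarith
    also have "\<dots> = c p * ?E" by (simp add: c_def distrib_right)
    finally show ?thesis .
  qed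
  show ?thesis
  \<comment> \<open>The sum replaces the constants \<open>c p\<close> by one that serves all p;
    adding 1 keeps it positive even for q = 0.\<close>
  proof (intro exI[of _ "(\<Sum>p<q. c p) + 1"] conjI allI impI ballI)
    show "0 < (\<Sum>p<q. c p) + 1" using c_nonneg by (intro add_nonneg_pos sum_nonneg) auto
    fix p s x assume *: "p < q" "s \<in> Rpos m" "x \<in> C"
    have "c p \<le> (\<Sum>p<q. c p) + 1" using member_le_sum[of p "{..<q}" c] *(1) c_nonneg by force
    then have "c p * exp (- x p) \<le> ((\<Sum>p<q. c p) + 1) * exp (- x p)" by (intro mult_right_mono) auto
    then show "\<bar>psi_deriv p (vcat m s x)\<bar> \<le> ((\<Sum>p<q. c p) + 1) * exp (- x p)" using bound[OF *] by linarith
  qed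
qed

end

section \<open>Coercivity, properness and the simplified form\<close>

context cell_normal_form
begin

lemma C_Rn: "C \<subseteq> Rn q"
  using C_chamber by auto

lemma C_nonneg: "x \<in> C \<Longrightarrow> p < q \<Longrightarrow> 0 \<le> x p"
  using C_chamber by auto

text \<open>At s = (1,...,1) the function \<open>total\<close> differs from \<open>Lam0\<close> by a
  bounded amount, so an upper bound for \<open>Lam0\<close> bounds \<open>total\<close>, and the
  hypothesis then bounds the coordinates.\<close>

lemma Lam0_sublevel_bounded:
  assumes "\<And>B. \<exists>R. \<forall>x\<in>C. total (vcat m (\<lambda>i. if i < m then 1 else 0) x) \<le> B \<longrightarrow> (\<forall>p<q. x p \<le> R)"
  shows "\<exists>R. \<forall>x\<in>closure C. lform q Lam0 x \<le> B \<longrightarrow> (\<forall>p<q. \<bar>x p\<bar> \<le> R)"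
proof -
  let ?s = "\<lambda>i. if i < m then 1 else 0 :: real"
  have s: "?s \<in> Rpos m" by (auto simp: Rpos_def Rn_iff)
  obtain K where K: "\<And>s x. s \<in> Rpos m \<Longrightarrow> x \<in> C \<Longrightarrow> \<bar>psi (vcat m s x)\<bar> \<le> K"
    using psi_bounded by blast
  obtain R where R: "\<And>x. x \<in> C \<Longrightarrow> total (vcat m ?s x) \<le> (\<Sum>j<m. 2 * real (d j)) + (B + 1) + K \<Longrightarrow> \<forall>p<q. x p \<le> R"
    using assms by metis
  \<comment> \<open>Both alternatives are closed conditions, so the inclusion of C passes to its
    closure. The slack between B and B + 1 rules out the first alternative wherever
    \<open>Lam0\<close> is at most B.\<close>
  define S where "S = {x. B + 1 \<le> lform q Lam0 x} \<union> (\<Inter>p\<in>{..<q}. {x. \<bar>x p\<bar> \<le> R})"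
  have "closed S"
    unfolding S_def by (intro closed_Un closed_INT closed_Collect_le continuous_intros ballI)
  moreover have "C \<subseteq> S"
  proof
    fix x assume x: "x \<in> C"
    show "x \<in> S"
    proof (cases "B + 1 \<le> lform q Lam0 x")
      case False
      have "psi (vcat m ?s x) \<le> K" using K[OF s x] by linarith
      moreover have "(\<Sum>j<m. 2 * real (d j) * vcat m ?s x j) = (\<Sum>j<m. 2 * real (d j))"
        by (intro sum.cong) auto
      ultimately have "total (vcat m ?s x) \<le> (\<Sum>j<m. 2 * real (d j)) + (B + 1) + K"
        using False unfolding total_def lform_Lam vdrop_vcat by linarith
      from R[OF x this] show ?thesis using C_nonneg[OF x] by (auto simp: S_def)
    qed (simp add: S_def)
  qed
  ultimately have "closure C \<subseteq> S" by (rule closure_minimal[rotated])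
  then show ?thesis by (intro exI[of _ R]) (force simp: S_def)
qed

lemma closure_scale:
  assumes "\<And>x. x \<in> C \<Longrightarrow> (\<lambda>i. r * x i) \<in> C" "x \<in> closure C"
  shows "(\<lambda>i. r * x i) \<in> closure C"
proof -
  have "continuous_on (closure C) (\<lambda>x i. r * x i)"
    by (intro continuous_on_coordinatewise_then_product continuous_intros)
  then have "(\<lambda>x i. r * x i) ` closure C \<subseteq> closure C"
    using assms(1) closure_subset by (intro image_closure_subset) auto
  then show ?thesis using assms(2) by blast
qed

lemma closure_C_chamber: "closure C \<subseteq> {x \<in> Rn q. \<forall>p<q. 0 \<le> x p}"
proof (rule closure_minimal)
  have "{x \<in> Rn q. \<forall>p<q. 0 \<le> x p} = Rn q \<inter> (\<Inter>p\<in>{..<q}. {x. 0 \<le> x p})" by auto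
  moreover have "closed (Rn q)" using closedin_Euclidean_space_iff[of q "Rn q"] by auto
  ultimately show "closed {x \<in> Rn q. \<forall>p<q. 0 \<le> x p}"
    by (auto intro!: closed_Int closed_INT closed_Collect_le continuous_intros)
qed (use C_Rn C_nonneg in auto)

text \<open>Scaling is restricted to r >= 1 because C inherits inequalities of the form w_j >= 1.
  The hypothesis \<open>coercive\<close> is the trace of properness along s = (1,...,1); both
  positivity and properness of Lambda are derived from it.\<close>

lemma simplified:
  assumes scale: "\<And>x r. x \<in> C \<Longrightarrow> 1 \<le> r \<Longrightarrow> (\<lambda>i. r * x i) \<in> C"
    and coercive: "\<And>B. \<exists>R. \<forall>x\<in>C. total (vcat m (\<lambda>i. if i < m then 1 else 0) x) \<le> B \<longrightarrow> (\<forall>p<q. x p \<le> R)"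
    and h: "\<And>s x. s \<in> Rpos m \<Longrightarrow> x \<in> C \<Longrightarrow> 0 \<le> h (vcat m s x) \<and> h (vcat m s x) = total (vcat m s x)"
  shows "simplified_length_type m q C h"
proof -
  define D where "D = vprod m (Rpos m) C"
  define D' where "D' = vprod m (Rnonneg m) (Euclidean_space q closure_of C)"
  \<comment> \<open>The end forms are at least 1 on C, so the closure of D stays inside this open
    set, on which \<open>end_corr\<close> of the end forms is analytic.\<close>
  define V where "V = {z \<in> Rn (m + q). \<forall>j<e. 0 < lform q (\<xi> j) (vdrop m z)}"
  have D_iff: "\<exists>s x. z = vcat m s x \<and> s \<in> Rpos m \<and> x \<in> C" if "z \<in> D" for z
    using that by (auto simp: D_def vprod_def)
  have D'_iff: "z \<in> D' \<longleftrightarrow> z \<in> Rn (m + q) \<and> (\<forall>i<m. 0 \<le> z i) \<and> vdrop m z \<in> closure C" for z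
  proof
    assume "z \<in> D'"
    then obtain s x where z: "z = vcat m s x" "s \<in> Rnonneg m" "x \<in> closure C"
      by (auto simp: D'_def vprod_def closure_of_Euclidean_space[OF C_Rn])
    then have "x \<in> Rn q" using closure_C_chamber by blast
    then show "z \<in> Rn (m + q) \<and> (\<forall>i<m. 0 \<le> z i) \<and> vdrop m z \<in> closure C"
      using z vcat_in_Rn by (auto simp: Rnonneg_def)
  next
    assume z: "z \<in> Rn (m + q) \<and> (\<forall>i<m. 0 \<le> z i) \<and> vdrop m z \<in> closure C"
    have "z = vcat m (vtake m z) (vdrop m z)" by (auto simp: vcat_def vtake_def vdrop_def fun_eq_iff)
    moreover have "vtake m z \<in> Rnonneg m" using z by (auto simp: Rnonneg_def vtake_def Rn_iff)
    ultimately show "z \<in> D'"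
      using z by (auto simp: D'_def vprod_def closure_of_Euclidean_space[OF C_Rn])
  qed
  have clRn: "closed (Rn d)" for d using closedin_Euclidean_space_iff[of d "Rn d"] by auto
  have "closed D'"
  proof -
    have "D' = Rn (m + q) \<inter> (\<Inter>i\<in>{..<m}. {z. 0 \<le> z i}) \<inter> (vdrop m -` closure C)"
      using D'_iff by auto
    moreover have "closed (vdrop m -` closure C)"
      by (intro closed_vimage closed_closure continuous_intros)
    ultimately show ?thesis
      using clRn by (auto intro!: closed_Int closed_INT closed_Collect_le continuous_intros)
  qed
  have Lam0_pos: "0 < lform q Lam0 x" if x: "x \<in> closure C" "x \<noteq> (\<lambda>_. 0)" for x
  proof (rule ccontr)
    assume neg: "\<not> 0 < lform q Lam0 x"
    obtain R where R: "\<And>x. x \<in> closure C \<Longrightarrow> lform q Lam0 x \<le> 0 \<Longrightarrow> \<forall>p<q. \<bar>x p\<bar> \<le> R"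
      using Lam0_sublevel_bounded[OF coercive, of 0] by blast
    have xR: "x \<in> Rn q" and x0: "\<And>p. p < q \<Longrightarrow> 0 \<le> x p" using x(1) closure_C_chamber by auto
    obtain p where "x p \<noteq> 0" using x(2) by auto
    then have p: "p < q" "0 < x p" using RnD[OF xR, of p] x0[of p] by force+
    \<comment> \<open>With this factor the p-th coordinate of r x equals \<bar>R\<bar> + x_p, beyond
      the bound R, although the ray through x stays in the sublevel set at 0.\<close>
    define r where "r = \<bar>R\<bar> / x p + 1"
    have r: "1 \<le> r" using p by (simp add: r_def)
    have "(\<lambda>i. r * x i) \<in> closure C" using scale r x(1) by (intro closure_scale) auto
    moreover have "lform q Lam0 (\<lambda>i. r * x i) \<le> 0"
      using neg r unfolding lform_scale by (intro mult_nonneg_nonpos) auto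
    ultimately have "\<bar>r * x p\<bar> \<le> R" using R p(1) by blast
    moreover have "r * x p = \<bar>R\<bar> + x p" using p by (simp add: r_def field_simps)
    ultimately show False using p by linarith
  qed
  have Lam0_nonneg: "0 \<le> lform q Lam0 x" if "x \<in> closure C" for x
    using Lam0_pos[OF that] by (cases "x = (\<lambda>_. 0)") (auto simp: lform_def)
  have Lam_pos: "0 < lform (m + q) Lam z" if z: "z \<in> D'" "z \<noteq> (\<lambda>_. 0)" for z
  proof (cases "vdrop m z = (\<lambda>_. 0)")
    case False
    then have "0 < lform q Lam0 (vdrop m z)" using z D'_iff by (intro Lam0_pos) auto
    moreover have "0 \<le> (\<Sum>j<m. 2 * real (d j) * z j)"
      using z(1) D'_iff by (intro sum_nonneg) auto
    ultimately show ?thesis unfolding lform_Lam by linarith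
  next
    case True
    obtain i where i: "z i \<noteq> 0" using z(2) by auto
    have "i < m"
    proof (rule ccontr)
      assume "\<not> i < m"
      then have "z i = vdrop m z (i - m)" by (simp add: vdrop_def)
      then show False using i True by simp
    qed
    then have "0 < (\<Sum>j<m. 2 * real (d j) * z j)"
      using z(1) D'_iff i d_pos[of i] by (intro sum_pos2[of _ i]) (auto simp: order_less_le)
    moreover have "0 \<le> lform q Lam0 (vdrop m z)" using z(1) D'_iff Lam0_nonneg by auto
    ultimately show ?thesis unfolding lform_Lam by linarith
  qed
  have proper: "proper_map (subtopology (Euclidean_space (m + q)) D') euclideanreal (lform (m + q) Lam)"
  proof (rule compact_imp_proper_map)
    show "kc_space euclideanreal" using Hausdorff_imp_kc_space Hausdorff_space_euclidean by blast
    have DR: "D' \<subseteq> Rn (m + q)" using D'_iff by blast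
    then have "{x. \<forall>i\<ge>m + q. x i = 0} \<inter> D' = D'" by (auto simp: topspace_Euclidean_space)
    then have sub: "subtopology (Euclidean_space (m + q)) D' = top_of_set D'"
      unfolding Euclidean_space_def euclidean_product_topology subtopology_subtopology by (rule arg_cong)
    show "continuous_map (subtopology (Euclidean_space (m + q)) D') euclideanreal (lform (m + q) Lam)
        \<or> kc_space (subtopology (Euclidean_space (m + q)) D')"
      unfolding sub by (auto intro!: continuous_intros)
    fix K :: "real set" assume "compactin euclideanreal K"
    then have K: "compact K" by simp
    then obtain B where B: "\<And>y. y \<in> K \<Longrightarrow> y \<le> B"
      by (meson bounded_imp_bdd_above compact_imp_bounded bdd_above_def)
    obtain R where R: "\<And>x. x \<in> closure C \<Longrightarrow> lform q Lam0 x \<le> B \<Longrightarrow> \<forall>p<q. \<bar>x p\<bar> \<le> R"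
      using Lam0_sublevel_bounded[OF coercive, of B] by blast
    let ?P = "{z \<in> D'. lform (m + q) Lam z \<in> K}"
    \<comment> \<open>Both blocks of Lambda are nonnegative on D', so an upper bound for the sum
      bounds each of them. The s_i have coefficients at least 1; the other coordinates are bounded
      through the sublevel set of \<open>Lam0\<close>.\<close>
    have "?P \<subseteq> {z \<in> Rn (m + q). \<forall>i<m + q. \<bar>z i\<bar> \<le> max \<bar>B\<bar> \<bar>R\<bar>}"
    proof (intro subsetI CollectI conjI allI impI)
      fix z assume z: "z \<in> ?P"
      then show "z \<in> Rn (m + q)" using DR by auto
      fix i assume i: "i < m + q"
      have zD: "\<And>j. j < m \<Longrightarrow> 0 \<le> z j" "vdrop m z \<in> closure C" using z D'_iff by auto
      have le: "(\<Sum>j<m. 2 * real (d j) * z j) + lform q Lam0 (vdrop m z) \<le> B"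
        using z B by (auto simp flip: lform_Lam)
      have nn: "0 \<le> 2 * real (d j) * z j" if "j < m" for j using zD(1)[OF that] by simp
      have nonneg: "0 \<le> (\<Sum>j<m. 2 * real (d j) * z j)" using nn by (intro sum_nonneg) auto
      show "\<bar>z i\<bar> \<le> max \<bar>B\<bar> \<bar>R\<bar>"
      proof (cases "i < m")
        case True
        have "1 * z i \<le> 2 * real (d i) * z i"
          using d_pos[OF True] zD(1)[OF True] by (intro mult_right_mono) auto
        also have "\<dots> \<le> (\<Sum>j<m. 2 * real (d j) * z j)"
          using True nn by (intro member_le_sum) auto
        finally have "z i \<le> B" using le Lam0_nonneg[OF zD(2)] by linarith
        then show ?thesis using zD(1)[OF True] by simp
      next
        case False
        then have "z i = vdrop m z (i - m)" "i - m < q" using i by (auto simp: vdrop_def)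
        then have "\<bar>z i\<bar> \<le> R" using R[OF zD(2)] le nonneg by auto
        then show ?thesis by simp
      qed
    qed
    moreover have "closed ?P"
    proof -
      have "?P = D' \<inter> lform (m + q) Lam -` K" by auto
      then show ?thesis
        using \<open>closed D'\<close> compact_imp_closed[OF K]
        by (auto intro!: closed_Int closed_vimage continuous_intros)
    qed
    ultimately have "compact ?P"
      using compact_coordinate_box[of "m + q" "max \<bar>B\<bar> \<bar>R\<bar>"] compact_Int_closed
      by (metis (no_types, lifting) Int_absorb1)
    then show "compactin (subtopology (Euclidean_space (m + q)) D')
        {x \<in> topspace (subtopology (Euclidean_space (m + q)) D'). lform (m + q) Lam x \<in> K}"
      unfolding sub by (simp add: compactin_subtopology)
  qed (auto simp: k_space_euclideanreal)
  have openV: "openin (Euclidean_space (m + q)) V"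
  proof -
    have "open (\<Inter>j\<in>{..<e}. {z. 0 < lform q (\<xi> j) (vdrop m z)})"
      by (intro open_INT finite_lessThan ballI open_Collect_less continuous_intros)
    moreover have "V = (\<Inter>j\<in>{..<e}. {z. 0 < lform q (\<xi> j) (vdrop m z)}) \<inter> Rn (m + q)"
      by (auto simp: V_def)
    ultimately show ?thesis
      unfolding Euclidean_space_def openin_subtopology euclidean_product_topology topspace_Euclidean_space
      by auto
  qed
  have closV: "Euclidean_space (m + q) closure_of D \<subseteq> V"
  proof -
    let ?W = "{z \<in> Rn (m + q). \<forall>j<e. 1 \<le> lform q (\<xi> j) (vdrop m z)}"
    have "closed (\<Inter>j\<in>{..<e}. {z. 1 \<le> lform q (\<xi> j) (vdrop m z)})"
      by (intro closed_INT ballI closed_Collect_le continuous_intros)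
    moreover have "?W = (\<Inter>j\<in>{..<e}. {z. 1 \<le> lform q (\<xi> j) (vdrop m z)}) \<inter> Rn (m + q)" by auto
    ultimately have "closedin (Euclidean_space (m + q)) ?W"
      unfolding closedin_Euclidean_space_iff using clRn by (metis (no_types, lifting) Int_lower2 closed_Int)
    moreover have "D \<subseteq> ?W"
      using D_iff end_form_ge1 vcat_in_Rn C_Rn by fastforce
    ultimately have "Euclidean_space (m + q) closure_of D \<subseteq> ?W" by (intro closure_of_minimal)
    also have "?W \<subseteq> V" unfolding V_def by force
    finally show ?thesis .
  qed
  obtain c where c: "0 < c"
    "\<And>p s x. p < q \<Longrightarrow> s \<in> Rpos m \<Longrightarrow> x \<in> C \<Longrightarrow> \<bar>psi_deriv p (vcat m s x)\<bar> \<le> c * exp (- x p)"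
    using psi_deriv_bound by blast
  have deriv: "\<bar>partial_deriv (m + p) psi (vcat m s x)\<bar> \<le> c * exp (- x p)"
    if "p < q" "s \<in> Rpos m" "x \<in> C" for p s x
  proof -
    have "0 < lform q (\<xi> j) (vdrop m (vcat m s x))" if "j < e" for j
      using end_form_ge1[OF \<open>x \<in> C\<close> that] by simp
    from DERIV_imp_deriv[OF psi_has_deriv[OF \<open>p < q\<close> this]]
    have "partial_deriv (m + p) psi (vcat m s x) = psi_deriv p (vcat m s x)"
      by (simp add: partial_deriv_def)
    then show ?thesis using c(2)[OF that] by simp
  qed
  \<comment> \<open>The coordinates are ordered and nonnegative on C, so each coordinate occurring
    in Lambda is at most the last occurring one. The constant is the sum of the absolute
    coefficients, plus 1 for positivity.\<close>
  have growth: "\<exists>M>0. \<forall>x\<in>C. lform (m + q) Lam (vcat m (\<lambda>_. 0) x) \<le> M * x (Max P)"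
    if P: "P = {p. p < q \<and> Lam (m + p) \<noteq> 0}" "P \<noteq> {}" for P
  proof (intro exI[of _ "(\<Sum>p<q. \<bar>Lam0 p\<bar>) + 1"] conjI ballI)
    show "0 < (\<Sum>p<q. \<bar>Lam0 p\<bar>) + 1" by (intro add_nonneg_pos sum_nonneg) auto
    fix x assume x: "x \<in> C"
    have fin: "finite P" using P(1) by auto
    have max: "Max P < q" using Max_in[OF fin P(2)] P(1) by simp
    have "lform (m + q) Lam (vcat m (\<lambda>_. 0) x) = (\<Sum>p<q. Lam0 p * x p)"
      unfolding lform_Lam vdrop_vcat by (simp add: lform_def)
    also have "\<dots> \<le> (\<Sum>p<q. \<bar>Lam0 p\<bar> * x (Max P))"
    proof (rule sum_mono)
      fix p assume "p \<in> {..<q}"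
      then have p: "p < q" by simp
      show "Lam0 p * x p \<le> \<bar>Lam0 p\<bar> * x (Max P)"
      proof (cases "Lam0 p = 0")
        case False
        then have "p \<in> P" using p P(1) by (simp add: Lam_def)
        then have "p \<le> Max P" using fin by simp
        then have "x p \<le> x (Max P)" using C_chamber x max by blast
        then have "\<bar>Lam0 p\<bar> * x p \<le> \<bar>Lam0 p\<bar> * x (Max P)" by (intro mult_left_mono) auto
        moreover have "Lam0 p * x p \<le> \<bar>Lam0 p\<bar> * x p"
          using C_nonneg[OF x p] by (intro mult_right_mono) auto
        ultimately show ?thesis by linarith
      qed simp
    qed
    also have "\<dots> \<le> ((\<Sum>p<q. \<bar>Lam0 p\<bar>) + 1) * x (Max P)"
      using C_nonneg[OF x max] by (simp add: sum_distrib_right[symmetric] distrib_right)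
    finally show "lform (m + q) Lam (vcat m (\<lambda>_. 0) x) \<le> ((\<Sum>p<q. \<bar>Lam0 p\<bar>) + 1) * x (Max P)" .
  qed
  have "real_analytic_on (m + q) total V"
    by (rule real_analytic_onI, rule analytic_near_total) (simp add: V_def)
  moreover have "bounded (psi ` D)"
  proof -
    obtain K where K: "\<And>s x. s \<in> Rpos m \<Longrightarrow> x \<in> C \<Longrightarrow> \<bar>psi (vcat m s x)\<bar> \<le> K" using psi_bounded by blast
    have "norm (psi z) \<le> K" if "z \<in> D" for z using D_iff[OF that] K by auto
    then show ?thesis by (auto intro!: boundedI)
  qed
  moreover have hD: "\<forall>v\<in>D. 0 \<le> h v" "\<forall>v\<in>D. h v = total v" using D_iff h by (blast, metis)
  moreover have "\<forall>i<m. Lam i \<in> \<int> \<and> 0 < Lam i" using d_pos by (auto simp: Lam_def vcat_def Suc_le_eq)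
  moreover have "\<forall>v\<in>V. total v = lform (m + q) Lam v + psi v" by (simp add: total_def)
  moreover have "\<exists>c>0. \<exists>Y. finite Y \<and> Y \<subseteq> Rn q
              \<and> (\<forall>p<q. \<forall>s\<in>Rpos m. \<forall>x\<in>C.
                    \<bar>partial_deriv (m + p) psi (vcat m s x)\<bar>
                      \<le> c * exp (- Min (insert (x p) ((\<lambda>T. lform q T x) ` Y))))
              \<and> (let P = {p. p < q \<and> Lam (m + p) \<noteq> 0}
                 in P \<noteq> {} \<longrightarrow>
                    (\<exists>M>0. \<forall>x\<in>C. lform (m + q) Lam (vcat m (\<lambda>_. 0) x)
                        \<le> M * Min (insert (x (Max P)) ((\<lambda>T. lform q T x) ` Y))))"
    using c(1) deriv growth[OF refl] unfolding Let_def
    by (intro exI[of _ c] conjI exI[of _ "{}"]) auto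
  ultimately show ?thesis
    unfolding simplified_length_type_def Let_def D_def[symmetric] D'_def[symmetric]
    using openV closV Lam_Rn Lam_pos proper
    by (intro conjI exI[of _ V] exI[of _ total] exI[of _ Lam] exI[of _ psi]) blast+
qed

end

section \<open>Cells, permutations and domains\<close>

lemma partition_on_fibres:
  assumes "finite (f ` A)"
  shows "finite ((\<lambda>y. {x \<in> A. f x = y}) ` f ` A)" "partition_on A ((\<lambda>y. {x \<in> A. f x = y}) ` f ` A)"
proof -
  show "finite ((\<lambda>y. {x \<in> A. f x = y}) ` f ` A)" using assms by (rule finite_imageI)
  show "partition_on A ((\<lambda>y. {x \<in> A. f x = y}) ` f ` A)"
    by (rule partition_onI) (auto simp: disjnt_def)
qed

lemma linear_cone_Int:
  assumes "linear_cone d K" "linear_cone d L"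
  shows "linear_cone d (K \<inter> L)"
proof -
  obtain A B where K: "finite A" "finite B" "A \<subseteq> Rn d" "B \<subseteq> Rn d"
    "K = {x \<in> Rn d. (\<forall>T\<in>A. 0 \<le> lform d T x) \<and> (\<forall>T\<in>B. 0 < lform d T x)}"
    using assms(1) unfolding linear_cone_def by blast
  obtain A' B' where L: "finite A'" "finite B'" "A' \<subseteq> Rn d" "B' \<subseteq> Rn d"
    "L = {x \<in> Rn d. (\<forall>T\<in>A'. 0 \<le> lform d T x) \<and> (\<forall>T\<in>B'. 0 < lform d T x)}"
    using assms(2) unfolding linear_cone_def by blast
  show ?thesis
    unfolding linear_cone_def
    by (rule exI[of _ "A \<union> A'"], rule exI[of _ "B \<union> B'"]) (use K L in auto)
qed

lemma linear_cone_nonneg: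
  assumes "J \<subseteq> {..<d}"
  shows "linear_cone d {x \<in> Rn d. \<forall>j\<in>J. 0 \<le> x j}"
  unfolding linear_cone_def
proof (intro exI conjI)
  show "finite (unit_vec ` J)" using assms finite_subset by blast
  show "unit_vec ` J \<subseteq> Rn d" using assms unit_vec_in_Rn by blast
  show "{x \<in> Rn d. \<forall>j\<in>J. 0 \<le> x j} =
    {x \<in> Rn d. (\<forall>T\<in>unit_vec ` J. 0 \<le> lform d T x) \<and> (\<forall>T\<in>{}. 0 < lform d T x)}"
    using assms lform_unit_vec by (auto simp: subset_iff)
qed auto

text \<open>A tie is recorded as a pair present in both orders, so the nonempty fibres are all
  relatively open faces of the arrangement of hyperplanes f = g, lower-dimensional ones
  included.\<close>

definition order_pattern :: "nat \<Rightarrow> (nat \<Rightarrow> real) set \<Rightarrow> (nat \<Rightarrow> real) \<Rightarrow> ((nat \<Rightarrow> real) \<times> (nat \<Rightarrow> real)) set" where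
  "order_pattern d F x = {(f, g). f \<in> F \<and> g \<in> F \<and> lform d f x \<le> lform d g x}"

lemma finite_range_order_pattern:
  assumes "finite F"
  shows "finite (range (order_pattern d F))"
  by (rule finite_subset[of _ "Pow (F \<times> F)"]) (use assms in \<open>auto simp: order_pattern_def\<close>)

lemma order_pattern_leD:
  assumes "order_pattern d F x = order_pattern d F y" "f \<in> F" "g \<in> F" "lform d f x \<le> lform d g x"
  shows "lform d f y \<le> lform d g y"
  using assms unfolding order_pattern_def by blast

lemma order_pattern_scale:
  assumes "0 < r"
  shows "order_pattern d F (\<lambda>i. r * x i) = order_pattern d F x"
  using assms by (simp add: order_pattern_def lform_scale)

text \<open>\<open>L\<close> pulls forms back along \<open>W\<close>. Pairs in the pattern give
  non-strict inequalities, and pairs outside it give strict inequalities in the opposite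
  direction.\<close>

lemma linear_cone_order_pattern:
  assumes "finite F" "F \<subseteq> Rn d" and L: "\<And>f. f \<in> Rn d \<Longrightarrow> L f \<in> Rn d'"
    and LW: "\<And>f x. f \<in> Rn d \<Longrightarrow> x \<in> Rn d' \<Longrightarrow> lform d' (L f) x = lform d f (W x)"
  shows "linear_cone d' {x \<in> Rn d'. order_pattern d F (W x) = order_pattern d F w}"
proof -
  let ?S = "order_pattern d F w"
  define A where "A = (\<lambda>(f, g). L (\<lambda>i. g i - f i)) ` ?S"
  define B where "B = (\<lambda>(f, g). L (\<lambda>i. f i - g i)) ` (F \<times> F - ?S)"
  have diff: "(\<lambda>i. f i - g i) \<in> Rn d" if "f \<in> F" "g \<in> F" for f g
  proof -
    have "f \<in> Rn d" "g \<in> Rn d" using that assms(2) by auto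
    then show ?thesis by (simp add: Rn_iff)
  qed
  have S: "?S \<subseteq> F \<times> F" by (auto simp: order_pattern_def)
  have "finite A" "finite B"
    unfolding A_def B_def using assms(1) finite_subset[OF S] by auto
  moreover have "A \<subseteq> Rn d'" "B \<subseteq> Rn d'"
    unfolding A_def B_def using S L diff by auto
  moreover have "{x \<in> Rn d'. order_pattern d F (W x) = ?S} =
      {x \<in> Rn d'. (\<forall>T\<in>A. 0 \<le> lform d' T x) \<and> (\<forall>T\<in>B. 0 < lform d' T x)}"
  proof (rule Collect_cong, rule conj_cong[OF refl])
    fix x assume x: "x \<in> Rn d'"
    have LL: "lform d' (L (\<lambda>i. f i - g i)) x = lform d f (W x) - lform d g (W x)" if "f \<in> F" "g \<in> F" for f g
      using LW[OF diff[OF that] x] by (simp add: lform_diff_form)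
    have "(\<forall>T\<in>A. 0 \<le> lform d' T x) \<longleftrightarrow> (\<forall>(f, g)\<in>?S. lform d f (W x) \<le> lform d g (W x))"
      unfolding A_def using LL S by fastforce
    moreover have "(\<forall>T\<in>B. 0 < lform d' T x) \<longleftrightarrow> (\<forall>(f, g)\<in>F \<times> F - ?S. \<not> lform d f (W x) \<le> lform d g (W x))"
    proof -
      have "(\<forall>T\<in>B. 0 < lform d' T x) \<longleftrightarrow>
          (\<forall>y\<in>F \<times> F - ?S. 0 < lform d' (L (\<lambda>i. fst y i - snd y i)) x)"
        unfolding B_def by (simp add: case_prod_unfold)
      also have "\<dots> \<longleftrightarrow> (\<forall>y\<in>F \<times> F - ?S. \<not> lform d (fst y) (W x) \<le> lform d (snd y) (W x))"
        by (rule ball_cong) (use LL in auto)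
      finally show ?thesis by (simp add: case_prod_unfold)
    qed
    ultimately show "order_pattern d F (W x) = ?S \<longleftrightarrow> (\<forall>T\<in>A. 0 \<le> lform d' T x) \<and> (\<forall>T\<in>B. 0 < lform d' T x)"
      unfolding order_pattern_def by blast
  qed
  ultimately show ?thesis unfolding linear_cone_def by blast
qed

text \<open>Glued from bijections on three consecutive blocks: onto I, onto the rest of {0,...,n-1},
  and the identity from n on. A permutation of all naturals makes composition with it invertible
  without side conditions.\<close>

lemma sorting_permutation:
  assumes "I \<subseteq> {..<n :: nat}"
  obtains \<rho> \<sigma> where "\<And>i. \<rho> (\<sigma> i) = i" "\<And>i. \<sigma> (\<rho> i) = i" "\<And>i. n \<le> i \<Longrightarrow> \<sigma> i = i"
    "\<And>i. i < n \<Longrightarrow> \<sigma> i < n" "\<And>i. \<sigma> i \<in> I \<longleftrightarrow> i < card I"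
proof -
  have fin: "finite I" using assms finite_subset by blast
  have le: "card I \<le> n" using card_mono[OF _ assms] by simp
  obtain f where f: "bij_betw f {0..<card I} I" using ex_bij_betw_nat_finite[OF fin] by blast
  have "bij_betw (\<lambda>i. i - card I) {card I..<n} {0..<n - card I}"
    by (rule bij_betw_byWitness[where f' = "\<lambda>i. i + card I"]) auto
  moreover obtain g where "bij_betw g {0..<card ({..<n} - I)} ({..<n} - I)"
    using ex_bij_betw_nat_finite[of "{..<n} - I"] by blast
  moreover have "card ({..<n} - I) = n - card I" using card_Diff_subset[OF fin assms] by simp
  ultimately have g: "bij_betw (g \<circ> (\<lambda>i. i - card I)) {card I..<n} ({..<n} - I)"
    using bij_betw_trans by metis
  define \<sigma> where "\<sigma> i = (if i < card I then f i else if i < n then g (i - card I) else i)" for i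
  have \<sigma>1: "bij_betw \<sigma> {0..<card I} I"
    using f by (rule bij_betw_cong[THEN iffD1, rotated]) (simp add: \<sigma>_def)
  have \<sigma>2: "bij_betw \<sigma> {card I..<n} ({..<n} - I)"
    using g by (rule bij_betw_cong[THEN iffD1, rotated]) (simp add: \<sigma>_def)
  have \<sigma>3: "bij_betw \<sigma> {n..} {n..}"
    using bij_betw_id by (rule bij_betw_cong[THEN iffD1, rotated]) (use le in \<open>simp add: \<sigma>_def\<close>)
  have \<sigma>12: "bij_betw \<sigma> ({0..<card I} \<union> {card I..<n}) (I \<union> ({..<n} - I))"
    using bij_betw_combine[OF \<sigma>1 \<sigma>2] by blast
  have "bij_betw \<sigma> (({0..<card I} \<union> {card I..<n}) \<union> {n..}) ((I \<union> ({..<n} - I)) \<union> {n..})"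
    by (rule bij_betw_combine[OF \<sigma>12 \<sigma>3]) (use assms in auto)
  moreover have "({0..<card I} \<union> {card I..<n}) \<union> {n..} = UNIV" "(I \<union> ({..<n} - I)) \<union> {n..} = UNIV"
    using assms le by auto
  ultimately have \<sigma>: "bij \<sigma>" by simp
  show ?thesis
  proof (rule that[of "inv \<sigma>" \<sigma>])
    show "inv \<sigma> (\<sigma> i) = i" for i using \<sigma> by (simp add: bij_is_inj)
    show "\<sigma> (inv \<sigma> i) = i" for i using \<sigma> by (simp add: bij_is_surj surj_f_inv_f)
    show "\<sigma> i = i" if "n \<le> i" for i using le that by (simp add: \<sigma>_def)
    show "\<sigma> i < n" if "i < n" for i
    proof -
      have "i \<in> {0..<card I} \<union> {card I..<n}" using that by auto
      from bij_betw_apply[OF \<sigma>12 this] show ?thesis using assms by auto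
    qed
    show "\<sigma> i \<in> I \<longleftrightarrow> i < card I" for i
    proof
      show "i < card I \<Longrightarrow> \<sigma> i \<in> I" using bij_betw_apply[OF \<sigma>1, of i] by simp
      assume "\<sigma> i \<in> I"
      then have "\<exists>j<card I. \<sigma> j = \<sigma> i" using bij_betw_imp_surj_on[OF \<sigma>1] by (metis atLeastLessThan_iff imageE)
      then show "i < card I" using \<sigma> bij_is_inj injD by metis
    qed
  qed
qed

lemma GL_linear:
  assumes "\<Psi> \<in> GL d" "x \<in> Rn d"
  shows "\<Psi> (\<lambda>i. r * x i) = (\<lambda>i. r * \<Psi> x i)"
  using assms by (simp add: GL_def)

lemma GL_bij: "\<Psi> \<in> GL d \<Longrightarrow> bij_betw \<Psi> (Rn d) (Rn d)"
  by (simp add: GL_def)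

lemma vdrop_in_Rn: "v \<in> Rn (m + q) \<Longrightarrow> vdrop m v \<in> Rn q"
  by (auto simp: vdrop_def Rn_iff)

lemma vdrop_in_Rn_iff: "vdrop m v \<in> Rn q \<longleftrightarrow> v \<in> Rn (m + q)"
proof
  assume R: "vdrop m v \<in> Rn q"
  have "v i = 0" if "m + q \<le> i" for i
    using RnD[OF R, of "i - m"] that by (simp add: vdrop_def)
  then show "v \<in> Rn (m + q)" by (simp add: Rn_iff)
qed (rule vdrop_in_Rn)

lemma vcat_vdrop: "vcat m v (vdrop m v) = v"
  by (auto simp: vcat_def vdrop_def)

lemma vcat_vcat [simp]: "vcat m (vcat m s x) y = vcat m s y"
  by (auto simp: vcat_def)

lemma vcat_vtake [simp]: "vcat m (vtake m s) y = vcat m s y"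
  by (auto simp: vcat_def vtake_def)

text \<open>The inverse undoes \<Theta> on the last block and then permutes back; both identities
  rest on \<rho> and \<sigma> being mutually inverse on all naturals.\<close>

lemma GL_permute_vcat:
  assumes \<Theta>: "\<Theta> \<in> GL q" and \<sigma>: "\<And>i. \<rho> (\<sigma> i) = i" "\<And>i. \<sigma> (\<rho> i) = i" "\<And>i. m + q \<le> i \<Longrightarrow> \<sigma> i = i"
  shows "(\<lambda>v. vcat m (v \<circ> \<sigma>) (\<Theta> (vdrop m (v \<circ> \<sigma>)))) \<in> GL (m + q)"
proof -
  let ?\<Psi> = "\<lambda>v. vcat m (v \<circ> \<sigma>) (\<Theta> (vdrop m (v \<circ> \<sigma>)))"
  let ?\<Theta>' = "inv_into (Rn q) \<Theta>"
  let ?\<Phi> = "\<lambda>x. vcat m x (?\<Theta>' (vdrop m x)) \<circ> \<rho>"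
  have \<Theta>b: "bij_betw \<Theta> (Rn q) (Rn q)" using GL_bij[OF \<Theta>] .
  have \<rho>: "\<rho> i = i" if "m + q \<le> i" for i using \<sigma>(1)[of i] \<sigma>(3)[OF that] by simp
  have perm: "v \<circ> \<sigma> \<in> Rn (m + q)" "v \<circ> \<rho> \<in> Rn (m + q)" if "v \<in> Rn (m + q)" for v
    using that \<sigma>(3) \<rho> by (auto simp: Rn_iff)
  have \<Psi>R: "?\<Psi> v \<in> Rn (m + q)" if "v \<in> Rn (m + q)" for v
    using bij_betw_apply[OF \<Theta>b vdrop_in_Rn[OF perm(1)[OF that]]] by (rule vcat_in_Rn)
  have \<Phi>R: "?\<Phi> x \<in> Rn (m + q)" if "x \<in> Rn (m + q)" for x
    by (rule perm(2), rule vcat_in_Rn, rule bij_betw_apply[OF bij_betw_inv_into[OF \<Theta>b] vdrop_in_Rn[OF that]])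
  have cancel: "(v \<circ> \<sigma>) \<circ> \<rho> = v" "(v \<circ> \<rho>) \<circ> \<sigma> = v" for v :: "nat \<Rightarrow> real" by (auto simp: \<sigma> fun_eq_iff)
  have "?\<Phi> (?\<Psi> v) = v" if "v \<in> Rn (m + q)" for v
    using bij_betw_inv_into_left[OF \<Theta>b vdrop_in_Rn[OF perm(1)[OF that]]] by (simp add: vcat_vdrop cancel)
  moreover have "?\<Psi> (?\<Phi> x) = x" if "x \<in> Rn (m + q)" for x
    using bij_betw_inv_into_right[OF \<Theta>b vdrop_in_Rn[OF that]] by (simp add: vcat_vdrop cancel)
  ultimately have "bij_betw ?\<Psi> (Rn (m + q)) (Rn (m + q))"
    by (intro bij_betw_byWitness[where f' = ?\<Phi>]) (use \<Psi>R \<Phi>R in auto)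
  moreover have "?\<Psi> (\<lambda>i. x i + y i) = (\<lambda>i. ?\<Psi> x i + ?\<Psi> y i)" if "x \<in> Rn (m + q)" "y \<in> Rn (m + q)" for x y
  proof -
    have "vdrop m ((\<lambda>i. x i + y i) \<circ> \<sigma>) = (\<lambda>i. vdrop m (x \<circ> \<sigma>) i + vdrop m (y \<circ> \<sigma>) i)"
      by (simp add: vdrop_def)
    moreover have "\<Theta> (\<lambda>i. vdrop m (x \<circ> \<sigma>) i + vdrop m (y \<circ> \<sigma>) i)
        = (\<lambda>i. \<Theta> (vdrop m (x \<circ> \<sigma>)) i + \<Theta> (vdrop m (y \<circ> \<sigma>)) i)"
      using \<Theta> that perm(1) vdrop_in_Rn unfolding GL_def by blast
    ultimately show ?thesis by (auto simp: vcat_def)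
  qed
  moreover have "?\<Psi> (\<lambda>i. r * x i) = (\<lambda>i. r * ?\<Psi> x i)" if "x \<in> Rn (m + q)" for r x
  proof -
    have "vdrop m ((\<lambda>i. r * x i) \<circ> \<sigma>) = (\<lambda>i. r * vdrop m (x \<circ> \<sigma>) i)" by (simp add: vdrop_def)
    moreover have "\<Theta> (\<lambda>i. r * vdrop m (x \<circ> \<sigma>) i) = (\<lambda>i. r * \<Theta> (vdrop m (x \<circ> \<sigma>)) i)"
      using \<Theta> vdrop_in_Rn[OF perm(1)[OF that]] by (rule GL_linear)
    ultimately show ?thesis by (auto simp: vcat_def)
  qed
  ultimately show ?thesis unfolding GL_def by blast
qed

text \<open>Concatenation forgets the entries of x from m on. The inclusion of A in
  \<open>Rn m\<close> makes them 0, so that \<open>vtake\<close> recovers x.\<close>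

lemma vprod_Rn_iff:
  assumes "A \<subseteq> Rn m"
  shows "v \<in> vprod m A B \<longleftrightarrow> vtake m v \<in> A \<and> vdrop m v \<in> B"
proof
  assume "v \<in> vprod m A B"
  then obtain x y where v: "v = vcat m x y" "x \<in> A" "y \<in> B" by (auto simp: vprod_def)
  have "vtake m v = x" using v assms by (auto simp: vtake_def vcat_def fun_eq_iff Rn_iff subset_iff)
  with v show "vtake m v \<in> A \<and> vdrop m v \<in> B" by simp
next
  assume "vtake m v \<in> A \<and> vdrop m v \<in> B"
  moreover have "v = vcat m (vtake m v) (vdrop m v)" by (simp add: vcat_vdrop)
  ultimately show "v \<in> vprod m A B" unfolding vprod_def by blast
qed

section \<open>Explicit domains and the inverse of Phi\<close>

lemma F_set_eq:
  assumes "I \<subseteq> {..<n}"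
  shows "F_set n I = {s \<in> Rn n. \<forall>i<n. if i \<in> I then 0 < s i else 1 \<le> s i}"
proof (intro equalityI subsetI)
  fix s assume "s \<in> F_set n I"
  then obtain x where x: "x \<in> E_set n I" and s: "s = Phi I x" by (auto simp: F_set_def)
  have R: "x \<in> Rn n" using x by (simp add: E_set_def Rpos_def)
  have "s i = 0" if "n \<le> i" for i
  proof -
    have "i \<notin> I" using assms that by auto
    then show ?thesis using RnD[OF R that] by (simp add: s Phi_def)
  qed
  moreover have "if i \<in> I then 0 < s i else 1 \<le> s i" if "i < n" for i
  proof -
    have "if i \<in> I then 0 < x i \<and> x i < 1 else 1 \<le> x i" using x that by (simp add: E_set_def)
    then show ?thesis by (simp add: s Phi_def split: if_splits)
  qed
  ultimately show "s \<in> {s \<in> Rn n. \<forall>i<n. if i \<in> I then 0 < s i else 1 \<le> s i}" by (simp add: Rn_iff)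
next
  fix s assume s: "s \<in> {s \<in> Rn n. \<forall>i<n. if i \<in> I then 0 < s i else 1 \<le> s i}"
  define x where "x i = (if i \<in> I then exp (- s i) else s i)" for i
  have "s = Phi I x" by (auto simp: Phi_def x_def)
  moreover have "x i = 0" if "n \<le> i" for i
  proof -
    have "i \<notin> I" using assms that by auto
    then show ?thesis using s that by (simp add: x_def Rn_iff)
  qed
  then have "x \<in> Rn n" by (simp add: Rn_iff)
  moreover have "if i \<in> I then 0 < x i \<and> x i < 1 else 1 \<le> x i" if "i < n" for i
  proof -
    have "if i \<in> I then 0 < s i else 1 \<le> s i" using s that by blast
    then show ?thesis by (simp add: x_def split: if_splits)
  qed
  ultimately have "s = Phi I x" "x \<in> E_set n I"
    unfolding E_set_def Rpos_def by (force split: if_splits)+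
  then show "s \<in> F_set n I" unfolding F_set_def by blast
qed

lemma tilde_dom_iff:
  assumes "I \<subseteq> {..<n}"
  shows "v \<in> tilde_dom n k I \<longleftrightarrow>
    v \<in> Rn (2*n + k) \<and> (\<forall>i<n. if i \<in> I then 0 < v i else 1 \<le> v i) \<and> (\<forall>i<k. 0 \<le> v (2*n + i))"
proof -
  have "v \<in> tilde_dom n k I \<longleftrightarrow> vtake n v \<in> F_set n I \<and> vtake n (vdrop n v) \<in> Rn n \<and> vdrop n (vdrop n v) \<in> Rnonneg k"
    unfolding tilde_dom_def using F_set_eq[OF assms] by (subst vprod_Rn_iff, force)+ auto
  also have "vdrop n (vdrop n v) = vdrop (2*n) v" by (simp add: vdrop_def mult_2 add.assoc)
  also have "vtake n (vdrop n v) \<in> Rn n \<longleftrightarrow> True" by (simp add: vtake_def Rn_iff)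
  also have "vtake n v \<in> F_set n I \<longleftrightarrow> (\<forall>i<n. if i \<in> I then 0 < v i else 1 \<le> v i)"
    unfolding F_set_eq[OF assms] by (auto simp: vtake_def Rn_iff)
  also have "vdrop (2*n) v \<in> Rnonneg k \<longleftrightarrow> v \<in> Rn (2*n + k) \<and> (\<forall>i<k. 0 \<le> v (2*n + i))"
    unfolding Rnonneg_def mem_Collect_eq vdrop_in_Rn_iff by (simp add: vdrop_def)
  finally show ?thesis by blast
qed

lemma length_dom_iff:
  "v \<in> length_dom n k \<longleftrightarrow> v \<in> Rn (2*n + k) \<and> (\<forall>i<n. 0 < v i) \<and> (\<forall>i<k. 0 \<le> v (2*n + i))"
proof -
  have "v \<in> length_dom n k \<longleftrightarrow> vtake n v \<in> Rpos n \<and> vtake n (vdrop n v) \<in> Rn n \<and> vdrop n (vdrop n v) \<in> Rnonneg k"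
    unfolding length_dom_def by (subst vprod_Rn_iff, force simp: Rpos_def)+ auto
  also have "vdrop n (vdrop n v) = vdrop (2*n) v" by (simp add: vdrop_def mult_2 add.assoc)
  also have "vtake n (vdrop n v) \<in> Rn n \<longleftrightarrow> True" by (simp add: vtake_def Rn_iff)
  also have "vtake n v \<in> Rpos n \<longleftrightarrow> (\<forall>i<n. 0 < v i)"
    by (auto simp: vtake_def Rn_iff Rpos_def)
  also have "vdrop (2*n) v \<in> Rnonneg k \<longleftrightarrow> v \<in> Rn (2*n + k) \<and> (\<forall>i<k. 0 \<le> v (2*n + i))"
    unfolding Rnonneg_def mem_Collect_eq vdrop_in_Rn_iff by (simp add: vdrop_def)
  finally show ?thesis by blast
qed

text \<open>The inverse of \<open>Phi I\<close> on the first factor together with the identity on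
  the others; one formula covers both because I only contains indices below n.\<close>

definition unfold_coords :: "nat set \<Rightarrow> (nat \<Rightarrow> real) \<Rightarrow> nat \<Rightarrow> real" where
  "unfold_coords I v = (\<lambda>i. if i \<in> I then exp (- v i) else v i)"

lemma H_tilde_eq:
  assumes I: "I \<subseteq> {..<n}" and v: "v \<in> tilde_dom n k I"
  shows "H_tilde n I H v = H (unfold_coords I v)" "unfold_coords I v \<in> length_dom n k"
proof -
  define x where "x i = (if i < n then unfold_coords I v i else 0)" for i
  have x: "x \<in> E_set n I"
    using v I by (force simp: tilde_dom_iff[OF I] E_set_def Rpos_def x_def unfold_coords_def Rn_iff split: if_splits)
  have "Phi I x = vtake n v" using I by (auto simp: Phi_def x_def unfold_coords_def vtake_def)
  moreover have "inj_on (Phi I) (E_set n I)"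
  proof (rule inj_onI, rule ext)
    fix y z i assume y: "y \<in> E_set n I" and z: "z \<in> E_set n I" and eq: "Phi I y = Phi I z"
    show "y i = z i"
    proof (cases "i \<in> I")
      case True
      then have "0 < y i" "0 < z i" using y z I by (auto simp: E_set_def Rpos_def)
      then show ?thesis using fun_cong[OF eq, of i] True by (simp add: Phi_def)
    qed (use fun_cong[OF eq, of i] in \<open>simp add: Phi_def\<close>)
  qed
  ultimately have "inv_into (E_set n I) (Phi I) (vtake n v) = x" using x inv_into_f_eq by metis
  moreover have "vcat n x (vdrop n v) = unfold_coords I v"
    using I by (auto simp: vcat_def vdrop_def x_def unfold_coords_def fun_eq_iff)
  ultimately show "H_tilde n I H v = H (unfold_coords I v)" by (simp add: H_tilde_def)
  have "v \<in> Rn (2*n + k)" "\<And>i. i < n \<Longrightarrow> if i \<in> I then 0 < v i else 1 \<le> v i" "\<And>i. i < k \<Longrightarrow> 0 \<le> v (2*n + i)"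
    using v tilde_dom_iff[OF I] by auto
  moreover have "i \<notin> I" if "n \<le> i" for i using I that by auto
  ultimately show "unfold_coords I v \<in> length_dom n k"
    unfolding length_dom_iff by (force simp: unfold_coords_def Rn_iff)
qed

section \<open>Consequences of the length-type formula\<close>

lemma u_fun_ge: "l \<le> u_fun l"
proof -
  have "exp (l / 2) \<le> 2 * cosh (l / 2)" by (simp add: cosh_def)
  then have "ln (exp (l / 2)) \<le> ln (2 * cosh (l / 2))" by (subst ln_le_cancel_iff) (auto simp: cosh_real_pos)
  then show ?thesis by (simp add: u_fun_def)
qed

lemma u_fun_nonneg: "0 \<le> u_fun l"
proof -
  have "1 \<le> 2 * cosh (l / 2)" using cosh_real_ge_1[of "l / 2"] by linarith
  then show ?thesis by (simp add: u_fun_def)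
qed

text \<open>Since h <= u(h) = H, a sublevel set of H lies in the preimage of [0, B] under the proper
  map h, and compactness of that preimage bounds each coordinate.\<close>

lemma pseudo_length_type_bounded:
  assumes "pseudo_length_type n k H"
  shows "\<exists>R. \<forall>x\<in>length_dom n k. H x \<le> B \<longrightarrow> (\<forall>i. \<bar>x i\<bar> \<le> R i)"
proof -
  define h where "h = inv_into {0..} u_fun \<circ> H"
  have H: "H x = u_fun (h x)" if "x \<in> length_dom n k" for x
    using assms that f_inv_into_f unfolding pseudo_length_type_def h_def by (metis comp_apply)
  have lt: "length_type n k h" using assms by (simp add: pseudo_length_type_def h_def)
  let ?X = "subtopology (Euclidean_space (2*n + k)) (length_dom n k)"
  have "compactin (top_of_set {0..}) {0..B}"
    by (simp add: compactin_subtopology)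
  then have "compactin ?X {x \<in> topspace ?X. h x \<in> {0..B}}"
    using lt compactin_proper_map_preimage unfolding length_type_def by blast
  moreover have "topspace ?X = length_dom n k"
    using length_dom_iff[of _ n k] by (auto simp: topspace_subtopology)
  ultimately have "compactin ?X {x \<in> length_dom n k. h x \<in> {0..B}}" (is "compactin _ ?P") by (simp only:)
  then have compact: "compact ?P"
    by (simp add: compactin_subtopology Euclidean_space_def euclidean_product_topology)
  have "\<exists>R. \<forall>x\<in>?P. \<bar>x i\<bar> \<le> R" for i
  proof -
    have "bounded ((\<lambda>x. x i) ` ?P)"
      by (intro compact_imp_bounded compact_continuous_image continuous_intros compact)
    then show ?thesis unfolding bounded_iff real_norm_def by blast
  qed
  then have "\<exists>R. \<forall>i. \<forall>x\<in>?P. \<bar>x i\<bar> \<le> R i" by (intro choice allI)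
  then obtain R where R: "\<And>i x. x \<in> ?P \<Longrightarrow> \<bar>x i\<bar> \<le> R i" by blast
  have "\<bar>x i\<bar> \<le> R i" if "x \<in> length_dom n k" "H x \<le> B" for x i
  proof -
    have "0 \<le> h x" using lt that(1) by (simp add: length_type_def)
    moreover have "h x \<le> B" using u_fun_ge[of "h x"] H[OF that(1)] that(2) by simp
    ultimately show ?thesis using R that(1) by simp
  qed
  then show ?thesis by blast
qed

text \<open>The logarithm of the defining identity. The sum of square roots is positive because cosh
  and the product of sinh powers are; this later shows that some G_i is nonempty.\<close>

lemma pseudo_length_type_formula:
  assumes "pseudo_length_type n k H"
  obtains d p G a where "\<And>j. j < n \<Longrightarrow> 1 \<le> (d j :: nat)"
    "\<And>i. i < p \<Longrightarrow> finite (G i) \<and> G i \<subseteq> Rn (2*n + k) \<and> (\<forall>T\<in>G i. 0 < a i T)"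
    "\<And>x. x \<in> length_dom n k \<Longrightarrow> 0 \<le> H x
       \<and> 0 < (\<Sum>i<p::nat. sqrt (\<Sum>T\<in>G i. a i T * exp (lform (2*n + k) T x)))
       \<and> H x = 2 * ln 2 + (\<Sum>j<n. 2 * real (d j) * - ln (sinh (x j / 2)))
          + 2 * ln (\<Sum>i<p. sqrt (\<Sum>T\<in>G i. a i T * exp (lform (2*n + k) T x)))"
proof -
  define h where "h = inv_into {0..} u_fun \<circ> H"
  have H: "H x = u_fun (h x)" if "x \<in> length_dom n k" for x
    using assms that f_inv_into_f unfolding pseudo_length_type_def h_def by (metis comp_apply)
  have "length_type n k h" using assms by (simp add: pseudo_length_type_def h_def)
  then obtain d p G a where d: "\<forall>j<n. 1 \<le> (d j :: nat)"
    and G: "\<forall>i<p. finite (G i) \<and> G i \<subseteq> Rn (2*n + k) \<and> (\<forall>T\<in>G i. 0 < a i T)"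
    and eq: "\<forall>v\<in>length_dom n k. cosh (h v / 2) = 1 / (\<Prod>j<n. sinh (v j / 2) ^ d j)
                 * (\<Sum>i<p::nat. sqrt (\<Sum>T\<in>G i. a i T * exp (lform (2*n + k) T v)))"
    unfolding length_type_def by blast
  show ?thesis
  proof (rule that[of d p G a])
    fix x assume x: "x \<in> length_dom n k"
    let ?S = "\<Sum>i<p::nat. sqrt (\<Sum>T\<in>G i. a i T * exp (lform (2*n + k) T x))"
    let ?P = "\<Prod>j<n. sinh (x j / 2) ^ d j"
    have sinh: "0 < sinh (x j / 2)" if "j < n" for j using x that by (simp add: length_dom_iff)
    then have P: "0 < ?P" by (intro prod_pos) auto
    have c: "cosh (h x / 2) = 1 / ?P * ?S" using eq x by blast
    then have S: "0 < ?S" using cosh_real_pos[of "h x / 2"] P by (simp add: zero_less_divide_iff)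
    have "1 / ?P * ?S = ?S / ?P" by simp
    then have "ln (cosh (h x / 2)) = ln ?S - ln ?P" unfolding c by (simp only: ln_divide_pos[OF S P])
    also have "ln ?P = (\<Sum>j<n. real (d j) * ln (sinh (x j / 2)))"
    proof -
      have "ln ?P = (\<Sum>j<n. ln (sinh (x j / 2) ^ d j))"
        by (rule ln_prod) (use sinh in fastforce)+
      also have "\<dots> = (\<Sum>j<n. real (d j) * ln (sinh (x j / 2)))"
        by (rule sum.cong) (use sinh in \<open>auto simp: ln_realpow\<close>)
      finally show ?thesis .
    qed
    finally have "ln (cosh (h x / 2)) = ln ?S - (\<Sum>j<n. real (d j) * ln (sinh (x j / 2)))" .
    then have "H x = 2 * ln 2 + (2 * ln ?S - 2 * (\<Sum>j<n. real (d j) * ln (sinh (x j / 2))))"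
      unfolding H[OF x] u_fun_def using ln_mult_pos[of 2 "cosh (h x / 2)"] cosh_real_pos[of "h x / 2"]
      by linarith
    moreover have "(\<Sum>j<n. 2 * real (d j) * - ln (sinh (x j / 2))) = - 2 * (\<Sum>j<n. real (d j) * ln (sinh (x j / 2)))"
      unfolding sum_distrib_left by (rule sum.cong) auto
    ultimately have "H x = 2 * ln 2 + (\<Sum>j<n. 2 * real (d j) * - ln (sinh (x j / 2))) + 2 * ln ?S" by linarith
    then show "0 \<le> H x \<and> 0 < ?S \<and> H x = 2 * ln 2 + (\<Sum>j<n. 2 * real (d j) * - ln (sinh (x j / 2))) + 2 * ln ?S"
      using S u_fun_nonneg[of "h x"] H[OF x] by linarith
  qed (use d G in auto)
qed

section \<open>The decomposition\<close>

text \<open>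
  The permutation \<open>\<sigma>\<close> lists the indices in I first; \<open>W v\<close> below consists of the remaining
  coordinates of v, the first n - card I of them being the ones that are \<open>\<ge> 1\<close>.
\<close>

locale sorted_pseudo_length =
  fixes n k :: nat and I :: "nat set" and H :: "(nat \<Rightarrow> real) \<Rightarrow> real"
    and \<sigma> \<rho> d :: "nat \<Rightarrow> nat" and r :: nat and G :: "nat \<Rightarrow> (nat \<Rightarrow> real) set"
    and a :: "nat \<Rightarrow> (nat \<Rightarrow> real) \<Rightarrow> real"
  assumes I: "I \<subseteq> {..<n}" and H: "pseudo_length_type n k H"
    and \<rho>\<sigma>: "\<And>i. \<rho> (\<sigma> i) = i" and \<sigma>\<rho>: "\<And>i. \<sigma> (\<rho> i) = i" and \<sigma>_fix: "\<And>i. n \<le> i \<Longrightarrow> \<sigma> i = i"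
    and \<sigma>_less: "\<And>i. i < n \<Longrightarrow> \<sigma> i < n" and \<sigma>_I: "\<And>i. \<sigma> i \<in> I \<longleftrightarrow> i < card I"
    and d_ge1: "\<And>j. j < n \<Longrightarrow> 1 \<le> d j"
    and G: "\<And>i. i < r \<Longrightarrow> finite (G i) \<and> G i \<subseteq> Rn (2*n + k) \<and> (\<forall>T\<in>G i. 0 < a i T)"
    and formula: "\<And>x. x \<in> length_dom n k \<Longrightarrow> 0 \<le> H x
       \<and> 0 < (\<Sum>i<r. sqrt (\<Sum>T\<in>G i. a i T * exp (lform (2*n + k) T x)))
       \<and> H x = 2 * ln 2 + (\<Sum>j<n. 2 * real (d j) * - ln (sinh (x j / 2)))
          + 2 * ln (\<Sum>i<r. sqrt (\<Sum>T\<in>G i. a i T * exp (lform (2*n + k) T x)))"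
begin

definition m :: nat where "m = card I"
definition q :: nat where "q = 2*n + k - card I"

lemma m_le: "m \<le> n"
  using card_mono[OF _ I] by (simp add: m_def)

lemma mq: "m + q = 2*n + k"
  using m_le by (simp add: m_def q_def)

lemma \<sigma>_less_n_iff: "\<sigma> i < n \<longleftrightarrow> i < n"
  using \<sigma>_less \<sigma>_fix by (metis linorder_not_less)

lemma \<sigma>_less_iff: "\<sigma> i < m + q \<longleftrightarrow> i < m + q"
proof (cases "i < n")
  case True
  then show ?thesis using \<sigma>_less[OF True] mq by linarith
qed (simp add: \<sigma>_fix)

lemma \<sigma>_ge: "m + q \<le> i \<Longrightarrow> \<sigma> i = i"
  using mq by (intro \<sigma>_fix) linarith

lemma \<sigma>_bij: "bij_betw \<sigma> {..<m + q} {..<m + q}" "bij_betw \<sigma> {..<n} {..<n}"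
  by (rule bij_betw_byWitness[where f' = \<rho>],
      auto simp: \<rho>\<sigma> \<sigma>\<rho> \<sigma>_less_iff \<sigma>_less_n_iff,
      metis \<sigma>\<rho> \<sigma>_less_iff,
      rule bij_betw_byWitness[where f' = \<rho>],
      auto simp: \<rho>\<sigma> \<sigma>\<rho> \<sigma>_less_iff \<sigma>_less_n_iff,
      metis \<sigma>\<rho> \<sigma>_less_n_iff)

definition W :: "(nat \<Rightarrow> real) \<Rightarrow> nat \<Rightarrow> real" where
  "W v = vdrop m (v \<circ> \<sigma>)"

lemma W_apply: "W v j = v (\<sigma> (m + j))"
  by (simp add: W_def vdrop_def)

lemma perm_Rn: "v \<in> Rn (m + q) \<Longrightarrow> v \<circ> \<sigma> \<in> Rn (m + q)"
  by (simp add: Rn_iff \<sigma>_ge)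

lemma perm_Rn': "v \<in> Rn (m + q) \<Longrightarrow> v \<circ> \<rho> \<in> Rn (m + q)"
proof -
  have "\<rho> i = i" if "m + q \<le> i" for i using \<rho>\<sigma>[of i] \<sigma>_ge[OF that] by simp
  then show "v \<in> Rn (m + q) \<Longrightarrow> v \<circ> \<rho> \<in> Rn (m + q)" by (simp add: Rn_iff)
qed

lemma comp_cancel: "(v \<circ> \<rho>) \<circ> \<sigma> = v" "(v \<circ> \<sigma>) \<circ> \<rho> = v"
  by (auto simp: fun_eq_iff \<rho>\<sigma> \<sigma>\<rho>)

lemma W_Rn: "v \<in> Rn (m + q) \<Longrightarrow> W v \<in> Rn q"
  unfolding W_def by (intro vdrop_in_Rn perm_Rn)

lemma lform_perm: "lform (m + q) T v = (\<Sum>i<m. T (\<sigma> i) * v (\<sigma> i)) + lform q (W T) (W v)"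
proof -
  have "lform (m + q) T v = lform (m + q) (T \<circ> \<sigma>) (v \<circ> \<sigma>)"
    unfolding lform_def using sum.reindex_bij_betw[OF \<sigma>_bij(1), of "\<lambda>i. T i * v i"] by simp
  also have "T \<circ> \<sigma> = vcat m (T \<circ> \<sigma>) (W T)" by (simp add: W_def vcat_vdrop)
  also have "lform (m + q) (vcat m (T \<circ> \<sigma>) (W T)) (v \<circ> \<sigma>) = (\<Sum>i<m. T (\<sigma> i) * v (\<sigma> i)) + lform q (W T) (W v)"
    unfolding lform_vcat_form by (simp add: W_def)
  finally show ?thesis .
qed

text \<open>What remains of the domain once the coordinates in I are split off, in sorted order: n -
  m lengths, n unconstrained twists at the indices from n - m to 2 n - m - 1, and k nonnegative
  parameters.\<close>

definition Q :: "(nat \<Rightarrow> real) set" where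
  "Q = {w \<in> Rn q. (\<forall>j<n - m. 1 \<le> w j) \<and> (\<forall>j\<in>{2*n - m..<q}. 0 \<le> w j)}"

lemma tilde_dom_sorted:
  "v \<in> tilde_dom n k I \<longleftrightarrow> v \<in> Rn (m + q) \<and> (\<forall>i<m. 0 < v (\<sigma> i)) \<and> W v \<in> Q"
proof
  assume v: "v \<in> tilde_dom n k I"
  have R: "v \<in> Rn (m + q)" and c: "\<And>i. i < n \<Longrightarrow> if i \<in> I then 0 < v i else 1 \<le> v i"
    and y: "\<And>i. i < k \<Longrightarrow> 0 \<le> v (2*n + i)"
    using v unfolding tilde_dom_iff[OF I] mq by auto
  have "0 < v (\<sigma> i)" if "i < m" for i
    using c[OF \<sigma>_less, of i] that m_le \<sigma>_I[of i] by (simp add: m_def)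
  moreover have "1 \<le> W v j" if "j < n - m" for j
    using c[OF \<sigma>_less, of "m + j"] that \<sigma>_I[of "m + j"] by (simp add: m_def W_apply)
  moreover have "0 \<le> W v j" if "j \<in> {2*n - m..<q}" for j
  proof -
    have "\<sigma> (m + j) = m + j" using that m_le by (intro \<sigma>_fix) auto
    moreover have "m + j = 2*n + (m + j - 2*n)" "m + j - 2*n < k" using that mq m_le by auto
    ultimately show ?thesis using y[of "m + j - 2*n"] by (simp add: W_apply)
  qed
  ultimately show "v \<in> Rn (m + q) \<and> (\<forall>i<m. 0 < v (\<sigma> i)) \<and> W v \<in> Q"
    using R W_Rn unfolding Q_def by blast
next
  assume v: "v \<in> Rn (m + q) \<and> (\<forall>i<m. 0 < v (\<sigma> i)) \<and> W v \<in> Q"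
  have "if i \<in> I then 0 < v i else 1 \<le> v i" if "i < n" for i
  proof (cases "\<rho> i < m")
    case True
    then show ?thesis using v \<sigma>_I[of "\<rho> i"] by (auto simp: \<sigma>\<rho> m_def)
  next
    case False
    have "\<rho> i < n" using \<sigma>_less_n_iff[of "\<rho> i"] that by (simp add: \<sigma>\<rho>)
    then have "1 \<le> W v (\<rho> i - m)" using v False unfolding Q_def by auto
    then show ?thesis using False \<sigma>_I[of "\<rho> i"] by (simp add: W_apply \<sigma>\<rho> m_def)
  qed
  moreover have "0 \<le> v (2*n + i)" if "i < k" for i
  proof -
    have "2*n + i - m \<in> {2*n - m..<q}" using that mq m_le by auto
    then have "0 \<le> W v (2*n + i - m)" using v unfolding Q_def by blast
    moreover have "\<sigma> (m + (2*n + i - m)) = 2*n + i" using m_le by (subst \<sigma>_fix) auto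
    ultimately show ?thesis by (simp add: W_apply)
  qed
  ultimately show "v \<in> tilde_dom n k I" using v unfolding tilde_dom_iff[OF I] mq by blast
qed

text \<open>An empty G_i contributes sqrt 0 = 0 and is dropped, so that every remaining radicand is
  positive and its square root analytic.\<close>

definition A :: "nat set" where
  "A = {i. i < r \<and> G i \<noteq> {}}"

text \<open>The logarithmic formula for H after the substitution x_i = exp (- s_i) for i in I,
  reindexed by \<sigma>; each log sinh is split into its linear part and its correction.\<close>

lemma H_tilde_sorted:
  assumes v: "v \<in> tilde_dom n k I"
  shows "H_tilde n I H v = 2 * ln 2 + (\<Sum>j<m. 2 * real (d (\<sigma> j)) * (pinch_corr (v (\<sigma> j)) + v (\<sigma> j)))
      + (\<Sum>j<n - m. 2 * real (d (\<sigma> (m + j))) * (end_corr (W v j) - W v j / 2))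
      + 2 * ln (\<Sum>i\<in>A. sqrt (\<Sum>T\<in>G i. a i T * exp ((\<Sum>j<m. T (\<sigma> j) * exp (- v (\<sigma> j))) + lform q (W T) (W v))))"
    and "0 \<le> H_tilde n I H v" and "A \<noteq> {}"
proof -
  define x where "x = unfold_coords I v"
  have Hx: "H_tilde n I H v = H x" and xd: "x \<in> length_dom n k"
    using H_tilde_eq[OF I v] by (auto simp: x_def)
  let ?S = "\<Sum>i<r. sqrt (\<Sum>T\<in>G i. a i T * exp (lform (2*n + k) T x))"
  have x1: "x (\<sigma> j) = exp (- v (\<sigma> j))" if "j < m" for j
    using \<sigma>_I[of j] that by (simp add: x_def unfold_coords_def m_def)
  have Wx: "W x = W v"
  proof
    fix j show "W x j = W v j"
      using \<sigma>_I[of "m + j"] by (simp add: x_def unfold_coords_def W_apply m_def)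
  qed
  have "lform (2*n + k) T x = (\<Sum>j<m. T (\<sigma> j) * exp (- v (\<sigma> j))) + lform q (W T) (W v)" for T
    unfolding mq[symmetric] lform_perm Wx using x1 by simp
  moreover have "?S = (\<Sum>i\<in>A. sqrt (\<Sum>T\<in>G i. a i T * exp (lform (2*n + k) T x)))"
    by (rule sum.mono_neutral_right) (auto simp: A_def)
  ultimately have S: "?S = (\<Sum>i\<in>A. sqrt (\<Sum>T\<in>G i. a i T * exp ((\<Sum>j<m. T (\<sigma> j) * exp (- v (\<sigma> j))) + lform q (W T) (W v))))"
    by simp
  have "(\<Sum>j<n. 2 * real (d j) * - ln (sinh (x j / 2))) = (\<Sum>j<n. 2 * real (d (\<sigma> j)) * - ln (sinh (x (\<sigma> j) / 2)))"
    using sum.reindex_bij_betw[OF \<sigma>_bij(2), of "\<lambda>j. 2 * real (d j) * - ln (sinh (x j / 2))"] by simp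
  also have "\<dots> = (\<Sum>j<m. 2 * real (d (\<sigma> j)) * - ln (sinh (x (\<sigma> j) / 2)))
      + (\<Sum>j<n - m. 2 * real (d (\<sigma> (m + j))) * - ln (sinh (x (\<sigma> (m + j)) / 2)))"
    using sum.atLeastLessThan_concat[of 0 m n "\<lambda>j. 2 * real (d (\<sigma> j)) * - ln (sinh (x (\<sigma> j) / 2))"]
      sum.shift_bounds_nat_ivl[of "\<lambda>j. 2 * real (d (\<sigma> j)) * - ln (sinh (x (\<sigma> j) / 2))" 0 m "n - m"] m_le
    by (simp add: lessThan_atLeast0 add.commute)
  also have "(\<Sum>j<m. 2 * real (d (\<sigma> j)) * - ln (sinh (x (\<sigma> j) / 2)))
      = (\<Sum>j<m. 2 * real (d (\<sigma> j)) * (pinch_corr (v (\<sigma> j)) + v (\<sigma> j)))"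
    by (rule sum.cong) (auto simp: x1 pinch_corr_def)
  also have "(\<Sum>j<n - m. 2 * real (d (\<sigma> (m + j))) * - ln (sinh (x (\<sigma> (m + j)) / 2)))
      = (\<Sum>j<n - m. 2 * real (d (\<sigma> (m + j))) * (end_corr (W v j) - W v j / 2))"
  proof (rule sum.cong)
    fix j assume "j \<in> {..<n - m}"
    then have "1 \<le> W v j" using v unfolding tilde_dom_sorted Q_def by auto
    then have "- ln (sinh (W v j / 2)) = end_corr (W v j) - W v j / 2" by (intro end_corr_sinh) simp
    moreover have "x (\<sigma> (m + j)) = W v j" using fun_cong[OF Wx, of j] by (simp add: W_apply)
    ultimately show "2 * real (d (\<sigma> (m + j))) * - ln (sinh (x (\<sigma> (m + j)) / 2))
      = 2 * real (d (\<sigma> (m + j))) * (end_corr (W v j) - W v j / 2)" by simp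
  qed simp
  finally have 1: "(\<Sum>j<n. 2 * real (d j) * - ln (sinh (x j / 2)))
     = (\<Sum>j<m. 2 * real (d (\<sigma> j)) * (pinch_corr (v (\<sigma> j)) + v (\<sigma> j)))
      + (\<Sum>j<n - m. 2 * real (d (\<sigma> (m + j))) * (end_corr (W v j) - W v j / 2))" .
  have f: "0 \<le> H x" "0 < ?S" "H x = 2 * ln 2 + (\<Sum>j<n. 2 * real (d j) * - ln (sinh (x j / 2))) + 2 * ln ?S"
    using formula[OF xd] by blast+
  show "0 \<le> H_tilde n I H v" using f(1) Hx by simp
  show "A \<noteq> {}" using f(2) unfolding S by auto
  show "H_tilde n I H v = 2 * ln 2 + (\<Sum>j<m. 2 * real (d (\<sigma> j)) * (pinch_corr (v (\<sigma> j)) + v (\<sigma> j)))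
      + (\<Sum>j<n - m. 2 * real (d (\<sigma> (m + j))) * (end_corr (W v j) - W v j / 2))
      + 2 * ln (\<Sum>i\<in>A. sqrt (\<Sum>T\<in>G i. a i T * exp ((\<Sum>j<m. T (\<sigma> j) * exp (- v (\<sigma> j))) + lform q (W T) (W v))))"
    unfolding Hx f(3) unfolding 1 S by (simp only: add.assoc)
qed

definition exps :: "(nat \<Rightarrow> real) set" where
  "exps = (\<Union>i\<in>A. G i)"

definition half_gap :: "(nat \<Rightarrow> real) \<Rightarrow> (nat \<Rightarrow> real) \<Rightarrow> nat \<Rightarrow> real" where
  "half_gap S T = (\<lambda>p. (W S p - W T p) / 2)"

text \<open>The zero form makes signs part of the order pattern. With both signs of every unit
  vector, the forms that are nonnegative at a given point span. Half gaps are taken for all ordered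
  pairs, since which exponent dominates depends on the cell.\<close>

definition forms :: "(nat \<Rightarrow> real) set" where
  "forms = insert (\<lambda>_. 0) (unit_vec ` {..<q} \<union> (\<lambda>j i. - unit_vec j i) ` {..<q}
     \<union> (\<lambda>(S, T). half_gap S T) ` (exps \<times> exps))"

lemma finite_exps: "finite exps"
  using G by (auto simp: exps_def A_def)

lemma W_exps: "T \<in> exps \<Longrightarrow> W T \<in> Rn q"
  using G W_Rn unfolding mq exps_def A_def by blast

lemma finite_forms: "finite forms"
  using finite_exps by (simp add: forms_def)

lemma half_gap_Rn: "S \<in> exps \<Longrightarrow> T \<in> exps \<Longrightarrow> half_gap S T \<in> Rn q"
  using W_exps by (simp add: half_gap_def Rn_iff)

lemma forms_Rn: "forms \<subseteq> Rn q"
proof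
  fix f assume "f \<in> forms"
  then consider "f = (\<lambda>_. 0)" | j where "j < q" "f = unit_vec j" | j where "j < q" "f = (\<lambda>i. - unit_vec j i)"
    | S T where "S \<in> exps" "T \<in> exps" "f = half_gap S T"
    unfolding forms_def by auto
  then show "f \<in> Rn q"
  proof cases
    case (2 j)
    then show ?thesis using unit_vec_in_Rn by simp
  next
    case (3 j)
    then show ?thesis using unit_vec_in_Rn[of j q] by (simp add: Rn_iff)
  next
    case (4 S T)
    then show ?thesis using half_gap_Rn by simp
  qed (simp add: Rn_iff)
qed

lemma forms_mem:
  "(\<lambda>_. 0) \<in> forms" "j < q \<Longrightarrow> unit_vec j \<in> forms" "j < q \<Longrightarrow> (\<lambda>i. - unit_vec j i) \<in> forms"
  "S \<in> exps \<Longrightarrow> T \<in> exps \<Longrightarrow> half_gap S T \<in> forms"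
  unfolding forms_def by auto

abbreviation pattern where "pattern \<equiv> order_pattern q forms"

text \<open>A form on the last q sorted coordinates pulls back by padding with m zeros and undoing
  the permutation, so the pattern of \<open>W v\<close> is decided by linear inequalities in
  v.\<close>

lemma cell_cone:
  "\<exists>K. linear_cone (2*n + k) K \<and> {v \<in> tilde_dom n k I. pattern (W v) = pattern w} = tilde_dom n k I \<inter> K"
proof (intro exI conjI)
  let ?L = "\<lambda>f. vcat m (\<lambda>_. 0) f \<circ> \<rho>"
  have "lform (m + q) (?L f) v = lform q f (W v)" for f v
    unfolding lform_perm W_def comp_cancel by (simp add: \<rho>\<sigma>)
  then have "linear_cone (m + q) {v \<in> Rn (m + q). pattern (W v) = pattern w}"
    by (intro linear_cone_order_pattern[where L = ?L] finite_forms forms_Rn perm_Rn' vcat_in_Rn)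
  then show "linear_cone (2*n + k) {v \<in> Rn (m + q). pattern (W v) = pattern w}" by (simp add: mq)
  show "{v \<in> tilde_dom n k I. pattern (W v) = pattern w} = tilde_dom n k I \<inter> {v \<in> Rn (m + q). pattern (W v) = pattern w}"
    using tilde_dom_sorted by blast
qed

end

section \<open>The normal form of a single cell\<close>

context sorted_pseudo_length
begin

lemma Q_scale:
  assumes "w \<in> Q" "1 \<le> t"
  shows "(\<lambda>i. t * w i) \<in> Q"
proof -
  have "1 \<le> t * w j" if "1 \<le> w j" for j
    using mult_mono[of 1 t 1 "w j"] that assms(2) by simp
  then show ?thesis using assms by (simp add: Q_def Rn_iff)
qed

text \<open>All choices (the nonnegative forms, the basis, the dominant exponent) are made at the
  one point \<open>v\<^sub>0\<close>. They remain valid on the whole cell because the order pattern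
  is constant there.\<close>

lemma cell_simplified:
  assumes v\<^sub>0: "v\<^sub>0 \<in> tilde_dom n k I"
  shows "\<exists>\<Psi>\<in>GL (m + q). \<exists>C. admissible_polytope q C
     \<and> \<Psi> ` {v \<in> tilde_dom n k I. pattern (W v) = pattern (W v\<^sub>0)} = vprod m (Rpos m) C
     \<and> simplified_length_type m q C (H_tilde n I H \<circ> inv_into (Rn (m + q)) \<Psi>)"
proof -
  define w\<^sub>0 where "w\<^sub>0 = W v\<^sub>0"
  define key where "key f = lform q f w\<^sub>0" for f
  define pos where "pos = {f \<in> forms. 0 \<le> key f}"
  have w\<^sub>0Q: "w\<^sub>0 \<in> Q" using v\<^sub>0 tilde_dom_sorted by (simp add: w\<^sub>0_def)
  have pos: "finite pos" "pos \<subseteq> Rn q" "pos \<subseteq> forms"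
    using finite_forms forms_Rn by (auto simp: pos_def)
  have unit_pos: "unit_vec j \<in> pos" if "j < q" "0 \<le> w\<^sub>0 j" for j
    using that forms_mem(2) by (simp add: pos_def key_def lform_unit_vec)
  have "unit_vec j \<in> pos \<or> (\<lambda>i. - unit_vec j i) \<in> pos" if j: "j < q" for j
  proof (cases "0 \<le> w\<^sub>0 j")
    case False
    have "lform q (\<lambda>i. - unit_vec j i) w\<^sub>0 = - w\<^sub>0 j"
      using lform_scale_form[of q "-1" "unit_vec j" w\<^sub>0] lform_unit_vec[OF j] by simp
    then show ?thesis using False forms_mem(3)[OF j] by (simp add: pos_def key_def)
  qed (use unit_pos j in simp)
  then obtain b c where b: "\<And>p. p < q \<Longrightarrow> b p \<in> pos"
    and b_mono: "\<And>p r. p \<le> r \<Longrightarrow> r < q \<Longrightarrow> key (b p) \<le> key (b r)"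
    and span: "\<And>f. f \<in> Rn q \<Longrightarrow> f = (\<lambda>i. \<Sum>p<q. c f p * b p i)"
    and below: "\<And>f p. f \<in> pos \<Longrightarrow> p < q \<Longrightarrow> c f p \<noteq> 0 \<Longrightarrow> key (b p) \<le> key f"
    and indep: "\<And>a. (\<lambda>i. \<Sum>p<q. a p * b p i) = (\<lambda>_. 0) \<Longrightarrow> \<forall>p<q. a p = 0"
    using ordered_basis[OF pos(1,2), of key] by blast
  define \<Theta> where "\<Theta> = frame_map q b"
  have \<Theta>: "\<Theta> \<in> GL q"
    unfolding \<Theta>_def using span indep b pos(2) by (intro frame_map_GL) auto
  \<comment> \<open>Coefficients of a form in the new coordinates, set to 0 from q on so as to lie
    in \<open>Rn q\<close>.\<close>
  define coef where "coef f = (\<lambda>p. if p < q then c f p else 0)" for f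
  have coef_Rn: "coef f \<in> Rn q" for f by (simp add: coef_def Rn_iff)
  have lform_coef: "lform q (coef f) (\<Theta> w) = lform q f w" if "f \<in> Rn q" for f w
    using lform_frame_map[OF span[OF that], of w] by (simp add: \<Theta>_def lform_def coef_def)
  \<comment> \<open>Each form has its own expansion; that the coefficients depend linearly on the
    form is read off from independence of the frame.\<close>
  have coef_half_gap: "c (half_gap S T) p = (coef (W S) p - coef (W T) p) / 2"
    if "S \<in> exps" "T \<in> exps" "p < q" for S T p
  proof -
    have "(\<lambda>i. \<Sum>p<q. (c (half_gap S T) p - (coef (W S) p - coef (W T) p) / 2) * b p i) = (\<lambda>_. 0)"
    proof
      fix i
      have "(\<Sum>p<q. c (half_gap S T) p * b p i) = half_gap S T i"
        using span[OF half_gap_Rn[OF that(1,2)], THEN fun_cong, of i] by simp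
      moreover have "(\<Sum>p<q. coef (W U) p * b p i) = W U i" if "U \<in> exps" for U
        using span[OF W_exps[OF that], THEN fun_cong, of i] by (simp add: coef_def)
      moreover have "(\<Sum>p<q. (c (half_gap S T) p - (coef (W S) p - coef (W T) p) / 2) * b p i)
         = (\<Sum>p<q. c (half_gap S T) p * b p i)
           - ((\<Sum>p<q. coef (W S) p * b p i) - (\<Sum>p<q. coef (W T) p * b p i)) / 2"
        by (simp add: left_diff_distrib sum_subtractf diff_divide_distrib sum_divide_distrib)
      ultimately show "(\<Sum>p<q. (c (half_gap S T) p - (coef (W S) p - coef (W T) p) / 2) * b p i) = 0"
        using that(1,2) by (simp add: half_gap_def)
    qed
    from indep[OF this] show ?thesis using that(3) by auto
  qed
  define K where "K = {w \<in> Q. pattern w = pattern w\<^sub>0}"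
  define C where "C = \<Theta> ` K"
  have K_Rn: "K \<subseteq> Rn q" by (auto simp: K_def Q_def)
  have K_le: "lform q f w \<le> lform q g w" if "w \<in> K" "f \<in> forms" "g \<in> forms" "key f \<le> key g" for f g w
  proof (rule order_pattern_leD)
    show "pattern w\<^sub>0 = pattern w" using that(1) by (simp add: K_def)
    show "lform q f w\<^sub>0 \<le> lform q g w\<^sub>0" using that(4) by (simp add: key_def)
  qed fact+
  have K_nonneg: "0 \<le> lform q f w" if "w \<in> K" "f \<in> pos" for f w
    using K_le[OF that(1) forms_mem(1), of f] that(2) by (simp add: pos_def key_def lform_def)
  have K_above: "lform q (b p) w \<le> lform q f w" if "w \<in> K" "f \<in> pos" "p < q" "c f p \<noteq> 0" for w f p
    using K_le[OF that(1)] b[OF that(3)] below[OF that(2-4)] that(2) pos(3) by blast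
  have \<Theta>_apply: "\<Theta> w p = lform q (b p) w" if "p < q" for w p using that by (simp add: \<Theta>_def frame_map_def)
  have \<Theta>_Rn: "\<Theta> w \<in> Rn q" for w by (simp add: \<Theta>_def frame_map_def Rn_iff)
  have C_chamber: "C \<subseteq> {x \<in> Rn q. (\<forall>i<q. 0 \<le> x i) \<and> (\<forall>j<q. \<forall>i\<le>j. x i \<le> x j)}"
  proof
    fix x assume "x \<in> C"
    then obtain w where w: "w \<in> K" "x = \<Theta> w" by (auto simp: C_def)
    have "0 \<le> x i" if "i < q" for i using K_nonneg[OF w(1) b[OF that]] that by (simp add: w(2) \<Theta>_apply)
    moreover have "x i \<le> x j" if "j < q" "i \<le> j" for i j
    proof -
      have i: "i < q" using that by simp
      have "b i \<in> forms" "b j \<in> forms" using b[OF i] b[OF that(1)] pos(3) by auto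
      from K_le[OF w(1) this b_mono[OF that(2,1)]] show ?thesis using i that(1) by (simp add: w(2) \<Theta>_apply)
    qed
    ultimately show "x \<in> {x \<in> Rn q. (\<forall>i<q. 0 \<le> x i) \<and> (\<forall>j<q. \<forall>i\<le>j. x i \<le> x j)}"
      using \<Theta>_Rn w(2) by blast
  qed
  have admissible: "admissible_polytope q C"
    unfolding admissible_polytope_def
  proof (intro conjI C_chamber exI)
    \<comment> \<open>The inhomogeneous conditions w_j >= 1 concern exactly the first n - m
      coordinates, whence m' = n - m; everything else is homogeneous and goes into the cone.\<close>
    let ?U = "{w \<in> Rn q. pattern w = pattern w\<^sub>0} \<inter> {w \<in> Rn q. \<forall>j\<in>{2*n - m..<q}. 0 \<le> w j}"
    show "linear_cone q ?U"
      using linear_cone_order_pattern[OF finite_forms forms_Rn, of "\<lambda>f. f" q "\<lambda>w. w" w\<^sub>0]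
      by (intro linear_cone_Int linear_cone_nonneg) auto
    show "n - m \<le> q" using mq m_le by linarith
    show "\<Theta> \<in> GL q" by fact
    show "C = \<Theta> ` (?U \<inter> {x \<in> Rn q. \<forall>i<n - m. 1 \<le> x i})"
      unfolding C_def K_def Q_def by (rule arg_cong[where f = "(`) \<Theta>"]) blast
  qed
  define \<Psi> where "\<Psi> v = vcat m (v \<circ> \<sigma>) (\<Theta> (W v))" for v
  have \<Psi>: "\<Psi> \<in> GL (m + q)"
    using GL_permute_vcat[OF \<Theta>, of \<rho> \<sigma> m] \<rho>\<sigma> \<sigma>\<rho> \<sigma>_ge unfolding W_def[symmetric] \<Psi>_def[symmetric] by blast
  let ?U = "{v \<in> tilde_dom n k I. pattern (W v) = pattern w\<^sub>0}"
  \<comment> \<open>\<open>lift s w\<close> is the point whose sorted coordinates are (s, w); it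
    makes preimages under \<Psi> explicit.\<close>
  define lift where "lift s w = vcat m s w \<circ> \<rho>" for s w
  have W_lift: "W (lift s w) = w" for s w by (simp add: W_def lift_def comp_cancel)
  have lift_apply: "lift s w (\<sigma> i) = s i" if "i < m" for s w i using that by (simp add: lift_def \<rho>\<sigma>)
  have lift_Rn: "lift s w \<in> Rn (m + q)" if "w \<in> Rn q" for s w
    unfolding lift_def by (intro perm_Rn' vcat_in_Rn that)
  have lift_dom: "lift s w \<in> tilde_dom n k I" if "s \<in> Rpos m" "w \<in> Q" for s w
    using that lift_Rn unfolding tilde_dom_sorted W_lift
    by (auto simp: lift_apply Rpos_def Q_def)
  have \<Psi>_lift: "\<Psi> (lift s w) = vcat m s (\<Theta> w)" for s w
    unfolding \<Psi>_def W_lift by (simp add: lift_def comp_cancel)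
  have image: "\<Psi> ` ?U = vprod m (Rpos m) C"
  proof (intro equalityI subsetI)
    fix z assume "z \<in> \<Psi> ` ?U"
    then obtain v where v: "v \<in> ?U" "z = \<Psi> v" by blast
    have "vtake m (v \<circ> \<sigma>) \<in> Rpos m" using v(1) tilde_dom_sorted by (auto simp: vtake_def Rpos_def Rn_iff)
    moreover have "W v \<in> K" using v(1) tilde_dom_sorted by (simp add: K_def)
    moreover have "z = vcat m (vtake m (v \<circ> \<sigma>)) (\<Theta> (W v))" by (simp add: v(2) \<Psi>_def)
    ultimately show "z \<in> vprod m (Rpos m) C" unfolding vprod_def C_def by blast
  next
    fix z assume "z \<in> vprod m (Rpos m) C"
    then obtain s w where z: "z = vcat m s (\<Theta> w)" "s \<in> Rpos m" "w \<in> K" by (auto simp: vprod_def C_def)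
    then have "lift s w \<in> ?U" using lift_dom by (simp add: K_def W_lift)
    then show "z \<in> \<Psi> ` ?U" using \<Psi>_lift z(1) by (metis (no_types, lifting) image_eqI)
  qed
  have A_ne: "A \<noteq> {}" using H_tilde_sorted(3)[OF v\<^sub>0] .
  then have "exps \<noteq> {}" by (auto simp: exps_def A_def)
  \<comment> \<open>An exponent that is largest at the base point. Its half gaps are nonnegative
    there, so they belong to \<open>pos\<close> and stay nonnegative on the whole cell.\<close>
  then have "Max ((\<lambda>T. key (W T)) ` exps) \<in> (\<lambda>T. key (W T)) ` exps"
    using finite_exps by (intro Max_in) auto
  then obtain \<tau> where \<tau>0: "\<tau> \<in> exps" "Max ((\<lambda>T. key (W T)) ` exps) = key (W \<tau>)" by blast
  have "key (W T) \<le> key (W \<tau>)" if "T \<in> exps" for T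
    unfolding \<tau>0(2)[symmetric] using that finite_exps by (intro Max_ge) auto
  note \<tau> = \<tau>0(1) this
  obtain i\<^sub>0 where i\<^sub>0: "i\<^sub>0 \<in> A" "\<tau> \<in> G i\<^sub>0" using \<tau>(1) by (auto simp: exps_def)
  have in_exps: "T \<in> exps" if "i \<in> A" "T \<in> G i" for i T using that by (auto simp: exps_def)
  have gap_pos: "half_gap \<tau> T \<in> pos" if "T \<in> exps" for T
  proof -
    have "key (half_gap \<tau> T) = (key (W \<tau>) - key (W T)) / 2"
      unfolding key_def half_gap_def
      using lform_scale_form[of q "1/2" "\<lambda>p. W \<tau> p - W T p" w\<^sub>0] by (simp add: lform_diff_form)
    then show ?thesis using \<tau>(2)[OF that] forms_mem(4)[OF \<tau>(1) that] by (simp add: pos_def)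
  qed
  have lform_gap: "lform q (\<lambda>p. (coef (W \<tau>) p - coef (W T) p) / 2) (\<Theta> w) = lform q (half_gap \<tau> T) w"
    if "T \<in> exps" for T w
  proof -
    have "lform q (\<lambda>p. (coef (W \<tau>) p - coef (W T) p) / 2) (\<Theta> w) = lform q (coef (half_gap \<tau> T)) (\<Theta> w)"
      unfolding lform_def using coef_half_gap[OF \<tau>(1) that] by (intro sum.cong) (auto simp: coef_def)
    then show ?thesis using lform_coef[OF half_gap_Rn[OF \<tau>(1) that]] by simp
  qed
  have unit_end: "j < q" "unit_vec j \<in> pos" if "j < n - m" for j
  proof -
    show "j < q" using that mq m_le by linarith
    moreover have "1 \<le> w\<^sub>0 j" using w\<^sub>0Q that by (simp add: Q_def)
    ultimately show "unit_vec j \<in> pos" by (intro unit_pos) auto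
  qed
  interpret nf: cell_normal_form m q "n - m" C "\<lambda>j. d (\<sigma> j)" "\<lambda>j. d (\<sigma> (m + j))" "\<lambda>j. coef (unit_vec j)"
    A G a "\<lambda>T j. T (\<sigma> j)" "\<lambda>T. coef (W T)" i\<^sub>0 \<tau>
  proof
    show "C \<subseteq> {x \<in> Rn q. (\<forall>i<q. 0 \<le> x i) \<and> (\<forall>j<q. \<forall>i\<le>j. x i \<le> x j)}" by fact
    show "coef (unit_vec j) \<in> Rn q" for j by (rule coef_Rn)
    show "coef (W T) \<in> Rn q" for T by (rule coef_Rn)
    fix x j assume x: "x \<in> C" and j: "j < n - m"
    obtain w where w: "w \<in> K" "x = \<Theta> w" using x by (auto simp: C_def)
    have eq: "lform q (coef (unit_vec j)) x = lform q (unit_vec j) w"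
      unfolding w(2) using unit_end[OF j] pos(2) by (intro lform_coef) auto
    have "1 \<le> w j" using w(1) j by (simp add: K_def Q_def)
    then show "1 \<le> lform q (coef (unit_vec j)) x"
      unfolding eq using lform_unit_vec[OF unit_end(1)[OF j]] by simp
    show "x p \<le> lform q (coef (unit_vec j)) x" if "p < q" "coef (unit_vec j) p \<noteq> 0" for p
      using K_above[OF w(1) unit_end(2)[OF j] that(1)] that \<Theta>_apply
      unfolding eq by (simp add: w(2) coef_def)
  next
    show "finite A" by (simp add: A_def)
    show "finite (G i) \<and> G i \<noteq> {}" if "i \<in> A" for i using that G by (simp add: A_def)
    show "0 < a i T" if "i \<in> A" "T \<in> G i" for i T using that G by (simp add: A_def)
    show "i\<^sub>0 \<in> A" "\<tau> \<in> G i\<^sub>0" by fact+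
    show "1 \<le> d (\<sigma> j)" if "j < m" for j using that m_le by (intro d_ge1 \<sigma>_less) simp
    fix x i T assume x: "x \<in> C" and T: "i \<in> A" "T \<in> G i"
    obtain w where w: "w \<in> K" "x = \<Theta> w" using x by (auto simp: C_def)
    note Te = in_exps[OF T]
    show "0 \<le> lform q (\<lambda>p. (coef (W \<tau>) p - coef (W T) p) / 2) x"
      unfolding w(2) lform_gap[OF Te] using K_nonneg[OF w(1) gap_pos[OF Te]] .
    show "x p \<le> lform q (\<lambda>p. (coef (W \<tau>) p - coef (W T) p) / 2) x"
      if "p < q" "(coef (W \<tau>) p - coef (W T) p) / 2 \<noteq> 0" for p
      unfolding w(2) lform_gap[OF Te]
      using K_above[OF w(1) gap_pos[OF Te] that(1)] coef_half_gap[OF \<tau>(1) Te that(1)] that \<Theta>_apply by simp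
  qed
  have total: "nf.total (vcat m s (\<Theta> w)) = H_tilde n I H (lift s w)" if s: "s \<in> Rpos m" and w: "w \<in> K" for s w
  proof -
    let ?z = "vcat m s (\<Theta> w)"
    have dom: "lift s w \<in> tilde_dom n k I" using s w lift_dom by (simp add: K_def)
    have unit: "lform q (coef (unit_vec j)) (\<Theta> w) = w j" if "j < n - m" for j
      using lform_coef[OF unit_vec_in_Rn] lform_unit_vec unit_end(1)[OF that] by simp
    \<comment> \<open>exp t is the factor pulled out of all radicands; it leaves the square roots as
      exp (t / 2) and contributes exactly t to twice the logarithm.\<close>
    define t where "t = lform q (W \<tau>) w"
    have "a i T * exp ((\<Sum>j<m. T (\<sigma> j) * exp (- s j)) + lform q (W T) w) = exp t * nf.summand i T ?z"
      if "i \<in> A" "T \<in> G i" for i T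
    proof -
      have "lform q (nf.gap T) (\<Theta> w) = (t - lform q (W T) w) / 2"
        using lform_gap[OF in_exps[OF that], of w]
          lform_scale_form[of q "1/2" "\<lambda>p. W \<tau> p - W T p" w]
        by (simp add: nf.gap_def[abs_def] half_gap_def lform_diff_form t_def)
      then have "nf.summand i T ?z = a i T * exp (\<Sum>j<m. T (\<sigma> j) * exp (- s j)) * exp (lform q (W T) w - t)"
        by (simp add: nf.summand_def)
      then show ?thesis by (simp add: exp_add exp_diff)
    qed
    then have inner: "(\<Sum>T\<in>G i. a i T * exp ((\<Sum>j<m. T (\<sigma> j) * exp (- s j)) + lform q (W T) w))
        = exp t * (\<Sum>T\<in>G i. nf.summand i T ?z)" if "i \<in> A" for i
      using that unfolding sum_distrib_left by (intro sum.cong) auto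
    have "(\<Sum>i\<in>A. sqrt (\<Sum>T\<in>G i. a i T * exp ((\<Sum>j<m. T (\<sigma> j) * exp (- s j)) + lform q (W T) w)))
        = (\<Sum>i\<in>A. sqrt (exp t) * sqrt (\<Sum>T\<in>G i. nf.summand i T ?z))"
      by (rule sum.cong) (simp_all only: inner real_sqrt_mult)
    also have "\<dots> = sqrt (exp t) * nf.rad ?z" by (simp only: nf.rad_def sum_distrib_left)
    finally have "(\<Sum>i\<in>A. sqrt (\<Sum>T\<in>G i. a i T * exp ((\<Sum>j<m. T (\<sigma> j) * exp (- s j)) + lform q (W T) w)))
        = sqrt (exp t) * nf.rad ?z" .
    moreover have "sqrt (exp t) = exp (t / 2)" by (intro real_sqrt_unique) (auto simp: exp_double[symmetric])
    ultimately have rad: "2 * ln (\<Sum>i\<in>A. sqrt (\<Sum>T\<in>G i. a i T * exp ((\<Sum>j<m. T (\<sigma> j) * exp (- s j)) + lform q (W T) w)))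
        = t + 2 * ln (nf.rad ?z)"
      using nf.rad_pos[of ?z] by (simp add: ln_mult_pos)
    have "H_tilde n I H (lift s w) = 2 * ln 2 + (\<Sum>j<m. 2 * real (d (\<sigma> j)) * (pinch_corr (s j) + s j))
      + (\<Sum>j<n - m. 2 * real (d (\<sigma> (m + j))) * (end_corr (w j) - w j / 2)) + (t + 2 * ln (nf.rad ?z))"
      unfolding H_tilde_sorted(1)[OF dom] W_lift using rad by (simp add: lift_apply)
    also have "(\<Sum>j<m. 2 * real (d (\<sigma> j)) * (pinch_corr (s j) + s j))
       = (\<Sum>j<m. 2 * real (d (\<sigma> j)) * pinch_corr (s j)) + (\<Sum>j<m. 2 * real (d (\<sigma> j)) * s j)"
      by (simp add: distrib_left sum.distrib)
    also have "(\<Sum>j<n - m. 2 * real (d (\<sigma> (m + j))) * (end_corr (w j) - w j / 2))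
       = (\<Sum>j<n - m. 2 * real (d (\<sigma> (m + j))) * end_corr (w j)) - (\<Sum>j<n - m. real (d (\<sigma> (m + j))) * w j)"
      by (simp add: right_diff_distrib sum_subtractf)
    finally have 1: "H_tilde n I H (lift s w) = 2 * ln 2
       + ((\<Sum>j<m. 2 * real (d (\<sigma> j)) * pinch_corr (s j)) + (\<Sum>j<m. 2 * real (d (\<sigma> j)) * s j))
       + ((\<Sum>j<n - m. 2 * real (d (\<sigma> (m + j))) * end_corr (w j)) - (\<Sum>j<n - m. real (d (\<sigma> (m + j))) * w j))
       + (t + 2 * ln (nf.rad ?z))" .
    have "lform q nf.Lam0 (\<Theta> w) = t - (\<Sum>j<n - m. real (d (\<sigma> (m + j))) * w j)"
    proof -
      have "lform q nf.Lam0 (\<Theta> w) = lform q (coef (W \<tau>)) (\<Theta> w)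
         - (\<Sum>j<n - m. lform q (\<lambda>p. real (d (\<sigma> (m + j))) * coef (unit_vec j) p) (\<Theta> w))"
        unfolding nf.Lam0_def[abs_def] lform_diff_form lform_sum_form ..
      then show ?thesis
        using lform_coef[OF W_exps[OF \<tau>(1)]] unit by (simp add: lform_scale_form t_def)
    qed
    moreover have "nf.psi ?z = 2 * ln 2 + (\<Sum>j<m. 2 * real (d (\<sigma> j)) * pinch_corr (s j))
       + (\<Sum>j<n - m. 2 * real (d (\<sigma> (m + j))) * end_corr (w j)) + 2 * ln (nf.rad ?z)"
      unfolding nf.psi_def using unit by simp
    ultimately show ?thesis
      unfolding 1 nf.total_def nf.lform_Lam by simp
  qed
  have "simplified_length_type m q C (H_tilde n I H \<circ> inv_into (Rn (m + q)) \<Psi>)"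
  proof (rule nf.simplified)
    fix x t assume x: "x \<in> C" and t: "1 \<le> (t::real)"
    then obtain w where w: "w \<in> K" "x = \<Theta> w" by (auto simp: C_def)
    have "(\<lambda>i. t * w i) \<in> K" using w(1) t Q_scale order_pattern_scale[of t] by (simp add: K_def)
    moreover have "(\<lambda>i. t * x i) = \<Theta> (\<lambda>i. t * w i)"
      using GL_linear[OF \<Theta>, of w] K_Rn w by (metis subsetD)
    ultimately show "(\<lambda>i. t * x i) \<in> C" by (simp add: C_def)
  next
    fix B
    let ?s = "\<lambda>i. if i < m then 1 else 0 :: real"
    have s: "?s \<in> Rpos m" by (auto simp: Rpos_def Rn_iff)
    obtain R where R: "\<And>x i. x \<in> length_dom n k \<Longrightarrow> H x \<le> B \<Longrightarrow> \<bar>x i\<bar> \<le> R i"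
      using pseudo_length_type_bounded[OF H, of B] by blast
    \<comment> \<open>Properness bounds the old coordinates w; the rows \<open>b p\<close> of
      \<Theta> turn this into a bound for the new coordinates x.\<close>
    define R' where "R' p = (\<Sum>j<q. \<bar>b p j\<bar> * R (\<sigma> (m + j)))" for p
    have "\<forall>p<q. x p \<le> Max (R' ` {..<q})" if x: "x \<in> C" "nf.total (vcat m ?s x) \<le> B" for x
    proof (intro allI impI)
      fix p assume p: "p < q"
      obtain w where w: "w \<in> K" "x = \<Theta> w" using x(1) by (auto simp: C_def)
      have dom: "lift ?s w \<in> tilde_dom n k I" using s w lift_dom by (simp add: K_def)
      have "H_tilde n I H (lift ?s w) \<le> B" using total[OF s w(1)] x(2) w(2) by simp
      then have le: "H (unfold_coords I (lift ?s w)) \<le> B" using H_tilde_eq(1)[OF I dom] by simp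
      have wR: "\<bar>w j\<bar> \<le> R (\<sigma> (m + j))" for j
      proof -
        have "unfold_coords I (lift ?s w) (\<sigma> (m + j)) = w j"
          using \<sigma>_I[of "m + j"] W_lift[of ?s w, THEN fun_cong, of j]
          by (simp add: unfold_coords_def m_def W_apply)
        then show ?thesis using R[OF H_tilde_eq(2)[OF I dom] le, of "\<sigma> (m + j)"] by simp
      qed
      have "x p = (\<Sum>j<q. b p j * w j)" using p by (simp add: w(2) \<Theta>_apply lform_def)
      also have "\<dots> \<le> R' p"
        unfolding R'_def
      proof (rule sum_mono)
        fix j
        have "b p j * w j \<le> \<bar>b p j\<bar> * \<bar>w j\<bar>" by (metis abs_ge_self abs_mult)
        also have "\<dots> \<le> \<bar>b p j\<bar> * R (\<sigma> (m + j))" using wR by (intro mult_left_mono) auto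
        finally show "b p j * w j \<le> \<bar>b p j\<bar> * R (\<sigma> (m + j))" .
      qed
      also have "\<dots> \<le> Max (R' ` {..<q})" using p by (intro Max_ge) auto
      finally show "x p \<le> Max (R' ` {..<q})" .
    qed
    then show "\<exists>R. \<forall>x\<in>C. nf.total (vcat m ?s x) \<le> B \<longrightarrow> (\<forall>p<q. x p \<le> R)" by blast
  next
    fix s x assume s: "s \<in> Rpos m" and "x \<in> C"
    then obtain w where w: "w \<in> K" "x = \<Theta> w" by (auto simp: C_def)
    have dom: "lift s w \<in> tilde_dom n k I" using s w lift_dom by (simp add: K_def)
    have "inv_into (Rn (m + q)) \<Psi> (vcat m s x) = lift s w"
      unfolding w(2) \<Psi>_lift[symmetric]
      using bij_betw_inv_into_left[OF GL_bij[OF \<Psi>]] dom tilde_dom_sorted by blast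
    then have "(H_tilde n I H \<circ> inv_into (Rn (m + q)) \<Psi>) (vcat m s x) = H_tilde n I H (lift s w)" by simp
    then show "0 \<le> (H_tilde n I H \<circ> inv_into (Rn (m + q)) \<Psi>) (vcat m s x)
      \<and> (H_tilde n I H \<circ> inv_into (Rn (m + q)) \<Psi>) (vcat m s x) = nf.total (vcat m s x)"
      using H_tilde_sorted(2)[OF dom] total[OF s w(1)] w(2) by simp
  qed
  then show ?thesis
    using \<Psi> admissible image unfolding w\<^sub>0_def by blast
qed

end

theorem theorem3p26:
  fixes n k :: nat
    and I :: "nat set"
    and H :: "(nat \<Rightarrow> real) \<Rightarrow> real"
  assumes "pseudo_length_type n k H"
    and "I \<subseteq> {..<n}"
  shows "\<exists>P. finite P \<and> partition_on (tilde_dom n k I) P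
    \<and> (\<forall>U\<in>P.
         (\<exists>K. linear_cone (2*n + k) K \<and> U = tilde_dom n k I \<inter> K)
       \<and> (\<exists>\<Psi>\<in>GL (2*n + k). \<exists>C.
            admissible_polytope (2*n + k - card I) C
          \<and> \<Psi> ` U = vprod (card I) (Rpos (card I)) C
          \<and> simplified_length_type (card I) (2*n + k - card I) C
              (H_tilde n I H \<circ> inv_into (Rn (2*n + k)) \<Psi>)))"
proof (rule sorting_permutation[OF assms(2)], rule pseudo_length_type_formula[OF assms(1)])
  fix \<rho> \<sigma> d :: "nat \<Rightarrow> nat" and p :: nat
    and G :: "nat \<Rightarrow> (nat \<Rightarrow> real) set" and a :: "nat \<Rightarrow> (nat \<Rightarrow> real) \<Rightarrow> real"
  assume \<sigma>: "\<And>i. \<rho> (\<sigma> i) = i" "\<And>i. \<sigma> (\<rho> i) = i" "\<And>i. n \<le> i \<Longrightarrow> \<sigma> i = i"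
    "\<And>i. i < n \<Longrightarrow> \<sigma> i < n" "\<And>i. \<sigma> i \<in> I \<longleftrightarrow> i < card I"
  assume f: "\<And>j. j < n \<Longrightarrow> 1 \<le> d j"
    "\<And>i. i < p \<Longrightarrow> finite (G i) \<and> G i \<subseteq> Rn (2*n + k) \<and> (\<forall>T\<in>G i. 0 < a i T)"
    "\<And>x. x \<in> length_dom n k \<Longrightarrow> 0 \<le> H x
       \<and> 0 < (\<Sum>i<p. sqrt (\<Sum>T\<in>G i. a i T * exp (lform (2*n + k) T x)))
       \<and> H x = 2 * ln 2 + (\<Sum>j<n. 2 * real (d j) * - ln (sinh (x j / 2)))
          + 2 * ln (\<Sum>i<p. sqrt (\<Sum>T\<in>G i. a i T * exp (lform (2*n + k) T x)))"
  interpret sorted_pseudo_length n k I H \<sigma> \<rho> d p G a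
    by unfold_locales (fact assms \<sigma> f)+
  let ?f = "\<lambda>v. pattern (W v)"
  let ?P = "(\<lambda>y. {v \<in> tilde_dom n k I. ?f v = y}) ` ?f ` tilde_dom n k I"
  have "finite (?f ` tilde_dom n k I)"
    using finite_range_order_pattern[OF finite_forms, of q] by (rule finite_subset[rotated]) auto
  note P = partition_on_fibres[OF this]
  show ?thesis
  proof (intro exI[of _ ?P] conjI ballI)
    fix U assume "U \<in> ?P"
    then obtain v\<^sub>0 where v\<^sub>0: "v\<^sub>0 \<in> tilde_dom n k I"
      and U: "U = {v \<in> tilde_dom n k I. pattern (W v) = pattern (W v\<^sub>0)}" by blast
    show "\<exists>K. linear_cone (2*n + k) K \<and> U = tilde_dom n k I \<inter> K"
      unfolding U by (rule cell_cone)
    show "\<exists>\<Psi>\<in>GL (2*n + k). \<exists>C. admissible_polytope (2*n + k - card I) C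
          \<and> \<Psi> ` U = vprod (card I) (Rpos (card I)) C
          \<and> simplified_length_type (card I) (2*n + k - card I) C
              (H_tilde n I H \<circ> inv_into (Rn (2*n + k)) \<Psi>)"
      using cell_simplified[OF v\<^sub>0] unfolding mq unfolding m_def q_def U .
  qed (use P in auto)
qed

end
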